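(* Let $V$ be a Euclidean vector space, let $G\subset \mathrm{O}(V)$ be a closed subgroup with algebra of invariants $A=\mathbb{R}[V]^G$, and let $k\geq 2$ be an integer. If $G$ is maximal in its orbit-equivalence class and the decomposition of $V$ into $G$-orbits satisfies $k$-NS, then the algebra of invariants of the diagonal $G$-representation $V^k$ coincides with the algebra of generalized polarizations: $\mathbb{R}[V^k]^G=A^{(k)}$. Moreover, either of the following conditions implies that the decomposition of $V$ into $G$-orbits satisfies $k$-NS: (a) the connected component (of the identity) of $G$ is a torus; (b) $k\geq\dim(V)$.
   Context: A Euclidean vector space is a finite-dimensional real inner product space; $\mathbb{R}[V]$ is its algebra of real polynomial functions, $\mathrm{O}(V)$ its orthogonal group, and $\mathbb{R}[V]^G$ the algebra of $G$-invariant polynomials. Two subgroups $G,G'\subset \mathrm{O}(V)$ are orbit-equivalent if they have the same orbits in $V$; $G$ is maximal in its orbit-equivalence class if it is maximal with respect to inclusion among the subgroups of $\mathrm{O}(V)$ orbit-equivalent to it (equivalently, $G$ is the group of all $g\in \mathrm{O}(V)$ mapping each $G$-orbit to itself). $k$-NS ($k$ normal spaces condition) for the decomposition of $V$ into $G$-orbits: there is a non-empty open subset $U\subset V^k$ such that for all $(x_1,\dots,x_k)\in U$ one has $\nu_{x_1}(L_{x_1})+\cdots+\nu_{x_k}(L_{x_k})=V$, where for $x\in V$, $L_x=G\cdot x$ and $\nu_x(L_x)\subset V$ is the normal space to $L_x$ at $x$ (the orthogonal complement of the tangent space). In orthonormal coordinates $x_i$ on a Euclidean vector space $W$, a sub-algebra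 of $\mathbb{R}[W]$ is called Laplacian if it contains $r^2=\sum_i x_i^2$ and is preserved by $\Delta=\sum_i\partial^2/\partial x_i^2$. The algebra $\mathbb{R}[V]^G$ is Laplacian. For a Laplacian sub-algebra $A\subset\mathbb{R}[V]$, the algebra of generalized polarizations $A^{(k)}\subset\mathbb{R}[V^k]$ is the smallest Laplacian sub-algebra of $\mathbb{R}[V^k]$ (with the product inner product on $V^k$) containing all polynomials $(v_1,\dots,v_k)\mapsto f(v_1)$ with $f\in A$, and all polynomials $(v_1,\dots,v_k)\mapsto\langle v_i,v_j\rangle$ with $1\le i,j\le k$. *)

theory Defs
  imports "HOL-Analysis.Analysis"
begin

definition orthogonal_group :: "('a::real_inner \<Rightarrow> 'a) set" where
  "orthogonal_group = {g. orthogonal_transformation g}"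

definition orthogonal_subgroup :: "('a::euclidean_space \<Rightarrow> 'a) set \<Rightarrow> bool" where
  "orthogonal_subgroup G \<longleftrightarrow>
     G \<subseteq> orthogonal_group \<and> id \<in> G \<and> (\<forall>g\<in>G. \<forall>h\<in>G. g \<circ> h \<in> G) \<and> (\<forall>g\<in>G. inv g \<in> G)"

text \<open>The function type carries the topology of pointwise convergence. On linear maps of a
  finite-dimensional space this is the operator norm topology.\<close>

definition closed_orthogonal_subgroup :: "('a::euclidean_space \<Rightarrow> 'a) set \<Rightarrow> bool" where
  "closed_orthogonal_subgroup G \<longleftrightarrow>
     orthogonal_subgroup G \<and> closedin (top_of_set orthogonal_group) G"

definition orbit :: "('a \<Rightarrow> 'a) set \<Rightarrow> 'a \<Rightarrow> 'a set" where
  "orbit G x = (\<lambda>g. g x) ` G"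

definition orbit_equivalent :: "('a \<Rightarrow> 'a) set \<Rightarrow> ('a \<Rightarrow> 'a) set \<Rightarrow> bool" where
  "orbit_equivalent G H \<longleftrightarrow> range (orbit G) = range (orbit H)"

definition maximal_in_orbit_class :: "('a::euclidean_space \<Rightarrow> 'a) set \<Rightarrow> bool" where
  "maximal_in_orbit_class G \<longleftrightarrow>
     (\<forall>H. orthogonal_subgroup H \<and> orbit_equivalent G H \<and> G \<subseteq> H \<longrightarrow> H = G)"

text \<open>For an embedded submanifold \<open>L\<close> the velocities at \<open>x\<close> of \<open>C\<^sup>1\<close> curves in \<open>L\<close> through \<open>x\<close>
  form its tangent space; orbits of closed subgroups of the orthogonal group are such submanifolds.\<close>

definition tangent_space :: "'a::euclidean_space set \<Rightarrow> 'a \<Rightarrow> 'a set" where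
  "tangent_space L x =
     {v. \<exists>\<gamma> \<epsilon>. \<epsilon> > 0 \<and> \<gamma> C1_differentiable_on {-\<epsilon><..<\<epsilon>} \<and> \<gamma> ` {-\<epsilon><..<\<epsilon>} \<subseteq> L \<and>
              \<gamma> 0 = x \<and> (\<gamma> has_vector_derivative v) (at 0)}"

definition normal_space :: "'a::euclidean_space set \<Rightarrow> 'a \<Rightarrow> 'a set" where
  "normal_space L x = orthogonal_comp (tangent_space L x)"

text \<open>\<open>V\<^sup>k\<close> is the type \<open>'a ^ 'k\<close>, whose inner product is the product inner product.\<close>

definition k_NS :: "'k::finite itself \<Rightarrow> ('a::euclidean_space \<Rightarrow> 'a) set \<Rightarrow> bool" where
  "k_NS (_ :: 'k itself) G \<longleftrightarrow>
     (\<exists>U :: ('a ^ 'k) set. open U \<and> U \<noteq> {} \<and>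
        (\<forall>x\<in>U. {\<Sum>i\<in>UNIV. w i | w. \<forall>i. w i \<in> normal_space (orbit G (x $ i)) (x $ i)} = UNIV))"

definition standard_torus :: "nat \<Rightarrow> (nat \<Rightarrow> complex) set" where
  "standard_torus n = {z. (\<forall>i<n. cmod (z i) = 1) \<and> (\<forall>i\<ge>n. z i = 1)}"

text \<open>An isomorphism of topological groups with some \<open>(S\<^sup>1)\<^sup>n\<close>; between Lie groups such an
  isomorphism is automatically smooth.\<close>

definition is_torus :: "('a::euclidean_space \<Rightarrow> 'a) set \<Rightarrow> bool" where
  "is_torus T \<longleftrightarrow>
     (\<exists>n \<phi> \<psi>. homeomorphism (standard_torus n) T \<phi> \<psi> \<and>
        (\<forall>z\<in>standard_torus n. \<forall>w\<in>standard_torus n. \<phi> (\<lambda>i. z i * w i) = \<phi> z \<circ> \<phi> w))"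

definition polynomial_functions :: "('a::euclidean_space \<Rightarrow> real) set" where
  "polynomial_functions = {f. real_polynomial_function f}"

definition invariant_polynomials :: "('a::euclidean_space \<Rightarrow> 'a) set \<Rightarrow> ('a \<Rightarrow> real) set" where
  "invariant_polynomials G = {f \<in> polynomial_functions. \<forall>g\<in>G. \<forall>x. f (g x) = f x}"

definition diagonal_action :: "('a \<Rightarrow> 'a) set \<Rightarrow> ('a ^ 'k \<Rightarrow> 'a ^ 'k) set" where
  "diagonal_action G = (\<lambda>g v. \<chi> i. g (v $ i)) ` G"

definition polynomial_subalgebra :: "('a::euclidean_space \<Rightarrow> real) set \<Rightarrow> bool" where
  "polynomial_subalgebra A \<longleftrightarrow>
     A \<subseteq> polynomial_functions \<and> (\<forall>c. (\<lambda>x. c) \<in> A) \<and>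
     (\<forall>f\<in>A. \<forall>g\<in>A. (\<lambda>x. f x + g x) \<in> A) \<and> (\<forall>f\<in>A. \<forall>g\<in>A. (\<lambda>x. f x * g x) \<in> A)"

definition laplacian :: "('a::euclidean_space \<Rightarrow> real) \<Rightarrow> 'a \<Rightarrow> real" where
  "laplacian f x = (\<Sum>b\<in>Basis. (deriv ^^ 2) (\<lambda>t. f (x + t *\<^sub>R b)) 0)"

definition laplacian_algebra :: "('a::euclidean_space \<Rightarrow> real) set \<Rightarrow> bool" where
  "laplacian_algebra A \<longleftrightarrow>
     polynomial_subalgebra A \<and> (\<lambda>x. \<Sum>b\<in>Basis. (x \<bullet> b)\<^sup>2) \<in> A \<and> (\<forall>f\<in>A. laplacian f \<in> A)"

text \<open>The index type has no distinguished element, so the index \<open>i0\<close> of the factor called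
  \<open>v\<^sub>1\<close> is a parameter.\<close>

definition generalized_polarizations ::
    "'k::finite \<Rightarrow> ('a::euclidean_space \<Rightarrow> real) set \<Rightarrow> ('a ^ 'k \<Rightarrow> real) set" where
  "generalized_polarizations i0 A =
     laplacian_algebra hull ({\<lambda>v. f (v $ i0) | f. f \<in> A} \<union> {\<lambda>v. v $ i \<bullet> v $ j | i j. True})"

end

theory Submission
  imports Defs
begin

text \<open>
  Let \<open>L\<close> be the algebra of generalized polarizations and \<open>B\<close> the algebra of invariants on \<open>V\<^sup>k\<close>.
  If \<open>l\<close> and \<open>F\<close> lie in a Laplacian algebra, then so does \<open>x \<mapsto> l(\<nabla>F x)\<close>. Applied to
  \<open>l = f(v\<^sub>1)\<close> this shows that the values of all \<open>f \<in> A\<close> at linear combinations of the vectors \<open>v\<^sub>i\<close>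
  and \<open>\<nabla>h(v\<^sub>i)\<close>, \<open>h \<in> A\<close>, belong to \<open>L\<close>. Generic normal spaces of orbits are spanned by gradients of
  invariants, so that under \<open>k\<close>-NS these vectors span \<open>V\<close> for generic \<open>x\<close>. If \<open>y\<close> has the same
  \<open>L\<close>-values as \<open>x\<close>, mapping the vectors at \<open>x\<close> to those at \<open>y\<close> defines an isometry that preserves
  all of \<open>A\<close>, hence all \<open>G\<close>-orbits; by maximality it lies in \<open>G\<close>, and \<open>x\<close> and \<open>y\<close> lie in one orbit. Thus
  \<open>L\<close> separates generic orbits, which forces \<open>L = B\<close>: a second order operator built from the
  Laplacian and the Euler field is symmetric on \<open>L\<^sup>2\<close> of a ball with a weight and preserves \<open>L\<close> and \<open>B\<close>,
  so that an eigenfunction in \<open>B\<close> orthogonal to the corresponding eigenspace of \<open>L\<close> is orthogonal to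
  \<open>L\<close>, and Stone--Weierstrass shows that it vanishes.

  For (a), a curve in a \<open>G\<close>-orbit stays in an orbit of the commutative identity component, whose
  invariant subspaces of dimension at most two provide enough normal vectors at two generic points.
  For (b), every vector is normal to its own orbit.
\<close>

subsection \<open>Gradients of polynomial functions\<close>

text \<open>Separating orbits does not by itself make a subalgebra exhaust the invariants: on the
  line, x^2 and x^3 separate points without generating x. The passage from separation to equality
  must therefore use closure under the Laplacian. The Laplacian alone is nilpotent on polynomials of
  bounded degree and has no useful eigenfunctions there; the Euler terms give distinct degrees
  distinct eigenvalues, and the weight vanishes on the boundary of the ball, so that integration by
  parts leaves no boundary term.

  Separation is known only on an open set. It has the form \<open>q x < 1\<close> with
  \<open>q\<close> in the algebra, and the cutoff \<open>max 0 (1 - q x)\<close> is then still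
  constant on the level sets of the algebra.

  Tangent vectors are velocities of curves, and orbits are never given a manifold structure. One
  inclusion is enough each time: every open set has a point where normal vectors are gradients of
  invariants, and conversely the gradient of a quadratic form that is constant along curves in an
  orbit is normal to it.\<close>

definition grad :: "('a::euclidean_space \<Rightarrow> real) \<Rightarrow> 'a \<Rightarrow> 'a" where
  "grad f x = (\<Sum>b\<in>Basis. frechet_derivative f (at x) b *\<^sub>R b)"

lemma
  shows real_polynomial_linear: "bounded_linear f \<Longrightarrow> real_polynomial_function f"
    and real_polynomial_const: "real_polynomial_function (\<lambda>x. c)"
    and real_polynomial_add:
      "real_polynomial_function f \<Longrightarrow> real_polynomial_function g \<Longrightarrow> real_polynomial_function (\<lambda>x. f x + g x)"
    and real_polynomial_mult:
      "real_polynomial_function f \<Longrightarrow> real_polynomial_function g \<Longrightarrow> real_polynomial_function (\<lambda>x. f x * g x)"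
  by auto

lemma grad_eqI:
  assumes "(f has_derivative (\<lambda>h. v \<bullet> h)) (at x)"
  shows "grad f x = v"
  unfolding grad_def frechet_derivative_at[OF assms, symmetric]
  by (rule euclidean_representation)

lemma has_derivative_grad_of:
  assumes "f differentiable (at x)"
  shows "(f has_derivative (\<lambda>h. grad f x \<bullet> h)) (at x)"
proof -
  have d: "(f has_derivative frechet_derivative f (at x)) (at x)"
    using assms frechet_derivative_works by blast
  have lin: "linear (frechet_derivative f (at x))"
    using d by (simp add: has_derivative_linear)
  have "frechet_derivative f (at x) h = grad f x \<bullet> h" for h
  proof -
    have "frechet_derivative f (at x) h = frechet_derivative f (at x) (\<Sum>b\<in>Basis. (h \<bullet> b) *\<^sub>R b)"
      by (simp add: euclidean_representation)
    also have "\<dots> = (\<Sum>b\<in>Basis. (h \<bullet> b) * frechet_derivative f (at x) b)"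
      using lin by (simp add: linear_sum linear_cmul)
    also have "\<dots> = grad f x \<bullet> h"
      unfolding grad_def by (simp add: inner_sum_left inner_commute[of h] mult.commute)
    finally show ?thesis .
  qed
  then show ?thesis using d by (metis (no_types, lifting) ext)
qed

lemma has_derivative_grad:
  assumes "real_polynomial_function f"
  shows "(f has_derivative (\<lambda>h. grad f x \<bullet> h)) (at x)"
  by (rule has_derivative_grad_of) (rule differentiable_at_real_polynomial_function[OF assms])

lemma has_real_derivative_line:
  assumes "real_polynomial_function f"
  shows "((\<lambda>t. f (x + t *\<^sub>R b)) has_real_derivative grad f (x + t *\<^sub>R b) \<bullet> b) (at t)"
proof -
  have "((\<lambda>t. f (x + t *\<^sub>R b)) has_derivative (\<lambda>h. grad f (x + t *\<^sub>R b) \<bullet> (h *\<^sub>R b))) (at t)"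
    by (rule has_derivative_compose[OF _ has_derivative_grad[OF assms]])
      (auto intro!: derivative_eq_intros)
  then show ?thesis
    by (simp add: has_field_derivative_def mult_commute_abs)
qed

lemma grad_const [simp]: "grad (\<lambda>x. c) = (\<lambda>x. 0)"
  by (intro ext grad_eqI) simp

lemma grad_add:
  assumes "real_polynomial_function f" "real_polynomial_function g"
  shows "grad (\<lambda>x. f x + g x) = (\<lambda>x. grad f x + grad g x)"
  by (intro ext grad_eqI)
    (auto intro!: derivative_eq_intros has_derivative_grad[OF assms(1)] has_derivative_grad[OF assms(2)]
      simp: inner_add_left)

lemma grad_mult:
  assumes "real_polynomial_function f" "real_polynomial_function g"
  shows "grad (\<lambda>x. f x * g x) = (\<lambda>x. f x *\<^sub>R grad g x + g x *\<^sub>R grad f x)"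
  by (intro ext grad_eqI)
    (auto intro!: derivative_eq_intros has_derivative_grad[OF assms(1)] has_derivative_grad[OF assms(2)]
      simp: inner_add_left)

lemma grad_cmul:
  assumes "real_polynomial_function f"
  shows "grad (\<lambda>x. c * f x) = (\<lambda>x. c *\<^sub>R grad f x)"
  using grad_mult[OF real_polynomial_const assms] by simp

lemma grad_diff:
  assumes "real_polynomial_function f" "real_polynomial_function g"
  shows "grad (\<lambda>x. f x - g x) = (\<lambda>x. grad f x - grad g x)"
  by (intro ext grad_eqI)
    (auto intro!: derivative_eq_intros has_derivative_grad[OF assms(1)] has_derivative_grad[OF assms(2)]
      simp: inner_diff_left)

lemma grad_sum:
  assumes "\<And>i. i \<in> I \<Longrightarrow> real_polynomial_function (f i)"
  shows "grad (\<lambda>x. \<Sum>i\<in>I. f i x) = (\<lambda>x. \<Sum>i\<in>I. grad (f i) x)"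
  by (intro ext grad_eqI)
    (auto intro!: derivative_eq_intros has_derivative_grad[OF assms] simp: inner_sum_left)

lemma grad_linear:
  assumes "bounded_linear f"
  shows "grad f = (\<lambda>x. \<Sum>b\<in>Basis. f b *\<^sub>R b)"
proof (intro ext grad_eqI)
  fix x
  have "f h = (\<Sum>b\<in>Basis. f b *\<^sub>R b) \<bullet> h" for h
  proof -
    have "f h = f (\<Sum>b\<in>Basis. (h \<bullet> b) *\<^sub>R b)" by (simp add: euclidean_representation)
    also have "\<dots> = (\<Sum>b\<in>Basis. (h \<bullet> b) * f b)"
      using assms by (simp add: linear_sum linear_cmul bounded_linear.linear)
    finally show ?thesis by (simp add: inner_sum_left inner_commute[of h] mult.commute)
  qed
  then show "(f has_derivative (\<lambda>h. (\<Sum>b\<in>Basis. f b *\<^sub>R b) \<bullet> h)) (at x)"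
    using bounded_linear_imp_has_derivative[OF assms] by (metis (no_types, lifting) ext)
qed

lemma polynomial_function_grad:
  assumes "real_polynomial_function f"
  shows "polynomial_function (grad f)"
  using assms
proof (induction rule: real_polynomial_function.induct)
  case (linear f)
  then show ?case by (simp add: grad_linear)
next
  case (mult f g)
  then show ?case
    by (simp add: grad_mult polynomial_function_add polynomial_function_mult real_polynomial_function_eq)
qed (auto simp: grad_add)

lemma real_polynomial_inner:
  fixes f g :: "'a::euclidean_space \<Rightarrow> 'b::euclidean_space"
  assumes "polynomial_function f" "polynomial_function g"
  shows "real_polynomial_function (\<lambda>x. f x \<bullet> g x)"
proof -
  have "(\<lambda>x. f x \<bullet> g x) = (\<lambda>x. \<Sum>b\<in>Basis. (f x \<bullet> b) * (g x \<bullet> b))"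
    by (intro ext euclidean_inner)
  moreover have "real_polynomial_function (\<lambda>x. \<Sum>b\<in>Basis. (f x \<bullet> b) * (g x \<bullet> b))"
    using assms by (intro real_polynomial_function_sum real_polynomial_mult)
      (auto simp: polynomial_function_iff_Basis_inner)
  ultimately show ?thesis by simp
qed

lemma real_polynomial_inner_const:
  fixes f :: "'a::euclidean_space \<Rightarrow> 'b::euclidean_space"
  shows "polynomial_function f \<Longrightarrow> real_polynomial_function (\<lambda>x. f x \<bullet> c)"
  by (simp add: real_polynomial_inner)

lemma real_polynomial_compose:
  fixes f :: "'a::euclidean_space \<Rightarrow> 'b::euclidean_space"
  assumes "polynomial_function f" "real_polynomial_function g"
  shows "real_polynomial_function (\<lambda>x. g (f x))"
  using real_polynomial_function_compose[OF assms] by (simp add: o_def)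

lemma continuous_on_grad:
  assumes "real_polynomial_function f"
  shows "continuous_on S (grad f)"
  using polynomial_function_grad[OF assms] by (rule continuous_on_polymonial_function)

lemma continuous_on_real_polynomial:
  fixes f :: "'a::euclidean_space \<Rightarrow> real"
  assumes "real_polynomial_function f"
  shows "continuous_on S f"
  using assms by (simp add: real_polynomial_function_eq continuous_on_polymonial_function)

section \<open>Hessians and the Laplacian of polynomial functions\<close>

definition hess :: "('a::euclidean_space \<Rightarrow> real) \<Rightarrow> 'a \<Rightarrow> 'a \<Rightarrow> 'a \<Rightarrow> real" where
  "hess f x b c = grad (\<lambda>y. grad f y \<bullet> b) x \<bullet> c"

lemma real_polynomial_grad_inner:
  "real_polynomial_function f \<Longrightarrow> real_polynomial_function (\<lambda>y. grad f y \<bullet> b)"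
  by (intro real_polynomial_inner_const polynomial_function_grad)

lemma hess_add:
  assumes "real_polynomial_function f" "real_polynomial_function g"
  shows "hess (\<lambda>x. f x + g x) x b c = hess f x b c + hess g x b c"
  using assms by (simp add: hess_def grad_add inner_add_left real_polynomial_grad_inner)

lemma hess_mult:
  assumes "real_polynomial_function f" "real_polynomial_function g"
  shows "hess (\<lambda>x. f x * g x) x b c = f x * hess g x b c + g x * hess f x b c
    + (grad f x \<bullet> b) * (grad g x \<bullet> c) + (grad f x \<bullet> c) * (grad g x \<bullet> b)"
  using assms
  by (simp add: hess_def grad_add grad_mult inner_add_left real_polynomial_grad_inner
      real_polynomial_mult)

lemma hess_linear: "bounded_linear f \<Longrightarrow> hess f x b c = 0"
  by (simp add: hess_def grad_linear)

lemma hess_const: "hess (\<lambda>x. k) x b c = 0"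
  by (simp add: hess_def)

text \<open>The product rule produces the two mixed terms together, and exchanging the directions
  swaps them; induction on the polynomial thus replaces Schwarz's theorem.\<close>

lemma hess_sym:
  assumes "real_polynomial_function f"
  shows "hess f x b c = hess f x c b"
  using assms
proof (induction rule: real_polynomial_function.induct)
  case (mult f g)
  then show ?case by (simp add: hess_mult algebra_simps)
qed (simp_all add: hess_add hess_linear hess_const)

lemma hess_linear_left:
  assumes "real_polynomial_function f"
  shows "linear (\<lambda>b. hess f x b c)"
  by (subst hess_sym[OF assms]) (auto intro!: linearI simp: hess_def inner_add_right)

lemma hess_linear_right: "linear (\<lambda>c. hess f x b c)"
  unfolding hess_def by (intro linearI) (auto simp: inner_add_right)

lemma laplacian_eq_hess:
  assumes "real_polynomial_function f"
  shows "laplacian f x = (\<Sum>b\<in>Basis. hess f x b b)"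
proof -
  have "(deriv ^^ 2) (\<lambda>t. f (x + t *\<^sub>R b)) 0 = hess f x b b" for b
  proof -
    have "deriv (\<lambda>t. f (x + t *\<^sub>R b)) = (\<lambda>t. grad f (x + t *\<^sub>R b) \<bullet> b)"
      using has_real_derivative_line[OF assms] by (intro ext DERIV_imp_deriv)
    moreover have "deriv (\<lambda>t. grad f (x + t *\<^sub>R b) \<bullet> b) 0 = hess f x b b"
      using has_real_derivative_line[OF real_polynomial_grad_inner[OF assms, of b], of x b 0]
      by (simp add: DERIV_imp_deriv hess_def)
    ultimately show ?thesis by (simp add: numeral_2_eq_2)
  qed
  then show ?thesis by (simp add: laplacian_def)
qed

lemma real_polynomial_laplacian:
  assumes "real_polynomial_function f"
  shows "real_polynomial_function (laplacian f)"
proof -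
  have "laplacian f = (\<lambda>x. \<Sum>b\<in>Basis. hess f x b b)"
    using laplacian_eq_hess[OF assms] by blast
  moreover have "real_polynomial_function (\<lambda>x. \<Sum>b\<in>Basis. hess f x b b)"
    unfolding hess_def
    by (intro real_polynomial_function_sum real_polynomial_grad_inner assms) auto
  ultimately show ?thesis by simp
qed

lemma laplacian_add:
  assumes "real_polynomial_function f" "real_polynomial_function g"
  shows "laplacian (\<lambda>x. f x + g x) = (\<lambda>x. laplacian f x + laplacian g x)"
  using assms by (auto simp: laplacian_eq_hess real_polynomial_add hess_add sum.distrib)

text \<open>The cross term is the source of the closure properties of Laplacian algebras: it
  expresses the inner product of two gradients through Laplacians and products.\<close>

lemma laplacian_mult:
  assumes "real_polynomial_function f" "real_polynomial_function g"
  shows "laplacian (\<lambda>x. f x * g x) =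
    (\<lambda>x. f x * laplacian g x + g x * laplacian f x + 2 * (grad f x \<bullet> grad g x))"
proof
  fix x
  have "(\<Sum>b\<in>Basis. hess (\<lambda>x. f x * g x) x b b) = (\<Sum>b\<in>Basis. f x * hess g x b b + g x * hess f x b b
    + 2 * ((grad f x \<bullet> b) * (grad g x \<bullet> b)))"
    by (intro sum.cong refl) (simp add: hess_mult[OF assms])
  then show "laplacian (\<lambda>x. f x * g x) x = f x * laplacian g x + g x * laplacian f x + 2 * (grad f x \<bullet> grad g x)"
    unfolding euclidean_inner[of "grad f x" "grad g x"] laplacian_eq_hess[OF real_polynomial_mult[OF assms]]
      laplacian_eq_hess[OF assms(1)] laplacian_eq_hess[OF assms(2)] sum_distrib_left
    by (simp add: sum.distrib)
qed

lemma laplacian_const: "laplacian (\<lambda>x. c) = (\<lambda>x. 0)"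
  by (rule ext) (simp only: laplacian_eq_hess[OF real_polynomial_const] hess_const sum.neutral_const)

lemma laplacian_cmul:
  assumes "real_polynomial_function f"
  shows "laplacian (\<lambda>x. c * f x) = (\<lambda>x. c * laplacian f x)"
  using laplacian_mult[OF real_polynomial_const assms] by (simp add: laplacian_const)

section \<open>Equivariance under orthogonal maps\<close>

lemma grad_orthogonal:
  fixes g :: "'a::euclidean_space \<Rightarrow> 'a"
  assumes f: "real_polynomial_function f" and g: "orthogonal_transformation g"
  shows "grad (\<lambda>x. f (g x)) x \<bullet> h = grad f (g x) \<bullet> g h"
proof -
  have lin: "bounded_linear g"
    using g by (simp add: orthogonal_transformation_def linear_conv_bounded_linear)
  have d: "((\<lambda>x. f (g x)) has_derivative (\<lambda>h. grad f (g x) \<bullet> g h)) (at x)"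
    by (rule has_derivative_compose[OF bounded_linear_imp_has_derivative[OF lin]
          has_derivative_grad[OF f]])
  have "(\<lambda>x. f (g x)) differentiable (at x)" using d differentiable_def by blast
  from has_derivative_grad_of[OF this] d
  show ?thesis by (metis (no_types, lifting) has_derivative_unique)
qed

lemma polynomial_orthogonal_compose:
  fixes g :: "'a::euclidean_space \<Rightarrow> 'a"
  assumes f: "real_polynomial_function f" and g: "orthogonal_transformation g"
  shows "real_polynomial_function (\<lambda>x. f (g x))"
proof (rule real_polynomial_compose[OF polynomial_function_bounded_linear f])
  show "bounded_linear g"
    using g by (simp add: orthogonal_transformation_def linear_conv_bounded_linear)
qed

text \<open>The trace of a bilinear form is the same in every orthonormal basis: expanding
  \<open>g b\<close> in \<open>Basis\<close> produces the product of the matrix of \<open>g\<close>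
  with its transpose, which is the identity.\<close>

lemma trace_orthogonal:
  fixes g :: "'a::euclidean_space \<Rightarrow> 'a"
  assumes g: "orthogonal_transformation g"
    and Ql: "\<And>c. linear (\<lambda>b. Q b c)" and Qr: "\<And>b. linear (Q b)"
  shows "(\<Sum>b\<in>Basis. Q (g b) (g b)) = (\<Sum>b\<in>Basis. Q b b :: real)"
proof -
  obtain h where h: "orthogonal_transformation h" "\<And>x. g (h x) = x" "\<And>x. h (g x) = x"
    using orthogonal_transformation_inv[OF g] orthogonal_transformation_bij[OF g]
    by (metis bij_inv_eq_iff)
  have adj: "g x \<bullet> y = x \<bullet> h y" for x y
    using g h by (metis orthogonal_transformation_def)
  have "Q (g b) (g b) = (\<Sum>c\<in>Basis. \<Sum>d\<in>Basis. (g b \<bullet> c) * (g b \<bullet> d) * Q c d)" for b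
  proof -
    have "Q (g b) (g b) = Q (\<Sum>c\<in>Basis. (g b \<bullet> c) *\<^sub>R c) (g b)"
      by (simp add: euclidean_representation)
    also have "\<dots> = (\<Sum>c\<in>Basis. (g b \<bullet> c) * Q c (g b))"
      using linear_sum[OF Ql[of "g b"], of "\<lambda>c. (g b \<bullet> c) *\<^sub>R c" Basis] linear_cmul[OF Ql[of "g b"]]
      by simp
    also have "\<dots> = (\<Sum>c\<in>Basis. (g b \<bullet> c) * Q c (\<Sum>d\<in>Basis. (g b \<bullet> d) *\<^sub>R d))"
      by (simp add: euclidean_representation)
    also have "\<dots> = (\<Sum>c\<in>Basis. (g b \<bullet> c) * (\<Sum>d\<in>Basis. (g b \<bullet> d) * Q c d))"
      using Qr by (simp add: linear_sum linear_cmul)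
    finally show ?thesis by (simp add: sum_distrib_left mult.assoc)
  qed
  then have "(\<Sum>b\<in>Basis. Q (g b) (g b))
    = (\<Sum>b\<in>Basis. \<Sum>c\<in>Basis. \<Sum>d\<in>Basis. (g b \<bullet> c) * (g b \<bullet> d) * Q c d)" by simp
  also have "\<dots> = (\<Sum>c\<in>Basis. \<Sum>b\<in>Basis. \<Sum>d\<in>Basis. (g b \<bullet> c) * (g b \<bullet> d) * Q c d)"
    by (rule sum.swap)
  also have "\<dots> = (\<Sum>c\<in>Basis. \<Sum>d\<in>Basis. \<Sum>b\<in>Basis. (g b \<bullet> c) * (g b \<bullet> d) * Q c d)"
    by (intro sum.cong refl sum.swap)
  also have "\<dots> = (\<Sum>c\<in>Basis. \<Sum>d\<in>Basis. (c \<bullet> d) * Q c d)"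
  proof (intro sum.cong refl)
    fix c d :: 'a
    have "(\<Sum>b\<in>Basis. (g b \<bullet> c) * (g b \<bullet> d)) = h c \<bullet> h d"
      unfolding adj by (subst (3) euclidean_inner) (simp add: inner_commute)
    also have "\<dots> = c \<bullet> d" using h by (simp add: orthogonal_transformation_def)
    finally show "(\<Sum>b\<in>Basis. (g b \<bullet> c) * (g b \<bullet> d) * Q c d) = (c \<bullet> d) * Q c d"
      by (simp flip: sum_distrib_right)
  qed
  also have "\<dots> = (\<Sum>c\<in>Basis. Q c c)"
    by (intro sum.cong refl) (simp add: inner_Basis if_distrib[of "\<lambda>x. x * _"] cong: if_cong)
  finally show ?thesis .
qed

lemma laplacian_orthogonal:
  fixes g :: "'a::euclidean_space \<Rightarrow> 'a"
  assumes f: "real_polynomial_function f" and g: "orthogonal_transformation g"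
  shows "laplacian (\<lambda>x. f (g x)) x = laplacian f (g x)"
proof -
  have "hess (\<lambda>x. f (g x)) x b c = hess f (g x) (g b) (g c)" for b c
    using grad_orthogonal[OF real_polynomial_grad_inner[OF f] g, of "g b" x c]
    by (simp add: hess_def grad_orthogonal[OF f g])
  then have "laplacian (\<lambda>x. f (g x)) x = (\<Sum>b\<in>Basis. hess f (g x) (g b) (g b))"
    using laplacian_eq_hess[OF polynomial_orthogonal_compose[OF f g]] by simp
  also have "\<dots> = laplacian f (g x)"
    unfolding laplacian_eq_hess[OF f]
    by (rule trace_orthogonal[OF g, of "hess f (g x)"]) (rule hess_linear_left[OF f] hess_linear_right)+
  finally show ?thesis .
qed

subsection \<open>Polynomial families in a linear space of functions\<close>

definition fun_subspace :: "('a \<Rightarrow> real) set \<Rightarrow> bool" where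
  "fun_subspace S \<longleftrightarrow> (\<lambda>x. 0) \<in> S \<and> (\<forall>f\<in>S. \<forall>g\<in>S. (\<lambda>x. f x + g x) \<in> S) \<and> (\<forall>c. \<forall>f\<in>S. (\<lambda>x. c * f x) \<in> S)"

lemma fun_subspaceD:
  assumes "fun_subspace S"
  shows "(\<lambda>x. 0) \<in> S" "f \<in> S \<Longrightarrow> g \<in> S \<Longrightarrow> (\<lambda>x. f x + g x) \<in> S" "f \<in> S \<Longrightarrow> (\<lambda>x. c * f x) \<in> S"
  using assms by (auto simp: fun_subspace_def)

lemma fun_subspace_diff:
  assumes "fun_subspace S" "f \<in> S" "g \<in> S"
  shows "(\<lambda>x. f x - g x) \<in> S"
  using fun_subspaceD(2)[OF assms(1,2) fun_subspaceD(3)[OF assms(1,3), of "-1"]] by simp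

lemma fun_subspace_sum:
  assumes "fun_subspace S" "\<And>i. i \<in> I \<Longrightarrow> f i \<in> S"
  shows "(\<lambda>x. \<Sum>i\<in>I. f i x) \<in> S"
  using assms(2)
  by (induction I rule: infinite_finite_induct) (auto intro: fun_subspaceD[OF assms(1)])

text \<open>Subtracting \<open>2 ^ Suc N\<close> times the family from its value at
  \<open>2 * s\<close> cancels the top coefficient and multiplies each lower one by the nonzero
  constant \<open>c i\<close>. This elimination takes the place of a Vandermonde
  determinant.\<close>

lemma coefficient_in_subspace:
  assumes S: "fun_subspace S" and "\<And>s. (\<lambda>x. \<Sum>j\<le>N. s ^ j * a j x) \<in> S" and "j \<le> N"
  shows "a j \<in> S"
  using assms(2,3)
proof (induction N arbitrary: a j)
  case 0
  then show ?case using "0.prems"(1)[of 1] by simp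
next
  case (Suc N)
  define c where "c i = (2 ^ i - 2 ^ Suc N :: real)" for i
  have c0: "c i \<noteq> 0" if "i \<le> N" for i
  proof -
    have "(2::real) ^ i < 2 ^ Suc N" using that by (intro power_strict_increasing) auto
    then show ?thesis by (simp add: c_def)
  qed
  have "(\<lambda>x. \<Sum>i\<le>N. s ^ i * (c i * a i x)) \<in> S" for s
  proof -
    have "(\<lambda>x. (\<Sum>i\<le>Suc N. (2 * s) ^ i * a i x) + (- (2 ^ Suc N)) * (\<Sum>i\<le>Suc N. s ^ i * a i x)) \<in> S"
      by (intro fun_subspaceD(2)[OF S] fun_subspaceD(3)[OF S] Suc.prems(1))
    moreover have "(\<Sum>i\<le>Suc N. (2 * s) ^ i * a i x) + (- (2 ^ Suc N)) * (\<Sum>i\<le>Suc N. s ^ i * a i x)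
      = (\<Sum>i\<le>N. s ^ i * (c i * a i x))" for x
    proof -
      have "(\<Sum>i\<le>Suc N. (2 * s) ^ i * a i x) + (- (2 ^ Suc N)) * (\<Sum>i\<le>Suc N. s ^ i * a i x)
        = (\<Sum>i\<le>Suc N. s ^ i * (c i * a i x))"
        by (simp only: sum_distrib_left flip: sum.distrib)
          (auto intro!: sum.cong simp: c_def power_mult_distrib algebra_simps)
      then show ?thesis by (simp add: c_def)
    qed
    ultimately show ?thesis by simp
  qed
  then have *: "(\<lambda>x. c i * a i x) \<in> S" if "i \<le> N" for i
    using Suc.IH[of "\<lambda>i x. c i * a i x" i] that by blast
  have low: "a i \<in> S" if "i \<le> N" for i
    using fun_subspaceD(3)[OF S *[OF that], of "inverse (c i)"] c0[OF that]
    by (simp add: mult.assoc[symmetric])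
  show ?case
  proof (cases "j = Suc N")
    case True
    have "(\<lambda>x. (\<Sum>i\<le>Suc N. 1 ^ i * a i x) - (\<Sum>i\<le>N. a i x)) \<in> S"
      by (intro fun_subspace_diff[OF S] Suc.prems(1) fun_subspace_sum[OF S] low) simp
    then show ?thesis using True by simp
  next
    case False
    then show ?thesis using Suc.prems low by simp
  qed
qed

section \<open>Expansion of a polynomial in one real parameter\<close>

lemma sum_pad_zero:
  fixes a :: "nat \<Rightarrow> real"
  assumes "m \<le> n" "\<And>j. j > m \<Longrightarrow> a j = 0"
  shows "(\<Sum>j\<le>n. s ^ j * a j) = (\<Sum>j\<le>m. s ^ j * a j)"
  by (rule sum.mono_neutral_right) (use assms in auto)

text \<open>Coefficients past \<open>N\<close> are required to vanish, so that sums and Cauchy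
  products can be formed from expansions of different lengths.\<close>

definition expands :: "('a \<times> real \<Rightarrow> real) \<Rightarrow> nat \<Rightarrow> (nat \<Rightarrow> 'a::euclidean_space \<Rightarrow> real) \<Rightarrow> bool" where
  "expands p N a \<longleftrightarrow> (\<forall>j. real_polynomial_function (a j)) \<and> (\<forall>j>N. \<forall>x. a j x = 0) \<and>
    (\<forall>x s. p (x, s) = (\<Sum>j\<le>N. s ^ j * a j x))"

lemma polynomial_expansion:
  fixes p :: "'a::euclidean_space \<times> real \<Rightarrow> real"
  assumes "real_polynomial_function p"
  shows "\<exists>N a. expands p N a"
  using assms
proof (induction rule: real_polynomial_function.induct)
  case (linear f)
  have eq: "f (x, s) = f (x, 0) + s * f (0, 1)" for x s
  proof -
    have "f ((x, 0) + s *\<^sub>R (0, 1)) = f (x, 0) + s *\<^sub>R f (0, 1)"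
      using linear_add[OF bounded_linear.linear[OF linear]] linear_cmul[OF bounded_linear.linear[OF linear]]
      by presburger
    then show ?thesis by simp
  qed
  have bl: "bounded_linear (\<lambda>x. f (x, 0))"
    using bounded_linear_compose[OF linear bounded_linear_Pair[OF bounded_linear_ident bounded_linear_zero]]
    by simp
  have sum: "f (x, s) = (\<Sum>j\<le>1. s ^ j * (if j = 0 then f (x, 0) else if j = 1 then f (0,1) else 0))" for x s
    by (subst eq) simp
  have pol: "real_polynomial_function (\<lambda>x. if j = 0 then f (x, 0) else if j = 1 then f (0,1) else 0)"
    for j :: nat
    by (cases "j = 0"; cases "j = 1") (simp_all add: bl real_polynomial_linear real_polynomial_const)
  have "expands f 1 (\<lambda>j x. if j = 0 then f (x, 0) else if j = 1 then f (0,1) else 0)"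
    unfolding expands_def by (intro conjI allI impI sum pol) simp
  then show ?case by blast
next
  case (const c)
  have "expands (\<lambda>_. c) 0 (\<lambda>j x. if j = 0 then c else 0)"
    by (simp add: expands_def real_polynomial_const)
  then show ?case by blast
next
  case (add f g)
  from add.IH obtain M a N b where
    a: "\<forall>j. real_polynomial_function (a j)" "\<forall>j>M. \<forall>x. a j x = 0" "\<forall>x s. f (x, s) = (\<Sum>j\<le>M. s ^ j * a j x)"
    and b: "\<forall>j. real_polynomial_function (b j)" "\<forall>j>N. \<forall>x. b j x = 0" "\<forall>x s. g (x, s) = (\<Sum>j\<le>N. s ^ j * b j x)"
    unfolding expands_def by blast
  have "f (x, s) + g (x, s) = (\<Sum>j\<le>max M N. s ^ j * (a j x + b j x))" for x s
    using sum_pad_zero[of M "max M N" "\<lambda>j. a j x" s] sum_pad_zero[of N "max M N" "\<lambda>j. b j x" s] a b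
    by (simp add: algebra_simps sum.distrib)
  then have "expands (\<lambda>x. f x + g x) (max M N) (\<lambda>j x. a j x + b j x)"
    using a b by (simp add: expands_def real_polynomial_add)
  then show ?case by blast
next
  case (mult f g)
  from mult.IH obtain M a N b where
    a: "\<forall>j. real_polynomial_function (a j)" "\<forall>j>M. \<forall>x. a j x = 0" "\<forall>x s. f (x, s) = (\<Sum>j\<le>M. s ^ j * a j x)"
    and b: "\<forall>j. real_polynomial_function (b j)" "\<forall>j>N. \<forall>x. b j x = 0" "\<forall>x s. g (x, s) = (\<Sum>j\<le>N. s ^ j * b j x)"
    unfolding expands_def by blast
  have sum: "f (x, s) * g (x, s) = (\<Sum>j\<le>M + N. s ^ j * (\<Sum>k\<le>j. a k x * b (j - k) x))" for x s
    using polynomial_product[of M "\<lambda>j. a j x" N "\<lambda>j. b j x" s] a b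
    by (simp add: Set_Interval.atLeast0AtMost mult.commute)
  have pol: "real_polynomial_function (\<lambda>x. \<Sum>k\<le>j. a k x * b (j - k) x)" for j
    using a b by (intro real_polynomial_function_sum real_polynomial_mult) auto
  have zero: "(\<Sum>k\<le>j. a k x * b (j - k) x) = 0" if "j > M + N" for j x
  proof (rule sum.neutral, rule ballI)
    fix k assume "k \<in> {..j}"
    then have "k > M \<or> j - k > N" using that by auto
    then show "a k x * b (j - k) x = 0" using a b by auto
  qed
  have "expands (\<lambda>x. f x * g x) (M + N) (\<lambda>j x. \<Sum>k\<le>j. a k x * b (j - k) x)"
    unfolding expands_def by (intro conjI allI impI sum pol zero)
  then show ?case by blast
qed

subsection \<open>Laplacian algebras\<close>

lemma grad_norm: "grad (\<lambda>x::'b::euclidean_space. x \<bullet> x) = (\<lambda>x. 2 *\<^sub>R x)"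
  by (intro ext grad_eqI) (auto intro!: derivative_eq_intros simp: inner_commute)

lemma polynomial_function_Pair:
  fixes f :: "'b::euclidean_space \<Rightarrow> 'c::euclidean_space" and g :: "'b \<Rightarrow> 'd::euclidean_space"
  assumes "polynomial_function f" "polynomial_function g"
  shows "polynomial_function (\<lambda>x. (f x, g x))"
  using assms by (auto simp: polynomial_function_iff_Basis_inner Basis_prod_def)

lemma has_derivative_grad_vector:
  fixes F :: "'b::euclidean_space \<Rightarrow> real"
  assumes "real_polynomial_function F"
  shows "(grad F has_derivative (\<lambda>h. \<Sum>b\<in>Basis. hess F x b h *\<^sub>R b)) (at x)"
proof -
  have "((\<lambda>y. \<Sum>b\<in>Basis. (grad F y \<bullet> b) *\<^sub>R b) has_derivative (\<lambda>h. \<Sum>b\<in>Basis. hess F x b h *\<^sub>R b)) (at x)"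
    unfolding hess_def
    by (intro has_derivative_sum has_derivative_scaleR_left has_derivative_grad
        real_polynomial_grad_inner assms)
  then show ?thesis by (simp add: euclidean_representation)
qed

text \<open>Symmetry of the Hessian lets \<open>h\<close> be moved out of the derivative of
  \<open>grad F x \<bullet> grad F x\<close>. The identity recognizes the second-order term of
  \<open>grad_stable_step\<close> as a gradient.\<close>

lemma hess_grad:
  fixes F :: "'b::euclidean_space \<Rightarrow> real"
  assumes F: "real_polynomial_function F"
  shows "(\<Sum>b\<in>Basis. hess F x b (grad F x) *\<^sub>R b) = (1/2) *\<^sub>R grad (\<lambda>x. grad F x \<bullet> grad F x) x"
proof -
  have "grad (\<lambda>x. grad F x \<bullet> grad F x) x = 2 *\<^sub>R (\<Sum>b\<in>Basis. hess F x b (grad F x) *\<^sub>R b)"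
  proof (rule grad_eqI)
    have "((\<lambda>x. grad F x \<bullet> grad F x) has_derivative
      (\<lambda>h. grad F x \<bullet> (\<Sum>b\<in>Basis. hess F x b h *\<^sub>R b) + (\<Sum>b\<in>Basis. hess F x b h *\<^sub>R b) \<bullet> grad F x)) (at x)"
      by (rule has_derivative_inner[OF has_derivative_grad_vector[OF F] has_derivative_grad_vector[OF F]])
    moreover have "grad F x \<bullet> (\<Sum>b\<in>Basis. hess F x b h *\<^sub>R b) = (\<Sum>b\<in>Basis. hess F x b (grad F x) *\<^sub>R b) \<bullet> h" for h
    proof -
      have "grad F x \<bullet> (\<Sum>b\<in>Basis. hess F x b h *\<^sub>R b) = (\<Sum>b\<in>Basis. hess F x ((grad F x \<bullet> b) *\<^sub>R b) h)"
        using linear_cmul[OF hess_linear_left[OF F, of x h]] by (simp add: inner_sum_right mult.commute)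
      also have "\<dots> = hess F x (grad F x) h"
        using linear_sum[OF hess_linear_left[OF F, of x h], of "\<lambda>b. (grad F x \<bullet> b) *\<^sub>R b" Basis]
        by (simp add: euclidean_representation)
      also have "\<dots> = hess F x (\<Sum>b\<in>Basis. (h \<bullet> b) *\<^sub>R b) (grad F x)"
        by (subst hess_sym[OF F]) (simp add: euclidean_representation)
      also have "\<dots> = (\<Sum>b\<in>Basis. (h \<bullet> b) * hess F x b (grad F x))"
        using linear_sum[OF hess_linear_left[OF F, of x "grad F x"], of "\<lambda>b. (h \<bullet> b) *\<^sub>R b" Basis]
          linear_cmul[OF hess_linear_left[OF F, of x "grad F x"]] by simp
      finally show ?thesis by (simp add: inner_sum_left mult.commute inner_commute[of h])
    qed
    ultimately show "((\<lambda>x. grad F x \<bullet> grad F x) has_derivative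
      (\<lambda>h. 2 *\<^sub>R (\<Sum>b\<in>Basis. hess F x b (grad F x) *\<^sub>R b) \<bullet> h)) (at x)"
      by (simp add: inner_commute[of "\<Sum>b\<in>Basis. hess F x b h *\<^sub>R b" "grad F x" for h])
  qed
  then show ?thesis by simp
qed

section \<open>Closure properties of a Laplacian algebra\<close>

context
  fixes L :: "('a::euclidean_space \<Rightarrow> real) set"
  assumes L: "laplacian_algebra L"
begin

lemma la_poly: "f \<in> L \<Longrightarrow> real_polynomial_function f"
  using L by (auto simp: laplacian_algebra_def polynomial_subalgebra_def polynomial_functions_def)

lemma la_const: "(\<lambda>x. c) \<in> L"
  using L by (auto simp: laplacian_algebra_def polynomial_subalgebra_def)

lemma la_add: "f \<in> L \<Longrightarrow> g \<in> L \<Longrightarrow> (\<lambda>x. f x + g x) \<in> L"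
  using L by (auto simp: laplacian_algebra_def polynomial_subalgebra_def)

lemma la_mult: "f \<in> L \<Longrightarrow> g \<in> L \<Longrightarrow> (\<lambda>x. f x * g x) \<in> L"
  using L by (auto simp: laplacian_algebra_def polynomial_subalgebra_def)

lemma la_laplacian: "f \<in> L \<Longrightarrow> laplacian f \<in> L"
  using L by (auto simp: laplacian_algebra_def)

lemma la_norm: "(\<lambda>x. x \<bullet> x) \<in> L"
proof -
  have "(\<lambda>x::'a. x \<bullet> x) = (\<lambda>x. \<Sum>b\<in>Basis. (x \<bullet> b)\<^sup>2)"
    by (rule ext) (subst euclidean_inner, simp add: power2_eq_square)
  then show ?thesis using L by (simp add: laplacian_algebra_def)
qed

lemma la_cmul: "f \<in> L \<Longrightarrow> (\<lambda>x. c * f x) \<in> L"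
  by (intro la_mult la_const)

lemma la_subspace: "fun_subspace L"
  unfolding fun_subspace_def by (auto intro: la_const la_add la_cmul)

lemmas la_diff = fun_subspace_diff[OF la_subspace] and la_sum = fun_subspace_sum[OF la_subspace]

lemma la_grad_inner:
  assumes "f \<in> L" "g \<in> L"
  shows "(\<lambda>x. grad f x \<bullet> grad g x) \<in> L"
proof -
  have "(\<lambda>x. (1/2) * (laplacian (\<lambda>x. f x * g x) x - f x * laplacian g x - g x * laplacian f x)) \<in> L"
    using assms by (intro la_cmul la_diff la_laplacian la_mult)
  then show ?thesis using assms by (simp add: laplacian_mult la_poly)
qed

text \<open>The Euler field is half the gradient of the squared norm, so this is a case of
  \<open>la_grad_inner\<close>.\<close>

lemma la_euler:
  assumes "f \<in> L"
  shows "(\<lambda>x. x \<bullet> grad f x) \<in> L"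
  using la_cmul[OF la_grad_inner[OF la_norm assms], of "1/2"] by (simp add: grad_norm)

text \<open>\<open>K\<close> is a function on the tangent bundle, tested on the graphs of all
  gradient fields at once: the induction step has to apply the condition not only to
  \<open>F\<close> but to \<open>F + s * H\<close> for every \<open>s\<close>.\<close>

definition grad_stable :: "('a \<times> 'a \<Rightarrow> real) set" where
  "grad_stable = {K. real_polynomial_function K \<and> (\<forall>F\<in>L. (\<lambda>x. K (x, grad F x)) \<in> L)}"

text \<open>Differentiating \<open>K(x, \<nabla>F x)\<close> along \<open>\<nabla>F\<close> also differentiates the second argument, in the
  direction \<open>D\<^sup>2F \<nabla>F\<close>. That this is the gradient of \<open>H = |\<nabla>F|\<^sup>2 / 2\<close>, which is again in \<open>L\<close>, is
  what makes the induction close up.\<close>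

lemma grad_stable_step:
  assumes K: "K \<in> grad_stable"
  shows "(\<lambda>z. grad K z \<bullet> (snd z, 0)) \<in> grad_stable"
proof -
  have pK: "real_polynomial_function K" using K by (simp add: grad_stable_def)
  have "polynomial_function (\<lambda>z::'a \<times> 'a. (snd z, 0::'a))"
    by (intro polynomial_function_bounded_linear bounded_linear_Pair bounded_linear_snd bounded_linear_zero)
  then have pol: "real_polynomial_function (\<lambda>z. grad K z \<bullet> (snd z, 0))"
    by (intro real_polynomial_inner polynomial_function_grad pK)
  have "(\<lambda>x. grad K (x, grad F x) \<bullet> (grad F x, 0)) \<in> L" if F: "F \<in> L" for F
  proof -
    have pF: "real_polynomial_function F" using la_poly[OF F] .
    define H where "H x = (1/2) * (grad F x \<bullet> grad F x)" for x
    have H: "H \<in> L" using la_cmul[OF la_grad_inner[OF F F], of "1/2"] by (simp add: H_def[abs_def])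
    have pH: "real_polynomial_function H" using la_poly[OF H] .
    have gH: "grad H x = (\<Sum>b\<in>Basis. hess F x b (grad F x) *\<^sub>R b)" for x
      unfolding hess_grad[OF pF] H_def[abs_def]
      by (subst grad_cmul) (auto intro!: real_polynomial_inner polynomial_function_grad pF)
    define p where "p x = K (x, grad F x)" for x
    have p: "p \<in> L" using K F by (simp add: grad_stable_def p_def[abs_def])
    have dp: "(p has_derivative (\<lambda>h. grad K (x, grad F x) \<bullet> (h, \<Sum>b\<in>Basis. hess F x b h *\<^sub>R b))) (at x)" for x
      unfolding p_def
      by (rule has_derivative_compose[OF has_derivative_Pair[OF has_derivative_ident
              has_derivative_grad_vector[OF pF]] has_derivative_grad[OF pK]])
    have gp: "grad p x \<bullet> h = grad K (x, grad F x) \<bullet> (h, \<Sum>b\<in>Basis. hess F x b h *\<^sub>R b)" for x h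
      by (rule fun_cong[OF has_derivative_unique[OF has_derivative_grad[OF la_poly[OF p]] dp]])
    \<comment> \<open>The derivative of \<open>p\<close> along \<open>grad F\<close> sees both
      arguments of \<open>K\<close>; the part coming from the second one still has to be
      removed.\<close>
    have first: "(\<lambda>x. grad K (x, grad F x) \<bullet> (grad F x, grad H x)) \<in> L"
      using la_grad_inner[OF p F] by (simp only: gp gH)
    \<comment> \<open>The unwanted part is the coefficient of \<open>s\<close> in \<open>K\<close>
      evaluated on the gradient of \<open>F + s * H\<close>. Every member of this family lies in
      \<open>L\<close>, hence so do its coefficients.\<close>
    define P where "P z = K (fst z, grad F (fst z) + snd z *\<^sub>R grad H (fst z))" for z :: "'a \<times> real"
    have "real_polynomial_function P"
      unfolding P_def
    proof (rule real_polynomial_compose[OF polynomial_function_Pair pK])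
      have fst: "polynomial_function (fst :: 'a \<times> real \<Rightarrow> 'a)"
        by (intro polynomial_function_bounded_linear bounded_linear_fst)
      have g: "polynomial_function (\<lambda>z::'a \<times> real. grad f (fst z))" if "real_polynomial_function f" for f
        using polynomial_function_compose[OF fst polynomial_function_grad[OF that]] by (simp add: o_def)
      have "polynomial_function (snd :: 'a \<times> real \<Rightarrow> real)"
        by (intro polynomial_function_bounded_linear bounded_linear_snd)
      then show "polynomial_function (\<lambda>z::'a \<times> real. grad F (fst z) + snd z *\<^sub>R grad H (fst z))"
        by (intro polynomial_function_add polynomial_function_mult g pF pH)
      show "polynomial_function (fst :: 'a \<times> real \<Rightarrow> 'a)" by (rule fst)
    qed
    from polynomial_expansion[OF this] obtain N a where "expands P N a" by blast
    then have zero: "\<And>j x. j > N \<Longrightarrow> a j x = 0" and P: "\<And>x s. P (x, s) = (\<Sum>j\<le>N. s ^ j * a j x)"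
      by (auto simp: expands_def)
    have "(\<lambda>x. \<Sum>j\<le>N. s ^ j * a j x) \<in> L" for s
    proof -
      have "(\<lambda>x. K (x, grad (\<lambda>x. F x + s * H x) x)) \<in> L"
        using K la_add[OF F la_cmul[OF H, of s]] by (simp add: grad_stable_def)
      moreover have "grad (\<lambda>x. F x + s * H x) x = grad F x + s *\<^sub>R grad H x" for x
        using la_poly[OF la_cmul[OF H]] by (simp add: grad_add pF grad_cmul pH)
      ultimately show ?thesis unfolding P[symmetric] by (simp add: P_def)
    qed
    then have a1: "a 1 \<in> L"
    proof (cases "1 \<le> N")
      case False
      then have "a 1 = (\<lambda>x. 0)" using zero[of 1] by auto
      then show ?thesis using la_const[of 0] by simp
    qed (rule coefficient_in_subspace[OF la_subspace])
    have "a 1 x = grad K (x, grad F x) \<bullet> (0, grad H x)" for x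
    proof -
      have "((\<lambda>s. K ((x, grad F x) + s *\<^sub>R (0, grad H x))) has_real_derivative
         grad K ((x, grad F x) + 0 *\<^sub>R (0, grad H x)) \<bullet> (0, grad H x)) (at 0)"
        by (rule has_real_derivative_line[OF pK])
      then have "((\<lambda>s. \<Sum>j\<le>N. s ^ j * a j x) has_real_derivative grad K (x, grad F x) \<bullet> (0, grad H x)) (at 0)"
        unfolding P[symmetric] by (simp add: P_def)
      moreover have "((\<lambda>s. \<Sum>j\<le>N. s ^ j * a j x) has_real_derivative (\<Sum>j\<le>N. (if j = 1 then a 1 x else 0))) (at 0)"
      proof (rule DERIV_sum)
        fix j
        have "((\<lambda>s. s ^ j * a j x) has_real_derivative (real j * 0 ^ (j - 1)) * a j x) (at 0)"
          by (auto intro!: derivative_eq_intros)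
        then show "((\<lambda>s. s ^ j * a j x) has_real_derivative (if j = 1 then a 1 x else 0)) (at 0)"
          by (cases "j = 0"; cases "j = 1") (auto simp: zero_power)
      qed
      moreover have "(\<Sum>j\<le>N. (if j = 1 then a 1 x else 0)) = a 1 x"
        using zero[of 1 x] by (cases "N = 0") (auto simp: sum.delta)
      ultimately show ?thesis by (auto dest: DERIV_unique)
    qed
    then have "a 1 = (\<lambda>x. grad K (x, grad F x) \<bullet> (0, grad H x))" by (rule ext)
    then have "(\<lambda>x. grad K (x, grad F x) \<bullet> (0, grad H x)) \<in> L" using a1 by simp
    from la_diff[OF first this] show ?thesis by (simp flip: inner_diff_right)
  qed
  then show ?thesis using pol by (simp add: grad_stable_def)
qed

lemma grad_stable_cmul: "K \<in> grad_stable \<Longrightarrow> (\<lambda>z. c * K z) \<in> grad_stable"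
  by (auto simp: grad_stable_def intro: la_cmul real_polynomial_mult real_polynomial_const)

text \<open>Taylor expansion of \<open>l\<close> at \<open>x\<close>: the coefficient
  \<open>a j (x, u)\<close> is the \<open>j\<close>-th derivative of \<open>l\<close> at
  \<open>x\<close> in direction \<open>u\<close>, divided by \<open>j!\<close>. Each arises from the
  preceding one by differentiating along \<open>(u, 0)\<close>, which is what
  \<open>grad_stable_step\<close> allows.\<close>

lemma la_shift_grad:
  assumes l: "l \<in> L" and F: "F \<in> L"
  shows "(\<lambda>x. l (x + grad F x)) \<in> L"
proof -
  have pl: "real_polynomial_function l" using la_poly[OF l] .
  define P where "P z = l (fst (fst z) + snd z *\<^sub>R snd (fst z))" for z :: "('a \<times> 'a) \<times> real"
  have "real_polynomial_function P"
    unfolding P_def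
  proof (rule real_polynomial_compose[OF _ pl], intro polynomial_function_add polynomial_function_mult)
    show "polynomial_function (\<lambda>z::('a \<times> 'a) \<times> real. fst (fst z))"
      by (intro polynomial_function_bounded_linear bounded_linear_compose[OF bounded_linear_fst bounded_linear_fst])
    show "polynomial_function (\<lambda>z::('a \<times> 'a) \<times> real. snd (fst z))"
      by (intro polynomial_function_bounded_linear bounded_linear_compose[OF bounded_linear_snd bounded_linear_fst])
    show "polynomial_function (snd::('a \<times> 'a) \<times> real \<Rightarrow> real)"
      by (intro polynomial_function_bounded_linear bounded_linear_snd)
  qed
  from polynomial_expansion[OF this] obtain N a where "expands P N a" by blast
  then have pa: "\<And>j. real_polynomial_function (a j)" and zero: "\<And>j z. j > N \<Longrightarrow> a j z = 0"
    and P: "\<And>z s. P (z, s) = (\<Sum>j\<le>N. s ^ j * a j z)"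
    by (auto simp: expands_def)
  \<comment> \<open>Moving the base point by \<open>e\<close> times the direction is the same as
    replacing \<open>s\<close> by \<open>s + e\<close>. The recursion results from differentiating
    both descriptions at \<open>e = 0\<close> and comparing powers of \<open>s\<close>.\<close>
  have step: "grad (a j) z \<bullet> (snd z, 0) = (real j + 1) * a (Suc j) z" if "j \<le> N" for j z
  proof -
    have "(\<Sum>j\<le>N. (grad (a j) z \<bullet> (snd z, 0)) * s ^ j) = (\<Sum>j\<le>N. ((real j + 1) * a (Suc j) z) * s ^ j)" for s
    proof -
      have "((\<lambda>e. \<Sum>j\<le>N. s ^ j * a j (z + e *\<^sub>R (snd z, 0))) has_real_derivative
        (\<Sum>j\<le>N. s ^ j * (grad (a j) (z + 0 *\<^sub>R (snd z, 0)) \<bullet> (snd z, 0)))) (at 0)"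
        by (intro DERIV_sum DERIV_cmult has_real_derivative_line pa)
      moreover have "(\<Sum>j\<le>N. s ^ j * a j (z + e *\<^sub>R (snd z, 0))) = (\<Sum>j\<le>N. (s + e) ^ j * a j z)" for e
      proof -
        have "P (z + e *\<^sub>R (snd z, 0), s) = P (z, s + e)"
          by (cases z) (simp add: P_def algebra_simps)
        then show ?thesis by (simp only: P)
      qed
      ultimately have d1: "((\<lambda>e. \<Sum>j\<le>N. (s + e) ^ j * a j z) has_real_derivative
        (\<Sum>j\<le>N. s ^ j * (grad (a j) z \<bullet> (snd z, 0)))) (at 0)" by (simp flip: zero_prod_def)
      have "((\<lambda>e. \<Sum>j\<le>N. (s + e) ^ j * a j z) has_real_derivative
        (\<Sum>j\<le>N. (real j * (s + 0) ^ (j - 1)) * a j z)) (at 0)"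
        by (intro DERIV_sum) (auto intro!: derivative_eq_intros)
      with d1 have "(\<Sum>j\<le>N. s ^ j * (grad (a j) z \<bullet> (snd z, 0))) = (\<Sum>j\<le>N. (real j * s ^ (j - 1)) * a j z)"
        by (auto dest: DERIV_unique)
      also have "\<dots> = (\<Sum>j\<le>Suc N. (real j * s ^ (j - 1)) * a j z)"
        using zero[of "Suc N" z] by simp
      also have "\<dots> = (\<Sum>j\<le>N. (real (Suc j) * s ^ j) * a (Suc j) z)"
        by (subst sum.atMost_Suc_shift) simp
      finally show ?thesis by (simp add: mult_ac add.commute)
    qed
    then show ?thesis using that polyfun_eq_coeffs[of "\<lambda>j. grad (a j) z \<bullet> (snd z, 0)" N "\<lambda>j. (real j + 1) * a (Suc j) z"]
      by blast
  qed
  have a: "a j \<in> grad_stable" if "j \<le> N" for j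
    using that
  proof (induction j)
    case 0
    have "a 0 z = l (fst z)" for z
      using P[of z 0] by (simp add: P_def power_0_left if_distrib[of "\<lambda>x. x * _"] cong: if_cong)
    then have "a 0 = (\<lambda>z. l (fst z))" by blast
    moreover have "real_polynomial_function (\<lambda>z::'a\<times>'a. l (fst z))"
      by (intro real_polynomial_compose[OF _ pl] polynomial_function_bounded_linear bounded_linear_fst)
    ultimately show ?case using l by (simp add: grad_stable_def)
  next
    case (Suc j)
    have "a (Suc j) = (\<lambda>z. (1 / (real j + 1)) * (grad (a j) z \<bullet> (snd z, 0)))"
      using step[of j] Suc.prems by (auto simp: fun_eq_iff field_simps)
    then show ?case using grad_stable_cmul[OF grad_stable_step[OF Suc.IH], of "1 / (real j + 1)"] Suc.prems by simp
  qed
  have "l (x + grad F x) = (\<Sum>j\<le>N. a j (x, grad F x))" for x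
    using P[of "(x, grad F x)" 1] by (simp add: P_def)
  then show ?thesis using la_sum[of "{..N}" "\<lambda>j x. a j (x, grad F x)"] a F by (simp add: grad_stable_def)
qed

text \<open>Subtracting half the squared norm from \<open>F\<close> makes the gradient cancel the
  base point in \<open>la_shift_grad\<close>.\<close>

lemma la_compose_grad:
  assumes l: "l \<in> L" and F: "F \<in> L"
  shows "(\<lambda>x. l (grad F x)) \<in> L"
proof -
  have N: "(\<lambda>x. (1/2) * (x \<bullet> x)) \<in> L" by (intro la_cmul la_norm)
  have "grad (\<lambda>x::'a. (1/2) * (x \<bullet> x)) = (\<lambda>x. x)"
    using grad_cmul[OF la_poly[OF la_norm], of "1/2"] by (simp add: grad_norm)
  then have "x + grad (\<lambda>x. F x - (1/2) * (x \<bullet> x)) x = grad F x" for x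
    by (simp only: grad_diff[OF la_poly[OF F] la_poly[OF N]]) simp
  then show ?thesis using la_shift_grad[OF l la_diff[OF F N]] by simp
qed

end


subsection \<open>Generalized polarizations\<close>

lemma laplacian_algebra_polynomials:
  "laplacian_algebra (polynomial_functions :: ('a::euclidean_space \<Rightarrow> real) set)"
  unfolding laplacian_algebra_def polynomial_subalgebra_def polynomial_functions_def
  by (auto intro!: real_polynomial_const real_polynomial_add real_polynomial_mult real_polynomial_laplacian
      real_polynomial_function_sum real_polynomial_function_power real_polynomial_linear[OF bounded_linear_inner_left])

text \<open>The closure conditions pass to any intersection, but consisting of polynomials requires
  that the intersected family have a member; \<open>B\<close> provides one.\<close>

lemma laplacian_algebra_hull:
  assumes "laplacian_algebra B" "S \<subseteq> B"
  shows "laplacian_algebra (laplacian_algebra hull S)"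
proof -
  define \<T> where "\<T> = {T. laplacian_algebra T \<and> S \<subseteq> T}"
  have "B \<in> \<T>" using assms by (simp add: \<T>_def)
  then have "laplacian_algebra (\<Inter>\<T>)"
    unfolding laplacian_algebra_def polynomial_subalgebra_def
    by (auto simp: \<T>_def laplacian_algebra_def polynomial_subalgebra_def)
  then show ?thesis by (simp add: hull_def \<T>_def)
qed

lemma polynomial_function_vec_nth: "polynomial_function (\<lambda>v::'a::euclidean_space ^ 'k::finite. v $ i)"
  by (intro polynomial_function_bounded_linear bounded_linear_vec_nth)

lemma real_polynomial_component:
  fixes f :: "'a::euclidean_space \<Rightarrow> real"
  assumes "real_polynomial_function f"
  shows "real_polynomial_function (\<lambda>v::'a ^ 'k::finite. f (v $ i))"
  using real_polynomial_compose[OF polynomial_function_vec_nth assms] .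

lemma grad_component:
  fixes f :: "'a::euclidean_space \<Rightarrow> real"
  assumes "real_polynomial_function f"
  shows "grad (\<lambda>v::'a ^ 'k::finite. f (v $ i)) v = axis i (grad f (v $ i))"
proof (rule grad_eqI)
  have "((\<lambda>v::'a ^ 'k. f (v $ i)) has_derivative (\<lambda>h. grad f (v $ i) \<bullet> (h $ i))) (at v)"
    by (rule has_derivative_compose[OF bounded_linear_imp_has_derivative[OF bounded_linear_vec_nth]
          has_derivative_grad[OF assms]])
  then show "((\<lambda>v::'a ^ 'k. f (v $ i)) has_derivative (\<lambda>h. axis i (grad f (v $ i)) \<bullet> h)) (at v)"
    by (simp add: inner_axis')
qed

lemma grad_inner_components:
  fixes v :: "'a::euclidean_space ^ 'k::finite"
  shows "grad (\<lambda>v. v $ i \<bullet> v $ j) v = axis i (v $ j) + axis j (v $ i)"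
proof (rule grad_eqI)
  have "((\<lambda>v::'a ^ 'k. v $ i \<bullet> v $ j) has_derivative (\<lambda>h. v $ i \<bullet> h $ j + h $ i \<bullet> v $ j)) (at v)"
    by (intro has_derivative_inner bounded_linear_imp_has_derivative bounded_linear_vec_nth)
  then show "((\<lambda>v::'a ^ 'k. v $ i \<bullet> v $ j) has_derivative
      (\<lambda>h. (axis i (v $ j) + axis j (v $ i)) \<bullet> h)) (at v)"
    by (simp add: inner_axis' inner_add_left inner_commute[of _ "v $ j"] add.commute)
qed

context
  fixes A :: "('a::euclidean_space \<Rightarrow> real) set" and i0 :: "'k::finite"
  assumes A: "A \<subseteq> polynomial_functions"
begin

lemma generalized_polarizations_laplacian: "laplacian_algebra (generalized_polarizations i0 A)"
  unfolding generalized_polarizations_def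
proof (rule laplacian_algebra_hull[OF laplacian_algebra_polynomials])
  show "{\<lambda>v. f (v $ i0) | f. f \<in> A} \<union> {\<lambda>v. v $ i \<bullet> v $ j | i j. True}
    \<subseteq> (polynomial_functions :: ('a ^ 'k \<Rightarrow> real) set)"
    using A by (auto simp: polynomial_functions_def
        intro!: real_polynomial_component real_polynomial_inner polynomial_function_vec_nth)
qed

lemma generalized_polarizations_gen: "f \<in> A \<Longrightarrow> (\<lambda>v. f (v $ i0)) \<in> generalized_polarizations i0 A"
  and generalized_polarizations_inner: "(\<lambda>v. v $ i \<bullet> v $ j) \<in> generalized_polarizations i0 A"
  unfolding generalized_polarizations_def by (rule hull_inc; blast)+

lemma generalized_polarizations_compose_grad:
  assumes "f \<in> A" "F \<in> generalized_polarizations i0 A"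
  shows "(\<lambda>v. f (grad F v $ i0)) \<in> generalized_polarizations i0 A"
  using la_compose_grad[OF generalized_polarizations_laplacian generalized_polarizations_gen[OF assms(1)] assms(2)] .

text \<open>The generators single out the factor \<open>i0\<close>. Since the
  \<open>i0\<close>-component of the gradient of \<open>v $ i0 \<bullet> v $ i\<close> is
  \<open>v $ i\<close>, composing with that gradient carries \<open>f\<close> to any other
  factor.\<close>

lemma generalized_polarizations_component:
  assumes f: "f \<in> A"
  shows "(\<lambda>v. f (v $ i)) \<in> generalized_polarizations i0 A"
proof (cases "i = i0")
  case False
  then show ?thesis
    using generalized_polarizations_compose_grad[OF f generalized_polarizations_inner[of i0 i]]
    by (simp add: grad_inner_components axis_def)
qed (use generalized_polarizations_gen[OF f] in simp)

text \<open>Supplies the \<open>F\<close> that \<open>generalized_polarizations_compose_grad\<close>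
  needs in order to evaluate invariants at gradient vectors. For \<open>i \<noteq> i0\<close> it is
  the classical polarization \<open>v $ i0 \<bullet> grad h (v $ i)\<close>, which is linear in
  \<open>v $ i0\<close> and is itself an inner product of two gradients.\<close>

lemma generalized_polarizations_grad:
  assumes h: "h \<in> A"
  shows "\<exists>F\<in>generalized_polarizations i0 A. \<forall>v. grad F v $ i0 = grad h (v $ i)"
proof -
  have ph: "real_polynomial_function h" using A h by (auto simp: polynomial_functions_def)
  show ?thesis
  proof (cases "i = i0")
    case True
    then show ?thesis
      using generalized_polarizations_gen[OF h] by (intro bexI) (auto simp: grad_component[OF ph])
  next
    case False
    define F :: "'a ^ 'k \<Rightarrow> real" where "F v = v $ i0 \<bullet> grad h (v $ i)" for v
    have "F = (\<lambda>v. grad (\<lambda>v. v $ i0 \<bullet> v $ i) v \<bullet> grad (\<lambda>v. h (v $ i)) v)"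
      using False by (auto simp: F_def grad_component[OF ph] grad_inner_components inner_add_left inner_axis_axis)
    then have F: "F \<in> generalized_polarizations i0 A"
      using la_grad_inner[OF generalized_polarizations_laplacian generalized_polarizations_inner
          generalized_polarizations_component[OF h]] by simp
    have "grad F v $ i0 \<bullet> c = grad h (v $ i) \<bullet> c" for v c
    proof -
      have "(\<lambda>t. F (v + t *\<^sub>R axis i0 c)) = (\<lambda>t. v $ i0 \<bullet> grad h (v $ i) + t * (c \<bullet> grad h (v $ i)))"
        using False by (auto simp: F_def axis_def inner_add_left)
      moreover have "((\<lambda>t. v $ i0 \<bullet> grad h (v $ i) + t * (c \<bullet> grad h (v $ i))) has_real_derivative
        c \<bullet> grad h (v $ i)) (at 0)"
        by (auto intro!: derivative_eq_intros)
      ultimately have "grad F (v + 0 *\<^sub>R axis i0 c) \<bullet> axis i0 c = c \<bullet> grad h (v $ i)"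
        using has_real_derivative_line[OF la_poly[OF generalized_polarizations_laplacian F], of v "axis i0 c" 0]
        by (auto dest: DERIV_unique)
      then show ?thesis by (simp add: inner_axis inner_commute[of c])
    qed
    then have "grad F v $ i0 = grad h (v $ i)" for v by (metis vector_eq_rdot)
    then show ?thesis using F by blast
  qed
qed

end

subsection \<open>Finite-dimensional spaces of functions\<close>

text \<open>Finite dimension expressed through evaluations: a linear space of functions is
  finite-dimensional exactly when finitely many points determine its members.\<close>

definition determined_by :: "('a \<Rightarrow> real) set \<Rightarrow> 'a set \<Rightarrow> bool" where
  "determined_by U Z \<longleftrightarrow> finite Z \<and> (\<forall>f\<in>U. (\<forall>z\<in>Z. f z = 0) \<longrightarrow> f = (\<lambda>x. 0))"

definition fun_span :: "('i \<Rightarrow> 'a \<Rightarrow> real) \<Rightarrow> 'i set \<Rightarrow> ('a \<Rightarrow> real) set" where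
  "fun_span e I = {\<lambda>x. \<Sum>i\<in>I. c i * e i x | c. True}"

text \<open>A new generator costs at most one new point. A nonzero \<open>f\<close> that vanishes on
  \<open>Z\<close> must involve \<open>e i\<close>, so any function vanishing on \<open>Z\<close> is
  a multiple of \<open>f\<close>, and a point where \<open>f\<close> is nonzero detects the
  multiple.\<close>

lemma fun_span_determined:
  assumes "finite I"
  shows "\<exists>Z. determined_by (fun_span e I) Z"
  using assms
proof (induction I rule: finite_induct)
  case empty
  have "determined_by (fun_span e {}) {}" by (auto simp: determined_by_def fun_span_def)
  then show ?case by blast
next
  case (insert i I)
  then obtain Z where Z: "finite Z" and det: "\<And>f. f \<in> fun_span e I \<Longrightarrow> \<forall>z\<in>Z. f z = 0 \<Longrightarrow> f = (\<lambda>x. 0)"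
    by (auto simp: determined_by_def)
  show ?case
  proof (cases "determined_by (fun_span e (insert i I)) Z")
    case False
    then obtain f where f: "f \<in> fun_span e (insert i I)" "\<forall>z\<in>Z. f z = 0" "f \<noteq> (\<lambda>x. 0)"
      using Z by (auto simp: determined_by_def)
    then obtain c where c: "f = (\<lambda>x. c i * e i x + (\<Sum>j\<in>I. c j * e j x))"
      using insert.hyps by (auto simp: fun_span_def)
    obtain z where z: "f z \<noteq> 0" using f(3) by blast
    have ci: "c i \<noteq> 0"
    proof
      assume "c i = 0"
      then have "f \<in> fun_span e I" using c by (auto simp: fun_span_def)
      then show False using det f by blast
    qed
    have "h = (\<lambda>x. 0)" if h: "h \<in> fun_span e (insert i I)" "\<forall>y\<in>insert z Z. h y = 0" for h
    proof -
      obtain d where d: "h = (\<lambda>x. d i * e i x + (\<Sum>j\<in>I. d j * e j x))"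
        using h insert.hyps by (auto simp: fun_span_def)
      define r where "r = d i / c i"
      have "(\<lambda>x. h x - r * f x) = (\<lambda>x. \<Sum>j\<in>I. (d j - r * c j) * e j x)"
        using ci by (auto simp: c d r_def sum_subtractf sum_distrib_left algebra_simps)
      then have "(\<lambda>x. h x - r * f x) \<in> fun_span e I" by (auto simp: fun_span_def)
      then have "(\<lambda>x. h x - r * f x) = (\<lambda>x. 0)" using det h f by simp
      then have eq: "h x = r * f x" for x by (metis eq_iff_diff_eq_0)
      have "r = 0" using eq[of z] h z by simp
      then show ?thesis using eq by auto
    qed
    then have "determined_by (fun_span e (insert i I)) (insert z Z)"
      using Z by (auto simp: determined_by_def)
    then show ?thesis by blast
  qed blast
qed

lemma determined_by_subset: "determined_by U Z \<Longrightarrow> U' \<subseteq> U \<Longrightarrow> determined_by U' Z"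
  by (auto simp: determined_by_def)

text \<open>Lagrange interpolation. The functions vanishing at \<open>z\<close> are handled by
  induction; a function with value 1 at \<open>z\<close>, corrected by its interpolant on the other
  points, supplies the missing basis element.\<close>

lemma interpolation_basis:
  assumes "fun_subspace U" "determined_by U Z"
  shows "\<exists>Z'\<subseteq>Z. \<exists>e. (\<forall>z\<in>Z'. e z \<in> U) \<and> (\<forall>f\<in>U. \<forall>x. f x = (\<Sum>z\<in>Z'. f z * e z x))"
proof -
  have "finite Z" using assms by (simp add: determined_by_def)
  then show ?thesis using assms
  proof (induction Z arbitrary: U rule: finite_induct)
    case empty
    then have "\<forall>f\<in>U. \<forall>x. f x = 0" by (auto simp: determined_by_def)
    then show ?case by simp
  next
    case (insert z Z)
    define U0 where "U0 = {f\<in>U. f z = 0}"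
    have s0: "fun_subspace U0"
      using insert.prems(1) by (auto simp: U0_def fun_subspace_def)
    have "determined_by U0 Z" using insert.prems(2) by (auto simp: determined_by_def U0_def)
    from insert.IH[OF s0 this] obtain Z' e where Z': "Z' \<subseteq> Z" and e: "\<And>y. y \<in> Z' \<Longrightarrow> e y \<in> U0"
      and rep: "\<And>f x. f \<in> U0 \<Longrightarrow> f x = (\<Sum>y\<in>Z'. f y * e y x)" by meson
    have fZ: "finite Z'" "z \<notin> Z'" using Z' insert.hyps finite_subset by auto
    show ?case
    proof (cases "U0 = U")
      case True
      then show ?thesis using Z' e rep by (metis subset_insertI2)
    next
      case False
      then obtain h0 where h0: "h0 \<in> U" "h0 z \<noteq> 0" by (auto simp: U0_def)
      define h where "h x = inverse (h0 z) * h0 x" for x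
      have h: "h \<in> U" "h z = 1"
        using fun_subspaceD(3)[OF insert.prems(1) h0(1), of "inverse (h0 z)"] h0(2)
        by (auto simp: h_def[abs_def])
      define h' where "h' x = h x - (\<Sum>y\<in>Z'. h y * e y x)" for x
      have h': "h' \<in> U"
        unfolding h'_def[abs_def]
        by (intro fun_subspace_diff[OF insert.prems(1)] fun_subspace_sum[OF insert.prems(1)]
            fun_subspaceD(3)[OF insert.prems(1)] h) (use e in \<open>auto simp: U0_def\<close>)
      define e' where "e' y = (if y = z then h' else e y)" for y
      have "f x = (\<Sum>y\<in>insert z Z'. f y * e' y x)" if f: "f \<in> U" for f x
      proof -
        have "(\<lambda>x. f x - f z * h x) \<in> U0"
          using fun_subspace_diff[OF insert.prems(1) f fun_subspaceD(3)[OF insert.prems(1) h(1), of "f z"]] h(2)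
          by (simp add: U0_def)
        from rep[OF this, of x] have "f x = f z * h x + (\<Sum>y\<in>Z'. (f y - f z * h y) * e y x)" by simp
        also have "\<dots> = f z * h' x + (\<Sum>y\<in>Z'. f y * e y x)"
          by (simp add: h'_def algebra_simps sum_subtractf sum_distrib_left)
        also have "(\<Sum>y\<in>Z'. f y * e y x) = (\<Sum>y\<in>Z'. f y * e' y x)"
          by (rule sum.cong) (use fZ in \<open>auto simp: e'_def\<close>)
        finally show ?thesis using fZ by (simp add: e'_def)
      qed
      moreover have "\<forall>y\<in>insert z Z'. e' y \<in> U"
        using h' e by (auto simp: e'_def U0_def)
      ultimately show ?thesis using Z' by (intro exI[of _ "insert z Z'"] conjI exI[of _ e']) auto
    qed
  qed
qed

subsection \<open>Homogeneous polynomials and the degree filtration\<close>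

text \<open>Since \<open>0 ^ 0 = 1\<close>, the case \<open>s = 0\<close> forces functions of degree
  0 to be constant. The zero function is homogeneous of every degree.\<close>

definition homogeneous :: "nat \<Rightarrow> ('a::euclidean_space \<Rightarrow> real) \<Rightarrow> bool" where
  "homogeneous n f \<longleftrightarrow> real_polynomial_function f \<and> (\<forall>s x. f (s *\<^sub>R x) = s ^ n * f x)"

definition degree_le :: "nat \<Rightarrow> ('a::euclidean_space \<Rightarrow> real) set" where
  "degree_le N = {\<lambda>x. \<Sum>j\<le>N. a j x | a. \<forall>j. homogeneous j (a j)}"

lemma homogeneous_zero: "homogeneous n (\<lambda>x. 0)"
  by (simp add: homogeneous_def real_polynomial_const)

lemma homogeneous_add: "homogeneous n f \<Longrightarrow> homogeneous n g \<Longrightarrow> homogeneous n (\<lambda>x. f x + g x)"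
  by (simp add: homogeneous_def real_polynomial_add algebra_simps)

lemma homogeneous_cmul: "homogeneous n f \<Longrightarrow> homogeneous n (\<lambda>x. c * f x)"
  by (simp add: homogeneous_def real_polynomial_mult real_polynomial_const)

lemma degree_le_subspace: "fun_subspace (degree_le N :: ('a::euclidean_space \<Rightarrow> real) set)"
  unfolding fun_subspace_def
proof (intro conjI ballI allI)
  show "(\<lambda>x::'a. 0) \<in> degree_le N"
    using homogeneous_zero by (fastforce simp: degree_le_def intro: exI[of _ "\<lambda>j x. 0"])
next
  fix f g :: "'a \<Rightarrow> real" assume "f \<in> degree_le N" "g \<in> degree_le N"
  then obtain a b where "f = (\<lambda>x. \<Sum>j\<le>N. a j x)" "g = (\<lambda>x. \<Sum>j\<le>N. b j x)"
    "\<forall>j. homogeneous j (a j)" "\<forall>j. homogeneous j (b j)" by (auto simp: degree_le_def)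
  then show "(\<lambda>x. f x + g x) \<in> degree_le N"
    unfolding degree_le_def
    by (intro CollectI exI[of _ "\<lambda>j x. a j x + b j x"]) (simp add: sum.distrib homogeneous_add)
next
  fix c and f :: "'a \<Rightarrow> real" assume "f \<in> degree_le N"
  then obtain a where "f = (\<lambda>x. \<Sum>j\<le>N. a j x)" "\<forall>j. homogeneous j (a j)" by (auto simp: degree_le_def)
  then show "(\<lambda>x. c * f x) \<in> degree_le N"
    unfolding degree_le_def
    by (intro CollectI exI[of _ "\<lambda>j x. c * a j x"]) (simp add: sum_distrib_left homogeneous_cmul)
qed

lemma homogeneous_degree_le:
  assumes "homogeneous j f" "j \<le> N"
  shows "f \<in> degree_le N"
proof -
  have "f x = (\<Sum>i\<le>N. (if i = j then f x else 0))" for x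
    using assms(2) by (simp add: sum.delta)
  moreover have "homogeneous i (\<lambda>x. if i = j then f x else 0)" for i
    using assms(1) homogeneous_zero by (cases "i = j") auto
  ultimately show ?thesis
    unfolding degree_le_def by (auto simp: fun_eq_iff intro!: exI[of _ "\<lambda>i x. if i = j then f x else 0"])
qed

lemma degree_le_mono:
  assumes "M \<le> N"
  shows "degree_le M \<subseteq> degree_le N"
proof
  fix f assume "f \<in> degree_le M"
  then obtain a where a: "f = (\<lambda>x. \<Sum>j\<le>M. a j x)" "\<forall>j. homogeneous j (a j)" by (auto simp: degree_le_def)
  show "f \<in> degree_le N"
    unfolding a(1)
  proof (rule fun_subspace_sum[OF degree_le_subspace])
    fix j assume "j \<in> {..M}"
    then show "a j \<in> degree_le N" using a(2) assms by (intro homogeneous_degree_le[of j]) auto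
  qed
qed

lemma degree_le_polynomial: "f \<in> degree_le N \<Longrightarrow> real_polynomial_function f"
  by (auto simp: degree_le_def homogeneous_def intro!: real_polynomial_function_sum)

text \<open>The homogeneous components are the coefficients of \<open>s\<close> in
  \<open>f (s *\<^sub>R x)\<close>; expanding \<open>f\<close> at \<open>s * t\<close> times
  \<open>x\<close> in two ways shows their homogeneity.\<close>

lemma polynomial_degree_le:
  assumes f: "real_polynomial_function f"
  shows "\<exists>N. f \<in> degree_le N"
proof -
  define P where "P z = f (snd z *\<^sub>R fst z)" for z :: "'a \<times> real"
  have "real_polynomial_function P"
    unfolding P_def
    by (intro real_polynomial_compose[OF _ f] polynomial_function_mult polynomial_function_bounded_linear
        bounded_linear_fst bounded_linear_snd)
  from polynomial_expansion[OF this] obtain N a where "expands P N a" by blast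
  then have pa: "\<And>j. real_polynomial_function (a j)" and zero: "\<And>j x. j > N \<Longrightarrow> a j x = 0"
    and P: "\<And>x s. P (x, s) = (\<Sum>j\<le>N. s ^ j * a j x)"
    by (auto simp: expands_def)
  have "a j (t *\<^sub>R x) = t ^ j * a j x" for j t x
  proof (cases "j \<le> N")
    case True
    have "(\<Sum>j\<le>N. a j (t *\<^sub>R x) * s ^ j) = (\<Sum>j\<le>N. (t ^ j * a j x) * s ^ j)" for s
      using P[of "t *\<^sub>R x" s] P[of x "s * t"] by (simp add: P_def power_mult_distrib mult_ac)
    then show ?thesis
      using True polyfun_eq_coeffs[of "\<lambda>j. a j (t *\<^sub>R x)" N "\<lambda>j. t ^ j * a j x"] by blast
  qed (simp add: zero)
  then have hom: "\<forall>j. homogeneous j (a j)" using pa by (simp add: homogeneous_def)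
  have "f = (\<lambda>x. \<Sum>j\<le>N. a j x)"
    using P[of _ 1] by (auto simp: P_def)
  then show ?thesis using hom by (auto simp: degree_le_def)
qed

lemma degree_le_compose:
  assumes f: "f \<in> degree_le N" and g: "linear g"
  shows "(\<lambda>x. f (g x)) \<in> degree_le N"
proof -
  obtain a where a: "f = (\<lambda>x. \<Sum>j\<le>N. a j x)" "\<forall>j. homogeneous j (a j)"
    using f by (auto simp: degree_le_def)
  have "polynomial_function g"
    using g by (intro polynomial_function_bounded_linear) (simp add: linear_conv_bounded_linear)
  then have "homogeneous j (\<lambda>x. a j (g x))" for j
    using a(2) by (simp add: homogeneous_def linear_cmul[OF g] real_polynomial_compose)
  then show ?thesis
    unfolding a(1) degree_le_def by (intro CollectI exI[of _ "\<lambda>j x. a j (g x)"]) simp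
qed

section \<open>Euler's identity and the degrees of derivatives\<close>

lemma homogeneous_euler:
  assumes f: "homogeneous n f"
  shows "x \<bullet> grad f x = n * f x"
proof -
  have pf: "real_polynomial_function f" using f by (simp add: homogeneous_def)
  have "((\<lambda>t. f (x + t *\<^sub>R x)) has_real_derivative grad f (x + 0 *\<^sub>R x) \<bullet> x) (at 0)"
    by (rule has_real_derivative_line[OF pf])
  moreover have "f (x + t *\<^sub>R x) = (1 + t) ^ n * f x" for t
    using f unfolding homogeneous_def by (metis scaleR_one scaleR_add_left)
  moreover have "((\<lambda>t. (1 + t) ^ n * f x) has_real_derivative (real n * (1 + 0) ^ (n - 1)) * f x) (at 0)"
    by (auto intro!: derivative_eq_intros)
  ultimately show ?thesis by (auto dest: DERIV_unique simp: inner_commute)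
qed

text \<open>For operators that lower the degree by \<open>m\<close>. Dividing by
  \<open>s ^ m\<close> is possible only for \<open>s \<noteq> 0\<close>; continuity settles
  \<open>s = 0\<close>. For \<open>j < m\<close> the difference \<open>j - m\<close> is truncated to
  0, hence the separate claim that \<open>g\<close> vanishes.\<close>

lemma homogeneousI_shift:
  assumes g: "real_polynomial_function g" and eq: "\<And>s x. s ^ m * g (s *\<^sub>R x) = s ^ j * g x"
  shows "homogeneous (j - m) g \<and> (j < m \<longrightarrow> g = (\<lambda>x. 0))"
proof -
  have lim: "((\<lambda>s. g (s *\<^sub>R x)) \<longlongrightarrow> g (0 *\<^sub>R x)) (at 0)" for x
  proof -
    have "continuous_on UNIV (\<lambda>s. g (s *\<^sub>R x))"
      by (intro continuous_on_compose2[OF continuous_on_real_polynomial[OF g, of UNIV]] continuous_intros) auto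
    then show ?thesis unfolding continuous_on_eq_continuous_at[OF open_UNIV] isCont_def by blast
  qed
  show ?thesis
  proof (cases "j < m")
    case True
    have "g x = 0" for x
    proof -
      have "((\<lambda>s. s ^ (m - j) * g (s *\<^sub>R x)) \<longlongrightarrow> 0 ^ (m - j) * g (0 *\<^sub>R x)) (at 0)"
        by (rule tendsto_mult[OF tendsto_power[OF tendsto_ident_at] lim])
      moreover have "eventually (\<lambda>s. s ^ (m - j) * g (s *\<^sub>R x) = g x) (at 0)"
        unfolding eventually_at_filter
      proof (rule always_eventually, intro allI impI)
        fix s :: real assume "s \<noteq> 0"
        moreover have "s ^ m = s ^ j * s ^ (m - j)" using True by (simp flip: power_add)
        ultimately show "s ^ (m - j) * g (s *\<^sub>R x) = g x"
          using eq[of s x] by simp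
      qed
      ultimately have "((\<lambda>s. g x) \<longlongrightarrow> 0 ^ (m - j) * g (0 *\<^sub>R x)) (at (0::real))"
        by (rule Lim_transform_eventually)
      then have "g x = 0 ^ (m - j) * g (0 *\<^sub>R x)" by (simp add: tendsto_const_iff)
      then show ?thesis using True by simp
    qed
    then have "g = (\<lambda>x. 0)" by blast
    then show ?thesis using homogeneous_zero by simp
  next
    case False
    have nz: "g (s *\<^sub>R x) = s ^ (j - m) * g x" if "s \<noteq> 0" for s x
    proof -
      have "s ^ j = s ^ m * s ^ (j - m)" using False by (simp flip: power_add)
      then show ?thesis using eq[of s x] that by simp
    qed
    have "g (0 *\<^sub>R x) = 0 ^ (j - m) * g x" for x
    proof -
      have "((\<lambda>s. s ^ (j - m) * g x) \<longlongrightarrow> 0 ^ (j - m) * g x) (at 0)"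
        by (intro tendsto_intros)
      moreover have "eventually (\<lambda>s. s ^ (j - m) * g x = g (s *\<^sub>R x)) (at 0)"
        unfolding eventually_at_filter by (rule always_eventually) (use nz in auto)
      ultimately have "((\<lambda>s. g (s *\<^sub>R x)) \<longlongrightarrow> 0 ^ (j - m) * g x) (at 0)"
        by (rule Lim_transform_eventually)
      then show ?thesis using tendsto_unique[OF _ lim] by (metis at_neq_bot)
    qed
    then have "g (s *\<^sub>R x) = s ^ (j - m) * g x" for s x using nz by (cases "s = 0") auto
    then show ?thesis using False g by (simp add: homogeneous_def)
  qed
qed

lemma grad_scale:
  assumes f: "real_polynomial_function f"
  shows "grad (\<lambda>x. f (s *\<^sub>R x)) x = s *\<^sub>R grad f (s *\<^sub>R x)"
proof (rule grad_eqI)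
  have "((\<lambda>x. f (s *\<^sub>R x)) has_derivative (\<lambda>h. grad f (s *\<^sub>R x) \<bullet> (s *\<^sub>R h))) (at x)"
    by (rule has_derivative_compose[OF _ has_derivative_grad[OF f]]) (auto intro!: derivative_eq_intros)
  then show "((\<lambda>x. f (s *\<^sub>R x)) has_derivative (\<lambda>h. s *\<^sub>R grad f (s *\<^sub>R x) \<bullet> h)) (at x)"
    by simp
qed

lemma homogeneous_grad:
  assumes f: "homogeneous n f"
  shows "homogeneous (n - 1) (\<lambda>x. grad f x \<bullet> b) \<and> (n < 1 \<longrightarrow> (\<lambda>x. grad f x \<bullet> b) = (\<lambda>x. 0))"
proof (rule homogeneousI_shift)
  have pf: "real_polynomial_function f" using f by (simp add: homogeneous_def)
  then show "real_polynomial_function (\<lambda>x. grad f x \<bullet> b)" by (rule real_polynomial_grad_inner)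
  fix s x
  have "(\<lambda>x. f (s *\<^sub>R x)) = (\<lambda>x. s ^ n * f x)" using f by (simp add: homogeneous_def)
  then have "s *\<^sub>R grad f (s *\<^sub>R x) = s ^ n *\<^sub>R grad f x"
    using grad_scale[OF pf, of s x] by (simp add: grad_cmul[OF pf])
  then show "s ^ 1 * (grad f (s *\<^sub>R x) \<bullet> b) = s ^ n * (grad f x \<bullet> b)"
    by (metis inner_scaleR_left power_one_right)
qed

lemma homogeneous_laplacian:
  assumes f: "homogeneous n f"
  shows "homogeneous (n - 2) (laplacian f) \<and> (n < 2 \<longrightarrow> laplacian f = (\<lambda>x. 0))"
proof (rule homogeneousI_shift)
  have pf: "real_polynomial_function f" using f by (simp add: homogeneous_def)
  then show "real_polynomial_function (laplacian f)" by (rule real_polynomial_laplacian)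
  fix s x
  have pfs: "real_polynomial_function (\<lambda>x. f (s *\<^sub>R x))"
    using f pf by (simp add: homogeneous_def real_polynomial_mult real_polynomial_const)
  have "hess (\<lambda>x. f (s *\<^sub>R x)) x b b = s\<^sup>2 * hess f (s *\<^sub>R x) b b" for b
  proof -
    have "real_polynomial_function (\<lambda>x. grad f (s *\<^sub>R x) \<bullet> b)"
      by (rule real_polynomial_compose[OF polynomial_function_bounded_linear[OF bounded_linear_scaleR_right]
            real_polynomial_grad_inner[OF pf]])
    then have "grad (\<lambda>x. s * (grad f (s *\<^sub>R x) \<bullet> b)) x = s *\<^sub>R s *\<^sub>R grad (\<lambda>x. grad f x \<bullet> b) (s *\<^sub>R x)"
      by (simp only: grad_cmul grad_scale[OF real_polynomial_grad_inner[OF pf]])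
    then show ?thesis
      by (simp add: hess_def grad_scale[OF pf] power2_eq_square)
  qed
  then have "laplacian (\<lambda>x. f (s *\<^sub>R x)) x = s\<^sup>2 * laplacian f (s *\<^sub>R x)"
    by (simp add: laplacian_eq_hess[OF pfs] laplacian_eq_hess[OF pf] sum_distrib_left)
  moreover have "laplacian (\<lambda>x. f (s *\<^sub>R x)) x = s ^ n * laplacian f x"
    using f laplacian_cmul[OF pf, of "s ^ n"] by (simp add: homogeneous_def)
  ultimately show "s ^ 2 * laplacian f (s *\<^sub>R x) = s ^ n * laplacian f x" by simp
qed

text \<open>Euler's identity writes \<open>f\<close> through coordinates times partial derivatives,
  which have degree one less, so no monomial basis has to be set up.\<close>

lemma homogeneous_finite_span:
  "\<exists>(I::nat set) e. finite I \<and> {f::'a::euclidean_space \<Rightarrow> real. homogeneous n f} \<subseteq> fun_span e I"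
proof (induction n)
  case 0
  have "{f::'a \<Rightarrow> real. homogeneous 0 f} \<subseteq> fun_span (\<lambda>_ _. 1) {0::nat}"
  proof
    fix f :: "'a \<Rightarrow> real" assume "f \<in> {f. homogeneous 0 f}"
    then have "f (0 *\<^sub>R x) = f x" for x unfolding homogeneous_def by (simp del: scaleR_zero_left)
    then have "f x = f 0" for x using scaleR_zero_left[of x] by metis
    then show "f \<in> fun_span (\<lambda>_ _. 1) {0::nat}"
      unfolding fun_span_def by (intro CollectI exI[of _ "\<lambda>_. f 0"]) auto
  qed
  then show ?case by blast
next
  case (Suc n)
  then obtain I :: "nat set" and e :: "nat \<Rightarrow> 'a \<Rightarrow> real"
    where I: "finite I" and sub: "{f. homogeneous n f} \<subseteq> fun_span e I" by blast
  define E where "E p x = (x \<bullet> fst p) * e (snd p) x" for p :: "'a \<times> nat" and x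
  have fin: "finite ((Basis::'a set) \<times> I)" using I by simp
  have span: "f \<in> fun_span E (Basis \<times> I)" if f: "homogeneous (Suc n) f" for f
  proof -
    have ex: "\<forall>b. \<exists>c. (\<lambda>x. grad f x \<bullet> b) = (\<lambda>x. \<Sum>i\<in>I. c i * e i x)"
    proof
      fix b
      have "homogeneous n (\<lambda>x. grad f x \<bullet> b)" using homogeneous_grad[OF f, of b] by simp
      then have "(\<lambda>x. grad f x \<bullet> b) \<in> fun_span e I" using sub by blast
      then show "\<exists>c. (\<lambda>x. grad f x \<bullet> b) = (\<lambda>x. \<Sum>i\<in>I. c i * e i x)" by (simp add: fun_span_def)
    qed
    obtain c where "\<forall>b. (\<lambda>x. grad f x \<bullet> b) = (\<lambda>x. \<Sum>i\<in>I. c b i * e i x)"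
      using choice[OF ex] ..
    then have c: "grad f x \<bullet> b = (\<Sum>i\<in>I. c b i * e i x)" for b x by (simp add: fun_eq_iff)
    have "f x = (\<Sum>p\<in>Basis \<times> I. (c (fst p) (snd p) / Suc n) * E p x)" for x
    proof -
      have "Suc n * f x = (\<Sum>b\<in>Basis. (x \<bullet> b) * (grad f x \<bullet> b))"
        using homogeneous_euler[OF f, of x] euclidean_inner[of x "grad f x"] by simp
      also have "\<dots> = (\<Sum>b\<in>Basis. \<Sum>i\<in>I. (x \<bullet> b) * (c b i * e i x))"
        by (simp add: c sum_distrib_left)
      also have "\<dots> = (\<Sum>p\<in>Basis \<times> I. (x \<bullet> fst p) * (c (fst p) (snd p) * e (snd p) x))"
        by (simp add: sum.cartesian_product case_prod_beta)
      finally have "f x = (\<Sum>p\<in>Basis \<times> I. (x \<bullet> fst p) * (c (fst p) (snd p) * e (snd p) x)) / Suc n"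
        by (simp add: field_simps)
      then show ?thesis by (simp add: sum_divide_distrib E_def mult_ac)
    qed
    then show ?thesis
      unfolding fun_span_def
      by (intro CollectI exI[of _ "\<lambda>p. c (fst p) (snd p) / Suc n"] conjI ext TrueI)
  qed
  \<comment> \<open>The pairs are renumbered because the statement under induction fixes the index
    type \<open>nat\<close>.\<close>
  obtain h :: "nat \<Rightarrow> 'a \<times> nat" and m where h: "bij_betw h {0..<m} (Basis \<times> I)"
    using ex_bij_betw_nat_finite[OF fin] by blast
  have "fun_span E (Basis \<times> I) \<subseteq> fun_span (\<lambda>i. E (h i)) {0..<m}"
  proof
    fix f assume "f \<in> fun_span E (Basis \<times> I)"
    then obtain c where "f = (\<lambda>x. \<Sum>p\<in>Basis \<times> I. c p * E p x)" by (auto simp: fun_span_def)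
    then have "f = (\<lambda>x. \<Sum>i\<in>{0..<m}. c (h i) * E (h i) x)"
      using sum.reindex_bij_betw[OF h, of "\<lambda>p. c p * E p _"] by simp
    then show "f \<in> fun_span (\<lambda>i. E (h i)) {0..<m}" by (auto simp: fun_span_def)
  qed
  then show ?case using span by (intro exI[of _ "{0..<m}"] exI[of _ "\<lambda>i. E (h i)"]) auto
qed

lemma degree_le_determined: "\<exists>Z. determined_by (degree_le N :: ('a::euclidean_space \<Rightarrow> real) set) Z"
proof -
  have "\<forall>n. \<exists>(I::nat set) e. finite I \<and> {f::'a \<Rightarrow> real. homogeneous n f} \<subseteq> fun_span e I"
    using homogeneous_finite_span by blast
  then obtain I :: "nat \<Rightarrow> nat set" and e :: "nat \<Rightarrow> nat \<Rightarrow> 'a \<Rightarrow> real"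
    where I: "\<And>n. finite (I n)" and sub: "\<And>n. {f. homogeneous n f} \<subseteq> fun_span (e n) (I n)" by metis
  have fin: "finite (SIGMA n:{..N}. I n)" using I by simp
  have "degree_le N \<subseteq> fun_span (\<lambda>p. e (fst p) (snd p)) (SIGMA n:{..N}. I n)"
  proof
    fix f :: "'a \<Rightarrow> real" assume "f \<in> degree_le N"
    then obtain a where a: "f = (\<lambda>x. \<Sum>j\<le>N. a j x)" "\<forall>j. homogeneous j (a j)" by (auto simp: degree_le_def)
    have "\<forall>j. \<exists>c. a j = (\<lambda>x. \<Sum>i\<in>I j. c i * e j i x)"
      using a(2) sub by (auto simp: fun_span_def)
    then obtain c where c: "\<And>j x. a j x = (\<Sum>i\<in>I j. c j i * e j i x)" by metis
    have "f = (\<lambda>x. \<Sum>p\<in>(SIGMA n:{..N}. I n). c (fst p) (snd p) * e (fst p) (snd p) x)"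
      unfolding a(1) c using I by (auto simp: sum.Sigma case_prod_beta)
    then show "f \<in> fun_span (\<lambda>p. e (fst p) (snd p)) (SIGMA n:{..N}. I n)"
      unfolding fun_span_def by (intro CollectI exI[of _ "\<lambda>p. c (fst p) (snd p)"]) simp
  qed
  then show ?thesis using fun_span_determined[OF fin] determined_by_subset by blast
qed

text \<open>On the line through \<open>y\<close> and a point of \<open>U\<close>, the polynomial has
  infinitely many zeros.\<close>

lemma polynomial_zero_on_open:
  fixes f :: "'a::euclidean_space \<Rightarrow> real"
  assumes f: "real_polynomial_function f" and U: "open U" "U \<noteq> {}" and zero: "\<And>x. x \<in> U \<Longrightarrow> f x = 0"
  shows "f = (\<lambda>x. 0)"
proof
  fix y
  obtain x where x: "x \<in> U" using U by blast
  define p where "p t = f (x + t *\<^sub>R (y - x))" for t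
  have "real_polynomial_function p"
    unfolding p_def
    by (rule real_polynomial_compose[OF polynomial_function_add[OF polynomial_function_const
          polynomial_function_bounded_linear[OF bounded_linear_scaleR_left]] f])
  then obtain a n where p: "p = (\<lambda>t. \<Sum>i\<le>n. a i * t ^ i)"
    using real_polynomial_function_imp_sum by blast
  have "open ((\<lambda>t. x + t *\<^sub>R (y - x)) -` U)"
    by (intro open_vimage U continuous_intros)
  moreover have "0 \<in> (\<lambda>t. x + t *\<^sub>R (y - x)) -` U" using x by simp
  ultimately obtain e where e: "e > 0" "ball 0 e \<subseteq> (\<lambda>t. x + t *\<^sub>R (y - x)) -` U"
    by (meson open_contains_ball)
  have "{0<..<e} \<subseteq> {t. (\<Sum>i\<le>n. a i * t ^ i) = 0}"
  proof
    fix t assume "t \<in> {0<..<e}"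
    then have "t \<in> ball 0 e" by simp
    then have "f (x + t *\<^sub>R (y - x)) = 0" using e(2) zero by blast
    then show "t \<in> {t. (\<Sum>i\<le>n. a i * t ^ i) = 0}" using fun_cong[OF p, of t] by (simp add: p_def)
  qed
  then have "infinite {t. (\<Sum>i\<le>n. a i * t ^ i) = 0}"
    by (rule infinite_super) (use e(1) in \<open>simp add: infinite_Ioo\<close>)
  then have "\<forall>i\<le>n. a i = 0" using polyfun_finite_roots[of a n] by blast
  then have "p 1 = 0" by (simp add: p)
  then show "f y = 0" by (simp add: p_def)
qed

subsection \<open>A weighted inner product on the ball\<close>

lemma integrable_compact_support:
  fixes F :: "'a::euclidean_space \<Rightarrow> real"
  assumes "continuous_on UNIV F" and "\<And>x. x \<notin> cball 0 R \<Longrightarrow> F x = 0"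
  shows "integrable lborel F"
proof -
  have "integrable lborel (\<lambda>x. indicator (cball 0 R) x *\<^sub>R F x)"
    using assms(1) by (intro borel_integrable_compact compact_cball) (rule continuous_on_subset, auto)
  moreover have "(\<lambda>x. indicator (cball 0 R) x *\<^sub>R F x) = F"
    by (rule ext) (use assms(2) in \<open>auto simp: indicator_def\<close>)
  ultimately show ?thesis by simp
qed

lemma integral_zero_continuous:
  fixes F :: "'a::euclidean_space \<Rightarrow> real"
  assumes F: "continuous_on UNIV F" and int: "integrable lborel F" and pos: "\<And>x. 0 \<le> F x"
    and zero: "(LINT x|lborel. F x) = 0"
  shows "F x = 0"
proof (rule ccontr)
  assume "F x \<noteq> 0"
  have op: "open {x. F x \<noteq> 0}"
    using F by (intro open_Collect_neq continuous_intros)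
  have "AE x in lborel. F x = 0"
    using integral_nonneg_eq_0_iff_AE[OF int] pos zero by simp
  then have "{x \<in> space lborel. \<not> F x = 0} \<in> null_sets lborel"
    using op by (subst (asm) AE_iff_null) auto
  then have "{x. F x \<noteq> 0} \<in> null_sets lebesgue" by (simp add: null_sets_completionI)
  then have "negligible {x. F x \<noteq> 0}" by (simp add: negligible_iff_null_sets)
  then show False using open_not_negligible[OF op] \<open>F x \<noteq> 0\<close> by blast
qed

text \<open>By translation invariance every difference quotient integrates to 0; dominated
  convergence passes this to the derivative, so neither Fubini nor iterated integrals occur.\<close>

lemma integral_derivative_compact_support:
  fixes F F' :: "'a::euclidean_space \<Rightarrow> real"
  assumes der: "\<And>x t. ((\<lambda>t. F (x + t *\<^sub>R b)) has_real_derivative F' (x + t *\<^sub>R b)) (at t)"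
    and contF: "continuous_on UNIV F" and contF': "continuous_on UNIV F'"
    and supp: "\<And>x. x \<notin> cball 0 R \<Longrightarrow> F x = 0" and supp': "\<And>x. x \<notin> cball 0 R \<Longrightarrow> F' x = 0"
  shows "(LINT x|lborel. F' x) = 0"
proof -
  have "compact (F' ` cball 0 R)"
    using contF' by (intro compact_continuous_image compact_cball) (rule continuous_on_subset, auto)
  then obtain C0 where C0: "\<And>y. y \<in> F' ` cball 0 R \<Longrightarrow> norm y \<le> C0"
    using compact_imp_bounded bounded_iff by metis
  define C where "C = max C0 0"
  have C: "\<bar>F' x\<bar> \<le> C" for x
    using C0[of "F' x"] supp'[of x] by (cases "x \<in> cball 0 R") (auto simp: C_def)
  define h where "h n = inverse (real (Suc n))" for n
  have h: "0 < h n" "h n \<le> 1" for n by (auto simp: h_def inverse_eq_divide)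
  define s where "s n x = (F (h n *\<^sub>R b + x) - F x) / h n" for n x
  \<comment> \<open>The steps \<open>h n\<close> are at most 1, so every difference quotient
    vanishes outside the ball enlarged by \<open>norm b\<close>; the mean value theorem gives the
    height \<open>C\<close>.\<close>
  define w where "w x = C * indicator (cball 0 (R + norm b)) x" for x :: 'a
  have intF: "integrable lborel F" by (rule integrable_compact_support[OF contF supp])
  have meas: "F \<in> borel_measurable borel" using contF by (rule borel_measurable_continuous_onI)
  have shift: "integrable lborel (\<lambda>x. F (c + x))" "(LINT x|lborel. F (c + x)) = (LINT x|lborel. F x)" for c
  proof -
    have m: "(+) c \<in> measurable lborel borel" by simp
    have "integrable (distr lborel borel ((+) c)) F" by (simp add: lborel_distr_plus intF)
    then show "integrable lborel (\<lambda>x. F (c + x))"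
      by (subst (asm) integrable_distr_eq[OF m meas])
    have "(LINT x|lborel. F x) = (LINT x|distr lborel borel ((+) c). F x)" by (simp add: lborel_distr_plus)
    also have "\<dots> = (LINT x|lborel. F (c + x))" by (rule integral_distr[OF m meas])
    finally show "(LINT x|lborel. F (c + x)) = (LINT x|lborel. F x)" by simp
  qed
  have s0: "(LINT x|lborel. s n x) = 0" for n
    using shift[of "h n *\<^sub>R b"] intF by (simp add: s_def)
  have bound: "\<bar>s n x\<bar> \<le> w x" for n x
  proof (cases "x \<in> cball 0 (R + norm b)")
    case True
    obtain t where "F (x + h n *\<^sub>R b) - F (x + 0 *\<^sub>R b) = (h n - 0) * F' (x + t *\<^sub>R b)"
      using MVT2[of 0 "h n" "\<lambda>t. F (x + t *\<^sub>R b)" "\<lambda>t. F' (x + t *\<^sub>R b)"] der h by metis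
    then have "s n x = F' (x + t *\<^sub>R b)" using h(1)[of n] by (simp add: s_def add.commute)
    then show ?thesis using C True by (simp add: w_def)
  next
    case False
    have "norm (h n *\<^sub>R b) \<le> norm b" using h[of n] by (simp add: mult_left_le_one_le)
    then have "R < norm (h n *\<^sub>R b + x)" "R < norm x"
      using False norm_triangle_ineq2[of x "- (h n *\<^sub>R b)"] norm_ge_zero[of b]
      unfolding mem_cball_0 diff_minus_eq_add norm_minus_cancel add.commute[of x] by linarith+
    then have "s n x = 0" using supp[of x] supp[of "h n *\<^sub>R b + x"] by (simp add: s_def)
    then show ?thesis using False by (simp add: w_def)
  qed
  have "(\<lambda>n. LINT x|lborel. s n x) \<longlonglongrightarrow> (LINT x|lborel. F' x)"
  proof (rule integral_dominated_convergence[where w=w])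
    show "F' \<in> borel_measurable lborel" using borel_measurable_continuous_onI[OF contF'] by simp
    show "s n \<in> borel_measurable lborel" for n
      using meas unfolding s_def by measurable
    show "integrable lborel w"
      unfolding w_def by (intro integrable_mult_right integrable_real_indicator)
        (use emeasure_bounded_finite[OF bounded_cball] in auto)
    show "AE x in lborel. norm (s n x) \<le> w x" for n using bound by simp
    have "(\<lambda>n. s n x) \<longlonglongrightarrow> F' x" for x
    proof -
      have "(\<lambda>t. (F (x + (0 + t) *\<^sub>R b) - F (x + 0 *\<^sub>R b)) / t) \<midarrow>0\<rightarrow> F' (x + 0 *\<^sub>R b)"
        using der[of x 0] unfolding DERIV_def .
      moreover have "filterlim h (at 0) sequentially"
        unfolding filterlim_at using LIMSEQ_inverse_real_of_nat h by (auto simp: h_def[abs_def] less_imp_neq[symmetric])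
      ultimately have "(\<lambda>n. (F (x + (0 + h n) *\<^sub>R b) - F (x + 0 *\<^sub>R b)) / h n) \<longlonglongrightarrow> F' (x + 0 *\<^sub>R b)"
        by (rule filterlim_compose)
      then show ?thesis by (simp add: s_def add.commute)
    qed
    then show "AE x in lborel. (\<lambda>n. s n x) \<longlonglongrightarrow> F' x" by simp
  qed
  then have "(\<lambda>n. 0) \<longlonglongrightarrow> (LINT x|lborel. F' x)" by (simp only: s0)
  then show ?thesis by (simp add: LIMSEQ_const_iff)
qed

lemma DERIV_pos_part_square: "((\<lambda>u::real. (max 0 u)\<^sup>2) has_real_derivative 2 * max 0 u) (at u)"
proof -
  consider "u < 0" | "u > 0" | "u = 0" by linarith
  then show ?thesis
  proof cases
    case 1
    have "((\<lambda>u. 0) has_real_derivative 0) (at u)" by simp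
    moreover have "eventually (\<lambda>v. 0 = (max 0 v)\<^sup>2) (nhds u)"
      using eventually_nhds_in_open[of "{..<0}" u] 1 by (auto elim!: eventually_mono simp: max_def)
    ultimately show ?thesis using 1 by (subst DERIV_cong_ev[OF refl _ refl, of _ "\<lambda>u. 0"]) (auto elim: eventually_mono simp: max_def)
  next
    case 2
    have "((\<lambda>u. u\<^sup>2) has_real_derivative 2 * u) (at u)" by (auto intro!: derivative_eq_intros)
    moreover have "eventually (\<lambda>v. (max 0 v)\<^sup>2 = v\<^sup>2) (nhds u)"
      using eventually_nhds_in_open[of "{0<..}" u] 2 by (auto elim!: eventually_mono simp: max_def)
    ultimately show ?thesis using 2 by (subst DERIV_cong_ev[OF refl _ refl, of _ "\<lambda>u. u\<^sup>2"]) (auto simp: max_def)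
  next
    case 3
    have "((\<lambda>h. (max 0 h)\<^sup>2 / h) \<longlongrightarrow> 0) (at (0::real))"
    proof (rule Lim_null_comparison)
      have "norm ((max 0 h)\<^sup>2 / h) \<le> \<bar>h\<bar>" for h :: real
        by (cases "h > 0") (auto simp: max_def power2_eq_square)
      then show "\<forall>\<^sub>F h in at (0::real). norm ((max 0 h)\<^sup>2 / h) \<le> \<bar>h\<bar>" by simp
      show "((\<lambda>h. \<bar>h\<bar>) \<longlongrightarrow> 0) (at (0::real))" by (rule tendsto_rabs_zero) (rule tendsto_ident_at)
    qed
    then show ?thesis using 3 by (simp add: DERIV_def)
  qed
qed

text \<open>The square makes the weight continuously differentiable across the sphere of radius
  \<rho>, so that it can be differentiated on the whole space.\<close>

definition bump :: "real \<Rightarrow> 'a::euclidean_space \<Rightarrow> real" where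
  "bump \<rho> x = (max 0 (\<rho>\<^sup>2 - x \<bullet> x))\<^sup>2"

definition ball_inner :: "real \<Rightarrow> ('a::euclidean_space \<Rightarrow> real) \<Rightarrow> ('a \<Rightarrow> real) \<Rightarrow> real" where
  "ball_inner \<rho> f g = (LINT x|lborel. bump \<rho> x * (f x * g x))"

lemma continuous_on_bump [continuous_intros]: "continuous_on S (bump \<rho>)"
  unfolding bump_def by (intro continuous_intros)

lemma bump_outside: "\<rho> > 0 \<Longrightarrow> x \<notin> cball 0 \<rho> \<Longrightarrow> \<rho>\<^sup>2 - x \<bullet> x \<le> 0"
  by (auto simp: dot_square_norm dest: power_strict_mono[where n=2])

lemma bump_zero: "\<rho> > 0 \<Longrightarrow> x \<notin> cball 0 \<rho> \<Longrightarrow> bump \<rho> x = 0"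
  using bump_outside[of \<rho> x] by (simp add: bump_def max_def)

lemma bump_pos: "x \<in> ball 0 \<rho> \<Longrightarrow> bump \<rho> x > 0"
  using power_strict_mono[of "norm x" \<rho> 2] by (auto simp: bump_def dot_square_norm max_def)

lemma bump_nonneg: "bump \<rho> x \<ge> 0" by (simp add: bump_def)

lemma integrable_bump:
  assumes "\<rho> > 0" "continuous_on UNIV f"
  shows "integrable lborel (\<lambda>x. bump \<rho> x * f x)"
  by (rule integrable_compact_support[of _ \<rho>])
    (use assms bump_zero in \<open>auto intro!: continuous_intros\<close>)

text \<open>The factor 4 comes from differentiating the weight: 2 from the square and 2 from the
  gradient of \<open>x \<bullet> x\<close>.\<close>

lemma integral_divergence_bump:
  assumes h: "real_polynomial_function h" and r: "\<rho> > 0"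
  shows "(LINT x|lborel. bump \<rho> x * (grad h x \<bullet> b) - 4 * max 0 (\<rho>\<^sup>2 - x \<bullet> x) * (x \<bullet> b) * h x) = 0"
proof (rule integral_derivative_compact_support[where F = "\<lambda>x. bump \<rho> x * h x" and R = \<rho> and b = b])
  fix x and t :: real
  let ?y = "x + t *\<^sub>R b"
  have "((\<lambda>t. \<rho>\<^sup>2 - (x + t *\<^sub>R b) \<bullet> (x + t *\<^sub>R b)) has_real_derivative - 2 * (?y \<bullet> b)) (at t)"
    using has_real_derivative_line[of "\<lambda>x. x \<bullet> x" x b t] la_poly[OF laplacian_algebra_polynomials la_norm[OF laplacian_algebra_polynomials]]
    by (auto intro!: derivative_eq_intros simp: grad_norm)
  from DERIV_chain2[OF DERIV_pos_part_square this]
  have "((\<lambda>t. bump \<rho> (x + t *\<^sub>R b)) has_real_derivative 2 * max 0 (\<rho>\<^sup>2 - ?y \<bullet> ?y) * (- 2 * (?y \<bullet> b))) (at t)"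
    by (simp add: bump_def)
  from DERIV_mult[OF this has_real_derivative_line[OF h]]
  show "((\<lambda>t. bump \<rho> (x + t *\<^sub>R b) * h (x + t *\<^sub>R b)) has_real_derivative
      bump \<rho> ?y * (grad h ?y \<bullet> b) - 4 * max 0 (\<rho>\<^sup>2 - ?y \<bullet> ?y) * (?y \<bullet> b) * h ?y) (at t)"
    by (rule DERIV_cong) (simp add: algebra_simps)
next
  show "continuous_on UNIV (\<lambda>x. bump \<rho> x * h x)"
    by (intro continuous_intros continuous_on_real_polynomial h)
  show "continuous_on UNIV (\<lambda>x. bump \<rho> x * (grad h x \<bullet> b) - 4 * max 0 (\<rho>\<^sup>2 - x \<bullet> x) * (x \<bullet> b) * h x)"
    by (intro continuous_intros continuous_on_real_polynomial continuous_on_grad h)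
  show "bump \<rho> x * h x = 0" if "x \<notin> cball 0 \<rho>" for x using bump_zero[OF r that] by simp
  show "bump \<rho> x * (grad h x \<bullet> b) - 4 * max 0 (\<rho>\<^sup>2 - x \<bullet> x) * (x \<bullet> b) * h x = 0" if "x \<notin> cball 0 \<rho>" for x
    using bump_zero[OF r that] bump_outside[OF r that] by (simp add: max_def)
qed

section \<open>The Euler field and a symmetric operator on the ball\<close>

definition euler :: "('a::euclidean_space \<Rightarrow> real) \<Rightarrow> 'a \<Rightarrow> real" where
  "euler f x = x \<bullet> grad f x"

lemma real_polynomial_euler: "real_polynomial_function f \<Longrightarrow> real_polynomial_function (euler f)"
  unfolding euler_def[abs_def]
  by (intro real_polynomial_inner polynomial_function_grad polynomial_function_id)

text \<open>The divergence form operator of the metric \<open>\<rho>\<^sup>2 I - x x\<^sup>T\<close> with respect to the weight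
  \<open>bump \<rho>\<close>: it is symmetric, and it preserves degrees.\<close>

definition ball_laplacian :: "real \<Rightarrow> ('a::euclidean_space \<Rightarrow> real) \<Rightarrow> 'a \<Rightarrow> real" where
  "ball_laplacian \<rho> f x = \<rho>\<^sup>2 * laplacian f x - euler (euler f) x - (DIM('a) + 4) * euler f x"

lemma real_polynomial_ball_laplacian:
  assumes "real_polynomial_function f"
  shows "real_polynomial_function (ball_laplacian \<rho> f)"
  unfolding ball_laplacian_def[abs_def]
  by (intro real_polynomial_function_diff real_polynomial_mult real_polynomial_const real_polynomial_laplacian
      real_polynomial_euler assms)

text \<open>Green's formula for the field \<open>Y\<close>, which is the matrix
  \<open>\<rho>\<^sup>2 I - x x\<^sup>T\<close> applied to \<open>grad f\<close>; the right-hand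
  side is symmetric in \<open>f\<close> and \<open>g\<close>. In the constant of
  \<open>ball_laplacian\<close>, \<open>DIM('a)\<close> is the divergence of the field
  \<open>x\<close>, and 4 comes from the derivative of the weight.\<close>

lemma ball_inner_green:
  fixes f g :: "'a::euclidean_space \<Rightarrow> real"
  assumes f: "real_polynomial_function f" and g: "real_polynomial_function g" and r: "\<rho> > 0"
  shows "ball_inner \<rho> (ball_laplacian \<rho> f) g
    = - (LINT x|lborel. bump \<rho> x * (\<rho>\<^sup>2 * (grad f x \<bullet> grad g x) - euler f x * euler g x))"
proof -
  define Y where "Y b x = \<rho>\<^sup>2 * (grad f x \<bullet> b) - (x \<bullet> b) * euler f x" for b x
  define h where "h b x = Y b x * g x" for b x
  have pe: "real_polynomial_function (euler f)" by (rule real_polynomial_euler[OF f])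
  have px: "real_polynomial_function (\<lambda>x::'a. x \<bullet> b)" for b
    by (intro real_polynomial_linear bounded_linear_inner_left)
  have gx: "grad (\<lambda>x::'a. x \<bullet> b) x = b" for b x
    by (rule grad_eqI) (auto intro!: derivative_eq_intros simp: inner_commute)
  have p1: "real_polynomial_function (\<lambda>x. \<rho>\<^sup>2 * (grad f x \<bullet> b))" for b
    by (intro real_polynomial_mult real_polynomial_const real_polynomial_grad_inner f)
  have p2: "real_polynomial_function (\<lambda>x. (x \<bullet> b) * euler f x)" for b
    by (intro real_polynomial_mult px pe)
  have pY: "real_polynomial_function (Y b)" for b
    unfolding Y_def[abs_def] by (intro real_polynomial_function_diff p1 p2)
  have ph: "real_polynomial_function (h b)" for b
    unfolding h_def[abs_def] by (intro real_polynomial_mult pY g)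
  have gY: "grad (Y b) x \<bullet> b = \<rho>\<^sup>2 * hess f x b b - (x \<bullet> b) * (grad (euler f) x \<bullet> b) - euler f x * (b \<bullet> b)" for b x
    unfolding Y_def[abs_def] grad_diff[OF p1 p2] grad_mult[OF px pe] gx
      grad_cmul[OF real_polynomial_grad_inner[OF f]]
    by (simp add: inner_diff_left inner_add_left hess_def)
  have gh: "grad (h b) x \<bullet> b = Y b x * (grad g x \<bullet> b) + g x * (grad (Y b) x \<bullet> b)" for b x
    unfolding h_def[abs_def] grad_mult[OF pY g] by (simp add: inner_add_left)
  define m where "m x = max 0 (\<rho>\<^sup>2 - x \<bullet> x)" for x :: 'a
  have pt: "(\<Sum>b\<in>Basis. bump \<rho> x * (grad (h b) x \<bullet> b) - 4 * m x * (x \<bullet> b) * h b x)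
    = bump \<rho> x * (ball_laplacian \<rho> f x * g x)
      + bump \<rho> x * (\<rho>\<^sup>2 * (grad f x \<bullet> grad g x) - euler f x * euler g x)" for x
  proof -
    have a: "(\<Sum>b\<in>Basis. Y b x * (v \<bullet> b)) = \<rho>\<^sup>2 * (grad f x \<bullet> v) - euler f x * (x \<bullet> v)" for v
    proof -
      have "(\<Sum>b\<in>Basis. Y b x * (v \<bullet> b))
        = (\<Sum>b\<in>Basis. \<rho>\<^sup>2 * ((grad f x \<bullet> b) * (v \<bullet> b)) - euler f x * ((x \<bullet> b) * (v \<bullet> b)))"
        by (intro sum.cong refl) (simp add: Y_def algebra_simps)
      then show ?thesis
        by (simp only: sum_subtractf euclidean_inner[of "grad f x" v] euclidean_inner[of x v] sum_distrib_left)
    qed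
    have b: "(\<Sum>b\<in>Basis. grad (Y b) x \<bullet> b) = \<rho>\<^sup>2 * laplacian f x - euler (euler f) x - euler f x * DIM('a)"
      by (simp add: gY sum_subtractf laplacian_eq_hess[OF f] sum_distrib_left
          euclidean_inner[of x "grad (euler f) x"] inner_Basis mult.commute euler_def[of "euler f"])
    have "(\<Sum>b\<in>Basis. bump \<rho> x * (grad (h b) x \<bullet> b) - 4 * m x * (x \<bullet> b) * h b x)
      = bump \<rho> x * ((\<Sum>b\<in>Basis. Y b x * (grad g x \<bullet> b)) + g x * (\<Sum>b\<in>Basis. grad (Y b) x \<bullet> b))
        - 4 * m x * g x * (\<Sum>b\<in>Basis. Y b x * (x \<bullet> b))"
      by (simp add: gh h_def sum_subtractf sum.distrib sum_distrib_left algebra_simps)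
    \<comment> \<open>The metric degenerates radially on the sphere. The factor appearing here
      completes \<open>m\<close> to \<open>bump\<close>, so that differentiating the weight costs
      only a polynomial multiple of the weight.\<close>
    also have "(\<Sum>b\<in>Basis. Y b x * (x \<bullet> b)) = (\<rho>\<^sup>2 - x \<bullet> x) * euler f x"
      unfolding a by (simp add: algebra_simps inner_commute euler_def)
    also have "4 * m x * g x * ((\<rho>\<^sup>2 - x \<bullet> x) * euler f x) = bump \<rho> x * (4 * g x * euler f x)"
      by (simp add: m_def bump_def max_def power2_eq_square)
    finally show ?thesis
      unfolding a b ball_laplacian_def by (simp add: algebra_simps euler_def[of g])
  qed
  have "0 = (\<Sum>b\<in>Basis. (LINT x|lborel. bump \<rho> x * (grad (h b) x \<bullet> b) - 4 * m x * (x \<bullet> b) * h b x))"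
    using integral_divergence_bump[OF ph r] by (simp add: m_def)
  also have "\<dots> = (LINT x|lborel. (\<Sum>b\<in>Basis. bump \<rho> x * (grad (h b) x \<bullet> b) - 4 * m x * (x \<bullet> b) * h b x))"
  proof (rule Bochner_Integration.integral_sum[symmetric])
    fix b :: 'a
    show "integrable lborel (\<lambda>x. bump \<rho> x * (grad (h b) x \<bullet> b) - 4 * m x * (x \<bullet> b) * h b x)"
    proof (rule integrable_compact_support[of _ \<rho>])
      show "continuous_on UNIV (\<lambda>x. bump \<rho> x * (grad (h b) x \<bullet> b) - 4 * m x * (x \<bullet> b) * h b x)"
        unfolding m_def by (intro continuous_intros continuous_on_real_polynomial continuous_on_grad ph)
      show "bump \<rho> x * (grad (h b) x \<bullet> b) - 4 * m x * (x \<bullet> b) * h b x = 0" if "x \<notin> cball 0 \<rho>" for x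
        using bump_zero[OF r that] bump_outside[OF r that] by (simp add: m_def max_def)
    qed
  qed
  also have "\<dots> = ball_inner \<rho> (ball_laplacian \<rho> f) g
    + (LINT x|lborel. bump \<rho> x * (\<rho>\<^sup>2 * (grad f x \<bullet> grad g x) - euler f x * euler g x))"
    unfolding pt ball_inner_def
  proof (rule Bochner_Integration.integral_add; rule integrable_bump[OF r])
    show "continuous_on UNIV (\<lambda>x. ball_laplacian \<rho> f x * g x)"
      by (intro continuous_intros continuous_on_real_polynomial real_polynomial_ball_laplacian f g)
    show "continuous_on UNIV (\<lambda>x. \<rho>\<^sup>2 * (grad f x \<bullet> grad g x) - euler f x * euler g x)"
      unfolding euler_def by (intro continuous_intros continuous_on_grad f g)
  qed
  finally show ?thesis by simp
qed

lemma ball_inner_commute: "ball_inner \<rho> f g = ball_inner \<rho> g f"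
  by (simp add: ball_inner_def mult.commute)

lemma ball_laplacian_symmetric:
  assumes "real_polynomial_function f" "real_polynomial_function g" "\<rho> > 0"
  shows "ball_inner \<rho> (ball_laplacian \<rho> f) g = ball_inner \<rho> f (ball_laplacian \<rho> g)"
  unfolding ball_inner_commute[of \<rho> f] ball_inner_green[OF assms] ball_inner_green[OF assms(2,1,3)]
  by (simp add: inner_commute mult.commute)

subsection \<open>Stone--Weierstrass for algebras that need not separate points\<close>

text \<open>The pairs separated by one function form an open set in the product, and Lindelof's
  theorem selects countably many of these sets. Countability allows the quotient by level sets to be
  realized in the metrizable space of real sequences.\<close>

lemma countable_separating_subset:
  fixes L :: "('a::second_countable_topology \<Rightarrow> real) set"
  assumes cont: "\<And>l. l \<in> L \<Longrightarrow> continuous_on UNIV l" and ne: "L \<noteq> {}"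
  shows "\<exists>\<phi>::nat \<Rightarrow> 'a \<Rightarrow> real. range \<phi> \<subseteq> L \<and> (\<forall>x y. (\<forall>n. \<phi> n x = \<phi> n y) \<longrightarrow> (\<forall>l\<in>L. l x = l y))"
proof -
  define D where "D l = {p::'a \<times> 'a. l (fst p) \<noteq> l (snd p)}" for l :: "'a \<Rightarrow> real"
  have "open (D l)" if "l \<in> L" for l
    unfolding D_def
    by (intro open_Collect_neq continuous_on_compose2[OF cont[OF that]] continuous_intros) auto
  then obtain F where F: "F \<subseteq> D ` L" "countable F" "\<Union>F = \<Union>(D ` L)"
    using Lindelof[of "D ` L"] by (metis imageE)
  obtain L' where L': "countable L'" "L' \<subseteq> L" "F = D ` L'"
    using F(1,2) countable_subset_image[of F D L] by auto
  obtain l0 where l0: "l0 \<in> L" using ne by blast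
  define \<phi> where "\<phi> = from_nat_into (insert l0 L')"
  have ran: "range \<phi> = insert l0 L'"
    unfolding \<phi>_def using L'(1) by (intro range_from_nat_into) auto
  have "l x = l y" if l: "l \<in> L" and eq: "\<forall>n. \<phi> n x = \<phi> n y" for l x y
  proof (rule ccontr)
    assume "l x \<noteq> l y"
    then have "(x, y) \<in> \<Union>(D ` L)" using l by (auto simp: D_def)
    then obtain m where m: "m \<in> L'" "m x \<noteq> m y" unfolding F(3)[symmetric] L'(3) by (auto simp: D_def)
    then obtain n where "m = \<phi> n" using ran by (metis insertCI rangeE)
    then show False using eq m by blast
  qed
  then show ?thesis using ran l0 L'(2) by (intro exI[of _ \<phi>]) auto
qed

text \<open>Stone--Weierstrass on the quotient of \<open>K\<close> by the level sets of
  \<open>L\<close>, realized as the compact image of \<Phi>, where coordinates separate points. A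
  function constant on level sets descends to the image, and remains continuous there because \<Phi>
  maps closed subsets of \<open>K\<close> to compact sets.\<close>

lemma Stone_Weierstrass_saturated:
  fixes L :: "('a::second_countable_topology \<Rightarrow> real) set"
  assumes K: "compact K" and cont: "\<And>l. l \<in> L \<Longrightarrow> continuous_on UNIV l"
    and const: "\<And>c. (\<lambda>x. c) \<in> L" and add: "\<And>f g. f \<in> L \<Longrightarrow> g \<in> L \<Longrightarrow> (\<lambda>x. f x + g x) \<in> L"
    and mult: "\<And>f g. f \<in> L \<Longrightarrow> g \<in> L \<Longrightarrow> (\<lambda>x. f x * g x) \<in> L"
    and h: "continuous_on K h"
    and sat: "\<And>x y. x \<in> K \<Longrightarrow> y \<in> K \<Longrightarrow> \<forall>l\<in>L. l x = l y \<Longrightarrow> h x = h y"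
    and e: "e > 0"
  shows "\<exists>l\<in>L. \<forall>x\<in>K. \<bar>h x - l x\<bar> < e"
proof -
  obtain \<phi> :: "nat \<Rightarrow> 'a \<Rightarrow> real" where \<phi>L: "\<And>n. \<phi> n \<in> L"
    and \<phi>: "\<And>x y. \<forall>n. \<phi> n x = \<phi> n y \<Longrightarrow> \<forall>l\<in>L. l x = l y"
    using countable_separating_subset[OF cont] const[of 0] by (metis empty_iff range_subsetD)
  define \<Phi> where "\<Phi> x n = \<phi> n x" for x n
  have c\<Phi>: "continuous_on K \<Phi>"
  proof (rule continuous_on_coordinatewise_then_product)
    fix n show "continuous_on K (\<lambda>x. \<Phi> x n)"
      unfolding \<Phi>_def by (rule continuous_on_subset[OF cont[OF \<phi>L]]) simp
  qed
  have K': "compact (\<Phi> ` K)" by (rule compact_continuous_image[OF c\<Phi> K])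
  define s where "s z = (SOME x. x \<in> K \<and> \<Phi> x = z)" for z
  have s: "s (\<Phi> x) \<in> K \<and> \<Phi> (s (\<Phi> x)) = \<Phi> x" if "x \<in> K" for x
    unfolding s_def by (rule someI[of _ x]) (simp add: that)
  define h' where "h' z = h (s z)" for z
  have h': "h' (\<Phi> x) = h x" if x: "x \<in> K" for x
  proof -
    have "\<forall>n. \<phi> n (s (\<Phi> x)) = \<phi> n x" using s[OF x] unfolding \<Phi>_def fun_eq_iff by blast
    then show ?thesis unfolding h'_def using \<phi> sat s[OF x] x by blast
  qed
  have ch': "continuous_on (\<Phi> ` K) h'"
    unfolding continuous_on_closed_vimage[OF compact_imp_closed[OF K']]
  proof (intro allI impI)
    fix C :: "real set" assume C: "closed C"
    have "h' -` C \<inter> \<Phi> ` K = \<Phi> ` (h -` C \<inter> K)" using h' by auto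
    moreover have "compact (h -` C \<inter> K)"
    proof (rule closedin_compact[OF K])
      show "closedin (top_of_set K) (h -` C \<inter> K)"
        using continuous_closedin_preimage[OF h C] by (simp add: Int_commute)
    qed
    then have "compact (\<Phi> ` (h -` C \<inter> K))"
      by (intro compact_continuous_image continuous_on_subset[OF c\<Phi>]) auto
    ultimately show "closed (h' -` C \<inter> \<Phi> ` K)" by (simp add: compact_imp_closed)
  qed
  define P where "P F \<longleftrightarrow> continuous_on (\<Phi> ` K) F \<and> (\<exists>l\<in>L. \<forall>x\<in>K. F (\<Phi> x) = l x)" for F
  have "\<exists>g. P g \<and> (\<forall>z \<in> \<Phi> ` K. \<bar>h' z - g z\<bar> < e)"
  proof (rule Stone_Weierstrass_HOL[OF K' _ _ _ _ _ ch' e])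
    show "P (\<lambda>x. c)" for c unfolding P_def using const by (intro conjI bexI[of _ "\<lambda>x. c"]) auto
    show "continuous_on (\<Phi> ` K) F" if "P F" for F using that by (simp add: P_def)
    show "P (\<lambda>x. F x + G x)" if "P F \<and> P G" for F G
      using that add unfolding P_def by (fastforce intro!: continuous_on_add)
    show "P (\<lambda>x. F x * G x)" if "P F \<and> P G" for F G
      using that mult unfolding P_def by (fastforce intro!: continuous_on_mult)
    show "\<exists>F. P F \<and> F y \<noteq> F z" if yz: "y \<in> \<Phi> ` K \<and> z \<in> \<Phi> ` K \<and> y \<noteq> z" for y z
    proof -
      obtain a b where ab: "a \<in> K" "b \<in> K" "y = \<Phi> a" "z = \<Phi> b" using yz by blast
      then obtain n where n: "y n \<noteq> z n" using yz by blast
      have "continuous_on (\<Phi> ` K) (\<lambda>z. z n)"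
        by (rule continuous_on_subset[OF continuous_on_product_coordinates]) simp
      then have "P (\<lambda>z. z n)" unfolding P_def using \<phi>L[of n] by (auto simp: \<Phi>_def)
      then show ?thesis using n by blast
    qed
  qed
  then obtain g where "P g" and g: "\<forall>z \<in> \<Phi> ` K. \<bar>h' z - g z\<bar> < e" by blast
  then obtain l where l: "l \<in> L" "\<And>x. x \<in> K \<Longrightarrow> g (\<Phi> x) = l x" unfolding P_def by blast
  have "\<bar>h x - l x\<bar> < e" if "x \<in> K" for x
    using g l(2)[OF that] h'[OF that] that by force
  then show ?thesis using l by blast
qed

subsection \<open>Spectral decomposition of Laplacian algebras\<close>

text \<open>The operator multiplies the part of top degree \<open>e\<close> by the negative of this
  number, since \<open>euler\<close> acts there as multiplication by \<open>e\<close>.\<close>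

definition ball_eigenvalue :: "'a::euclidean_space itself \<Rightarrow> nat \<Rightarrow> real" where
  "ball_eigenvalue _ e = (real e)\<^sup>2 + (DIM('a) + 4) * real e"

lemma ball_eigenvalue_inj: "ball_eigenvalue TYPE('a::euclidean_space) e = ball_eigenvalue TYPE('a) d \<longleftrightarrow> e = d"
proof -
  have "(real e - real d) * (real e + real d + (DIM('a) + 4)) = 0 \<longleftrightarrow> e = d"
    by (simp add: add_nonneg_eq_0_iff)
  then show ?thesis by (simp add: ball_eigenvalue_def power2_eq_square algebra_simps)
qed

text \<open>Through the degree bound the eigenspaces inherit finite dimension from
  \<open>degree_le\<close>.\<close>

definition ball_eigenspace :: "real \<Rightarrow> ('a::euclidean_space \<Rightarrow> real) set \<Rightarrow> nat \<Rightarrow> ('a \<Rightarrow> real) set" where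
  "ball_eigenspace \<rho> S e = {f \<in> S \<inter> degree_le e. ball_laplacian \<rho> f = (\<lambda>x. - ball_eigenvalue TYPE('a) e * f x)}"

lemma euler_add:
  assumes "real_polynomial_function f" "real_polynomial_function g"
  shows "euler (\<lambda>x. f x + g x) = (\<lambda>x. euler f x + euler g x)"
  by (auto simp: euler_def grad_add assms inner_add_right)

lemma euler_cmul:
  assumes "real_polynomial_function f"
  shows "euler (\<lambda>x. c * f x) = (\<lambda>x. c * euler f x)"
  by (auto simp: euler_def grad_cmul assms)

lemma ball_laplacian_add:
  assumes "real_polynomial_function f" "real_polynomial_function g"
  shows "ball_laplacian \<rho> (\<lambda>x. f x + g x) = (\<lambda>x. ball_laplacian \<rho> f x + ball_laplacian \<rho> g x)"
  unfolding ball_laplacian_def[abs_def] laplacian_add[OF assms] euler_add[OF assms]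
    euler_add[OF assms[THEN real_polynomial_euler]]
  by (simp add: algebra_simps)

lemma ball_laplacian_cmul:
  assumes "real_polynomial_function f"
  shows "ball_laplacian \<rho> (\<lambda>x. c * f x) = (\<lambda>x. c * ball_laplacian \<rho> f x)"
  unfolding ball_laplacian_def[abs_def] laplacian_cmul[OF assms] euler_cmul[OF assms]
    euler_cmul[OF assms[THEN real_polynomial_euler]]
  by (simp add: algebra_simps)

lemma ball_laplacian_sum:
  assumes "\<And>i. i \<in> I \<Longrightarrow> real_polynomial_function (f i)"
  shows "ball_laplacian \<rho> (\<lambda>x. \<Sum>i\<in>I. f i x) = (\<lambda>x. \<Sum>i\<in>I. ball_laplacian \<rho> (f i) x)"
  using assms
proof (induction I rule: infinite_finite_induct)
  case (insert i I)
  then show ?case by (simp add: ball_laplacian_add real_polynomial_function_sum)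
qed (simp_all add: ball_laplacian_def[abs_def] laplacian_const euler_def[abs_def])

lemma la_ball_laplacian:
  assumes "laplacian_algebra S" "f \<in> S"
  shows "ball_laplacian \<rho> f \<in> S"
proof -
  have e: "euler f \<in> S" if "f \<in> S" for f
    using la_euler[OF assms(1) that] by (simp add: euler_def[abs_def])
  show ?thesis
    unfolding ball_laplacian_def[abs_def]
    by (intro la_diff la_cmul la_laplacian e assms)
qed

lemma ball_laplacian_homogeneous:
  assumes f: "homogeneous e (f :: 'a::euclidean_space \<Rightarrow> real)"
  shows "ball_laplacian \<rho> f = (\<lambda>x. \<rho>\<^sup>2 * laplacian f x - ball_eigenvalue TYPE('a) e * f x)"
proof -
  have pf: "real_polynomial_function f" using f by (simp add: homogeneous_def)
  have e: "euler f = (\<lambda>x. e * f x)" using homogeneous_euler[OF f] by (auto simp: euler_def)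
  show ?thesis
    unfolding ball_laplacian_def[abs_def] e euler_cmul[OF pf] ball_eigenvalue_def
    by (simp add: power2_eq_square algebra_simps)
qed

text \<open>The added multiple of \<open>f\<close> cancels the part of degree \<open>N\<close>, and
  the Laplacian lowers degrees by 2. The case \<open>N = 0\<close> is stated apart because
  \<open>N - 1\<close> would be truncated to 0.\<close>

lemma degree_drop:
  assumes f: "(f :: 'a::euclidean_space \<Rightarrow> real) \<in> degree_le N"
  shows "if N = 0 then (\<lambda>x. ball_laplacian \<rho> f x + ball_eigenvalue TYPE('a) N * f x) = (\<lambda>x. 0)
    else (\<lambda>x. ball_laplacian \<rho> f x + ball_eigenvalue TYPE('a) N * f x) \<in> degree_le (N - 1)"
proof -
  let ?ev = "ball_eigenvalue TYPE('a)"
  obtain a where a: "f = (\<lambda>x. \<Sum>j\<le>N. a j x)" "\<And>j. homogeneous j (a j)" using f by (auto simp: degree_le_def)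
  have pa: "real_polynomial_function (a j)" for j using a(2) by (simp add: homogeneous_def)
  have eq: "(\<lambda>x. ball_laplacian \<rho> f x + ?ev N * f x)
    = (\<lambda>x. \<Sum>j\<le>N. \<rho>\<^sup>2 * laplacian (a j) x + (?ev N - ?ev j) * a j x)"
    unfolding a(1) ball_laplacian_sum[OF pa] ball_laplacian_homogeneous[OF a(2)]
    by (simp add: sum_distrib_left algebra_simps flip: sum.distrib)
  show ?thesis
  proof (cases "N = 0")
    case True
    then show ?thesis unfolding eq using homogeneous_laplacian[OF a(2)[of 0]] by simp
  next
    case False
    have "(\<lambda>x. \<Sum>j\<le>N. \<rho>\<^sup>2 * laplacian (a j) x + (?ev N - ?ev j) * a j x) \<in> degree_le (N - 1)"
    proof (rule fun_subspace_sum[OF degree_le_subspace])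
      fix j assume j: "j \<in> {..N}"
      have "laplacian (a j) \<in> degree_le (N - 1)"
        using homogeneous_laplacian[OF a(2)[of j]] j False
        by (intro homogeneous_degree_le[of "j - 2"]) auto
      moreover have "(\<lambda>x. (?ev N - ?ev j) * a j x) \<in> degree_le (N - 1)"
      proof (cases "j = N")
        case True
        then show ?thesis using fun_subspaceD(1)[OF degree_le_subspace] by simp
      next
        case False
        then show ?thesis using j a(2)[of j]
          by (intro fun_subspaceD(3)[OF degree_le_subspace] homogeneous_degree_le[of j]) auto
      qed
      ultimately show "(\<lambda>x. \<rho>\<^sup>2 * laplacian (a j) x + (?ev N - ?ev j) * a j x) \<in> degree_le (N - 1)"
        by (rule fun_subspaceD(2)[OF degree_le_subspace fun_subspaceD(3)[OF degree_le_subspace]])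
    qed
    then show ?thesis unfolding eq using False by simp
  qed
qed

text \<open>Shifting the operator by the top eigenvalue gives a \<open>g\<close> of lower degree,
  still in \<open>S\<close>. Dividing its components by the differences of eigenvalues yields the
  components of \<open>f\<close> for lower eigenvalues, and what is left of \<open>f\<close> is an
  eigenfunction for the top one. Every operation used stays inside an arbitrary Laplacian
  algebra.\<close>

lemma la_decomposition:
  fixes S :: "('a::euclidean_space \<Rightarrow> real) set"
  assumes S: "laplacian_algebra S" and f: "f \<in> S" "f \<in> degree_le N"
  shows "\<exists>p. (\<forall>e\<le>N. p e \<in> ball_eigenspace \<rho> S e) \<and> f = (\<lambda>x. \<Sum>e\<le>N. p e x)"
  using f
proof (induction N arbitrary: f)
  case 0
  have "f \<in> ball_eigenspace \<rho> S 0"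
  proof -
    have "ball_laplacian \<rho> f x = - ball_eigenvalue TYPE('a) 0 * f x" for x
      using fun_cong[OF degree_drop[OF 0(2), of \<rho>, simplified], of x] by simp
    then show ?thesis using 0 by (auto simp: ball_eigenspace_def)
  qed
  then show ?case by (intro exI[of _ "\<lambda>_. f"]) simp
next
  case (Suc N)
  let ?ev = "ball_eigenvalue TYPE('a)"
  define g where "g x = ball_laplacian \<rho> f x + ?ev (Suc N) * f x" for x
  have "g \<in> S" unfolding g_def[abs_def] by (intro la_add la_cmul la_ball_laplacian S Suc.prems)
  moreover have "g \<in> degree_le N" using degree_drop[OF Suc.prems(2), of \<rho>] by (simp add: g_def[abs_def])
  ultimately obtain p where p: "\<And>e. e \<le> N \<Longrightarrow> p e \<in> ball_eigenspace \<rho> S e" and g: "g = (\<lambda>x. \<Sum>e\<le>N. p e x)"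
    using Suc.IH by blast
  define c where "c e = inverse (?ev (Suc N) - ?ev e)" for e
  have c: "c e * (?ev (Suc N) - ?ev e) = 1" if "e \<le> N" for e
    using that ball_eigenvalue_inj[of "Suc N" e, where 'a='a] by (simp add: c_def)
  define q where "q e x = c e * p e x" for e x
  have pp: "real_polynomial_function (p e)" if "e \<le> N" for e
    using p[OF that] degree_le_polynomial by (auto simp: ball_eigenspace_def)
  have q: "q e \<in> ball_eigenspace \<rho> S e" if "e \<le> N" for e
    using p[OF that] ball_laplacian_cmul[OF pp[OF that], of \<rho> "c e"] la_cmul[OF S, of "p e" "c e"]
      fun_subspaceD(3)[OF degree_le_subspace, of "p e" e "c e"]
    by (auto simp: ball_eigenspace_def q_def[abs_def])
  define r where "r x = f x - (\<Sum>e\<le>N. q e x)" for x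
  have qS: "(\<lambda>x. \<Sum>e\<le>N. q e x) \<in> S" "(\<lambda>x. \<Sum>e\<le>N. q e x) \<in> degree_le (Suc N)"
  proof -
    show "(\<lambda>x. \<Sum>e\<le>N. q e x) \<in> S"
      by (rule la_sum[OF S]) (use q in \<open>auto simp: ball_eigenspace_def\<close>)
    show "(\<lambda>x. \<Sum>e\<le>N. q e x) \<in> degree_le (Suc N)"
    proof (rule fun_subspace_sum[OF degree_le_subspace])
      fix e assume "e \<in> {..N}"
      then show "q e \<in> degree_le (Suc N)" using q[of e] degree_le_mono[of e "Suc N"] by (auto simp: ball_eigenspace_def)
    qed
  qed
  have pf: "real_polynomial_function f" using la_poly[OF S Suc.prems(1)] .
  have pq: "real_polynomial_function (q e)" if "e \<le> N" for e
    using q[OF that] degree_le_polynomial by (auto simp: ball_eigenspace_def)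
  have "ball_laplacian \<rho> r x = - ?ev (Suc N) * r x" for x
  proof -
    have "r = (\<lambda>x. f x + (-1) * (\<Sum>e\<le>N. q e x))" by (auto simp: r_def)
    then have "ball_laplacian \<rho> r x = ball_laplacian \<rho> f x - (\<Sum>e\<le>N. ball_laplacian \<rho> (q e) x)"
      using ball_laplacian_add[OF pf la_poly[OF S la_cmul[OF S qS(1), of "-1"]], of \<rho>]
        ball_laplacian_cmul[OF la_poly[OF S qS(1)], of \<rho> "-1"] ball_laplacian_sum[of "{..N}" q \<rho>] pq
      by simp
    also have "(\<Sum>e\<le>N. ball_laplacian \<rho> (q e) x) = (\<Sum>e\<le>N. - ?ev e * q e x)"
      using q by (intro sum.cong) (auto simp: ball_eigenspace_def)
    also have "ball_laplacian \<rho> f x = g x - ?ev (Suc N) * f x" by (simp add: g_def)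
    also have "g x = (\<Sum>e\<le>N. (?ev (Suc N) - ?ev e) * q e x)"
      unfolding g q_def using c by (intro sum.cong refl) (simp add: mult.assoc[symmetric] mult.commute[of _ "c _"])
    finally show ?thesis
      by (simp add: r_def[of x] left_diff_distrib right_diff_distrib sum_subtractf sum_distrib_left sum_negf)
  qed
  then have r: "r \<in> ball_eigenspace \<rho> S (Suc N)"
    using la_diff[OF S Suc.prems(1) qS(1)] fun_subspace_diff[OF degree_le_subspace Suc.prems(2) qS(2)]
    by (auto simp: ball_eigenspace_def r_def[abs_def])
  have "f = (\<lambda>x. \<Sum>e\<le>Suc N. (if e = Suc N then r x else q e x))"
    by (auto simp: r_def intro!: ext)
  then show ?case
    using q r by (intro exI[of _ "\<lambda>e x. if e = Suc N then r x else q e x"]) (auto simp: le_Suc_eq)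
qed

subsection \<open>Orthogonal projection\<close>

lemma ball_inner_add:
  assumes "real_polynomial_function f" "real_polynomial_function g" "real_polynomial_function h" "\<rho> > 0"
  shows "ball_inner \<rho> (\<lambda>x. f x + g x) h = ball_inner \<rho> f h + ball_inner \<rho> g h"
proof -
  have "ball_inner \<rho> (\<lambda>x. f x + g x) h = (LINT x|lborel. bump \<rho> x * (f x * h x) + bump \<rho> x * (g x * h x))"
    by (simp add: ball_inner_def algebra_simps)
  also have "\<dots> = ball_inner \<rho> f h + ball_inner \<rho> g h"
    unfolding ball_inner_def
    by (intro Bochner_Integration.integral_add integrable_bump continuous_intros continuous_on_real_polynomial assms)
  finally show ?thesis .
qed

lemma ball_inner_cmul: "ball_inner \<rho> (\<lambda>x. c * f x) h = c * ball_inner \<rho> f h"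
proof -
  have "ball_inner \<rho> (\<lambda>x. c * f x) h = (LINT x|lborel. c * (bump \<rho> x * (f x * h x)))"
    by (simp add: ball_inner_def algebra_simps)
  then show ?thesis by (simp add: ball_inner_def)
qed

lemma ball_inner_sum:
  assumes "\<And>i. i \<in> I \<Longrightarrow> real_polynomial_function (f i)" "real_polynomial_function h" "\<rho> > 0"
  shows "ball_inner \<rho> (\<lambda>x. \<Sum>i\<in>I. f i x) h = (\<Sum>i\<in>I. ball_inner \<rho> (f i) h)"
  using assms(1)
proof (induction I rule: infinite_finite_induct)
  case (insert i I)
  then show ?case by (simp add: ball_inner_add real_polynomial_function_sum assms)
qed (simp_all add: ball_inner_def)

lemma ball_inner_diff:
  assumes "real_polynomial_function f" "real_polynomial_function g" "real_polynomial_function h" "\<rho> > 0"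
  shows "ball_inner \<rho> (\<lambda>x. f x - g x) h = ball_inner \<rho> f h - ball_inner \<rho> g h"
  using ball_inner_add[OF assms(1) real_polynomial_mult[OF real_polynomial_const assms(2), of "-1"] assms(3,4)]
    ball_inner_cmul[of \<rho> "-1" g h] by simp

lemma ball_inner_definite:
  fixes f :: "'a::euclidean_space \<Rightarrow> real"
  assumes f: "real_polynomial_function f" and r: "\<rho> > 0" and zero: "ball_inner \<rho> f f = 0"
  shows "f = (\<lambda>x. 0)"
proof (rule polynomial_zero_on_open[OF f open_ball[of 0 \<rho>]])
  show "ball (0::'a) \<rho> \<noteq> {}" using r by simp
next
  fix x :: 'a assume x: "x \<in> ball 0 \<rho>"
  have c: "continuous_on UNIV (\<lambda>x. f x * f x)" by (intro continuous_intros continuous_on_real_polynomial f)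
  have "bump \<rho> x * (f x * f x) = 0"
  proof (rule integral_zero_continuous[where F = "\<lambda>x. bump \<rho> x * (f x * f x)"])
    show "continuous_on UNIV (\<lambda>x. bump \<rho> x * (f x * f x))" by (intro continuous_intros c)
    show "integrable lborel (\<lambda>x. bump \<rho> x * (f x * f x))" by (rule integrable_bump[OF r c])
    show "0 \<le> bump \<rho> x * (f x * f x)" for x using bump_nonneg[of \<rho> x] by simp
    show "(LINT x|lborel. bump \<rho> x * (f x * f x)) = 0" using zero by (simp add: ball_inner_def)
  qed
  then show "f x = 0" using bump_pos[OF x] by simp
qed

text \<open>Gram--Schmidt one vector at a time, for functions \<open>e z\<close> that may be
  linearly dependent.\<close>

lemma projection_finite:
  assumes r: "\<rho> > 0" and Z: "finite Z" and e: "\<And>z. z \<in> Z \<Longrightarrow> real_polynomial_function (e z)"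
    and b: "real_polynomial_function b"
  shows "\<exists>u\<in>fun_span e Z. \<forall>z\<in>Z. ball_inner \<rho> (\<lambda>x. b x - u x) (e z) = 0"
  using Z e b
proof (induction Z arbitrary: b rule: finite_induct)
  case empty
  then show ?case by (auto simp: fun_span_def)
next
  case (insert z Z)
  have pe: "\<And>y. y \<in> Z \<Longrightarrow> real_polynomial_function (e y)" and ez: "real_polynomial_function (e z)"
    using insert.prems(1) by auto
  note pb = insert.prems(2)
  obtain v where "v \<in> fun_span e Z" and vo: "\<And>y. y \<in> Z \<Longrightarrow> ball_inner \<rho> (\<lambda>x. e z x - v x) (e y) = 0"
    using insert.IH[of "e z"] pe ez by blast
  then obtain cv where v: "v = (\<lambda>x. \<Sum>y\<in>Z. cv y * e y x)" by (auto simp: fun_span_def)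
  obtain u where "u \<in> fun_span e Z" and uo: "\<And>y. y \<in> Z \<Longrightarrow> ball_inner \<rho> (\<lambda>x. b x - u x) (e y) = 0"
    using insert.IH[of b] pe pb by blast
  then obtain cu where u: "u = (\<lambda>x. \<Sum>y\<in>Z. cu y * e y x)" by (auto simp: fun_span_def)
  have pc: "real_polynomial_function (\<lambda>x. c * e y x)" if "y \<in> Z" for c y
    by (intro real_polynomial_mult real_polynomial_const pe that)
  have pv: "real_polynomial_function v" and pu: "real_polynomial_function u"
    unfolding u v using insert.hyps(1) pc by (auto intro!: real_polynomial_function_sum)
  define s where "s x = e z x - v x" for x
  define t where "t x = b x - u x" for x
  have ps: "real_polynomial_function s" unfolding s_def[abs_def] by (intro real_polynomial_function_diff ez pv)
  have pt: "real_polynomial_function t" unfolding t_def[abs_def] by (intro real_polynomial_function_diff pb pu)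
  have so: "ball_inner \<rho> s (e y) = 0" and to: "ball_inner \<rho> t (e y) = 0" if "y \<in> Z" for y
    using vo[OF that] uo[OF that] by (simp_all add: s_def[abs_def] t_def[abs_def])
  have perp: "ball_inner \<rho> g v = 0" if "\<And>y. y \<in> Z \<Longrightarrow> ball_inner \<rho> g (e y) = 0" "real_polynomial_function g" for g
    unfolding ball_inner_commute[of \<rho> g] v
    using ball_inner_sum[of Z "\<lambda>y x. cv y * e y x", OF pc that(2) r] that(1)
    by (simp add: ball_inner_commute[of \<rho> g] ball_inner_cmul)
  \<comment> \<open>If \<open>s\<close> is orthogonal to \<open>e z\<close>, it is orthogonal to
    itself and hence zero. Then \<open>e z = v\<close>, to which \<open>t\<close> is already
    orthogonal, so any \<open>c\<close> serves.\<close>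
  have "\<exists>c. ball_inner \<rho> t (e z) = c * ball_inner \<rho> s (e z)"
  proof (cases "ball_inner \<rho> s (e z) = 0")
    case False
    then show ?thesis by (intro exI[of _ "ball_inner \<rho> t (e z) / ball_inner \<rho> s (e z)"]) simp
  next
    case True
    have "ball_inner \<rho> s s = ball_inner \<rho> s (e z) - ball_inner \<rho> s v"
      using ball_inner_diff[OF ez pv ps r] by (simp add: s_def[abs_def] ball_inner_commute)
    then have "s = (\<lambda>x. 0)"
      using ball_inner_definite[OF ps r] True perp[of s] so ps by simp
    then have "e z = v" by (auto simp: s_def fun_eq_iff)
    then show ?thesis using perp[of t] to pt True by simp
  qed
  then obtain c where c: "ball_inner \<rho> t (e z) = c * ball_inner \<rho> s (e z)" by blast
  define w where "w x = u x + c * s x" for x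
  have w: "ball_inner \<rho> (\<lambda>x. b x - w x) g = ball_inner \<rho> t g - c * ball_inner \<rho> s g"
    if g: "real_polynomial_function g" for g
  proof -
    have "(\<lambda>x. b x - w x) = (\<lambda>x. t x - c * s x)" by (auto simp: w_def t_def)
    then show ?thesis
      using ball_inner_diff[OF pt real_polynomial_mult[OF real_polynomial_const ps] g r, of c]
      by (simp add: ball_inner_cmul)
  qed
  have "w \<in> fun_span e (insert z Z)"
  proof -
    define d where "d y = (if y = z then c else cu y - c * cv y)" for y
    have "w x = (\<Sum>y\<in>insert z Z. d y * e y x)" for x
    proof -
      have "(\<Sum>y\<in>Z. d y * e y x) = (\<Sum>y\<in>Z. cu y * e y x - c * (cv y * e y x))"
        by (rule sum.cong) (use insert.hyps(2) in \<open>auto simp: d_def algebra_simps\<close>)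
      then show ?thesis
        using insert.hyps by (simp add: w_def s_def u v d_def sum_subtractf sum_distrib_left algebra_simps)
    qed
    then show ?thesis unfolding fun_span_def by (intro CollectI exI[of _ d] conjI ext TrueI)
  qed
  moreover have "\<forall>y\<in>insert z Z. ball_inner \<rho> (\<lambda>x. b x - w x) (e y) = 0"
    using w[OF ez] w[OF pe] c so to by simp
  ultimately show ?case by blast
qed

lemma eigenspace_projection:
  fixes L :: "('a::euclidean_space \<Rightarrow> real) set"
  assumes L: "laplacian_algebra L" and r: "\<rho> > 0" and b: "real_polynomial_function b"
  shows "\<exists>u\<in>ball_eigenspace \<rho> L d. \<forall>v\<in>ball_eigenspace \<rho> L d. ball_inner \<rho> (\<lambda>x. b x - u x) v = 0"
proof -
  define U where "U = ball_eigenspace \<rho> L d"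
  have poly: "real_polynomial_function f" if "f \<in> U" for f
    using that degree_le_polynomial by (auto simp: U_def ball_eigenspace_def)
  have U: "fun_subspace U"
    unfolding fun_subspace_def
  proof (intro conjI ballI allI)
    have "ball_laplacian \<rho> (\<lambda>x::'a. 0) = (\<lambda>x. 0)"
      using ball_laplacian_sum[of "{}" "\<lambda>_. undefined" \<rho>] by simp
    then show "(\<lambda>x. 0) \<in> U"
      using la_const[OF L, of 0] fun_subspaceD(1)[OF degree_le_subspace] by (auto simp: U_def ball_eigenspace_def)
  next
    fix f g assume fg: "f \<in> U" "g \<in> U"
    then show "(\<lambda>x. f x + g x) \<in> U"
      using la_add[OF L, of f g] fun_subspaceD(2)[OF degree_le_subspace, of f d g] ball_laplacian_add[OF poly poly, of f g \<rho>]
      by (auto simp: U_def ball_eigenspace_def algebra_simps)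
  next
    fix c f assume f: "f \<in> U"
    then show "(\<lambda>x. c * f x) \<in> U"
      using la_cmul[OF L, of f c] fun_subspaceD(3)[OF degree_le_subspace, of f d c] ball_laplacian_cmul[OF poly, of f \<rho> c]
      by (auto simp: U_def ball_eigenspace_def)
  qed
  obtain Z where "determined_by (degree_le d :: ('a \<Rightarrow> real) set) Z" using degree_le_determined by blast
  then have det: "determined_by U Z" by (rule determined_by_subset) (auto simp: U_def ball_eigenspace_def)
  from interpolation_basis[OF U this] obtain Z' e where Z': "Z' \<subseteq> Z" and e: "\<And>z. z \<in> Z' \<Longrightarrow> e z \<in> U"
    and rep: "\<And>f x. f \<in> U \<Longrightarrow> f x = (\<Sum>z\<in>Z'. f z * e z x)" by meson
  have fin: "finite Z'" using Z' det finite_subset by (auto simp: determined_by_def)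
  obtain u where "u \<in> fun_span e Z'" and uo: "\<And>z. z \<in> Z' \<Longrightarrow> ball_inner \<rho> (\<lambda>x. b x - u x) (e z) = 0"
    using projection_finite[OF r fin, of e b] e poly b by blast
  then obtain c where c: "u = (\<lambda>x. \<Sum>z\<in>Z'. c z * e z x)" by (auto simp: fun_span_def)
  have u: "u \<in> U" unfolding c by (intro fun_subspace_sum[OF U] fun_subspaceD(3)[OF U] e)
  have "ball_inner \<rho> (\<lambda>x. b x - u x) v = 0" if v: "v \<in> U" for v
  proof -
    have pbu: "real_polynomial_function (\<lambda>x. b x - u x)" by (intro real_polynomial_function_diff b poly u)
    have "v = (\<lambda>x. \<Sum>z\<in>Z'. v z * e z x)" using rep[OF v] by (rule ext)
    then have "ball_inner \<rho> v (\<lambda>x. b x - u x) = (\<Sum>z\<in>Z'. ball_inner \<rho> (\<lambda>x. v z * e z x) (\<lambda>x. b x - u x))"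
      using ball_inner_sum[of Z' "\<lambda>z x. v z * e z x", OF real_polynomial_mult[OF real_polynomial_const poly[OF e]] pbu r]
      by simp
    also have "\<dots> = 0" using uo by (simp add: ball_inner_cmul ball_inner_commute)
    finally show ?thesis by (simp add: ball_inner_commute)
  qed
  then show ?thesis using u by (auto simp: U_def)
qed

text \<open>A Laplacian algebra that separates enough points is determined by its level sets: the part of
  an eigenspace of \<open>B\<close> orthogonal to that of \<open>L\<close> is orthogonal to all of \<open>L\<close>, and is therefore
  killed by Stone--Weierstrass.\<close>

theorem laplacian_algebra_eqI:
  fixes L B :: "('a::euclidean_space \<Rightarrow> real) set"
  assumes L: "laplacian_algebra L" and B: "laplacian_algebra B" and LB: "L \<subseteq> B"
    and q: "q \<in> L" and x0: "q x0 < 1"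
    and sep: "\<And>x y b. \<forall>l\<in>L. l x = l y \<Longrightarrow> q x < 1 \<Longrightarrow> b \<in> B \<Longrightarrow> b x = b y"
  shows "L = B"
proof -
  \<comment> \<open>The radius is chosen so that the open ball contains \<open>x0\<close> and
    therefore meets the set \<open>q x < 1\<close>.\<close>
  define \<rho> where "\<rho> = norm x0 + 1"
  have r: "\<rho> > 0" by (simp add: \<rho>_def add_nonneg_pos)
  let ?ev = "ball_eigenvalue TYPE('a)"
  define d where "d x = max 0 (1 - q x)" for x
  have cd: "continuous_on S d" for S
    unfolding d_def by (intro continuous_intros continuous_on_real_polynomial la_poly[OF L q])
  have key: "b \<in> L" if b: "b \<in> ball_eigenspace \<rho> B n" for b n
  proof -
    have pb: "real_polynomial_function b" using b degree_le_polynomial by (auto simp: ball_eigenspace_def)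
    obtain u where u: "u \<in> ball_eigenspace \<rho> L n"
      and uo: "\<And>v. v \<in> ball_eigenspace \<rho> L n \<Longrightarrow> ball_inner \<rho> (\<lambda>x. b x - u x) v = 0"
      using eigenspace_projection[OF L r pb] by blast
    have uL: "u \<in> L" using u by (simp add: ball_eigenspace_def)
    note pu = la_poly[OF L uL]
    define R where "R x = b x - u x" for x
    have RB: "R \<in> B" unfolding R_def[abs_def] using b uL LB by (intro la_diff[OF B]) (auto simp: ball_eigenspace_def)
    note pR = la_poly[OF B RB]
    have DR: "ball_laplacian \<rho> R = (\<lambda>x. - ?ev n * R x)"
    proof -
      have "R = (\<lambda>x. b x + (-1) * u x)" by (auto simp: R_def)
      then show ?thesis
        using ball_laplacian_add[OF pb la_poly[OF L la_cmul[OF L uL, of "-1"]], of \<rho>]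
          ball_laplacian_cmul[OF pu, of \<rho> "-1"] b u
        by (simp add: ball_eigenspace_def algebra_simps)
    qed
    have RL: "ball_inner \<rho> R l = 0" if l: "l \<in> L" for l
    proof -
      obtain N where "l \<in> degree_le N" using polynomial_degree_le[OF la_poly[OF L l]] by blast
      from la_decomposition[OF L l this, of \<rho>] obtain p where
        p: "\<And>e. e \<le> N \<Longrightarrow> p e \<in> ball_eigenspace \<rho> L e" and lp: "l = (\<lambda>x. \<Sum>e\<le>N. p e x)" by blast
      have pp: "real_polynomial_function (p e)" if "e \<le> N" for e
        using p[OF that] degree_le_polynomial by (auto simp: ball_eigenspace_def)
      have "ball_inner \<rho> (p e) R = 0" if e: "e \<le> N" for e
      proof (cases "e = n")
        case True
        then show ?thesis using uo p[OF e] by (simp add: R_def[abs_def] ball_inner_commute)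
      next
        case False
        have De: "ball_laplacian \<rho> (p e) = (\<lambda>x. - ?ev e * p e x)" using p[OF e] by (simp add: ball_eigenspace_def)
        have "- ?ev n * ball_inner \<rho> R (p e) = ball_inner \<rho> (ball_laplacian \<rho> R) (p e)"
          unfolding DR by (rule ball_inner_cmul[symmetric])
        also have "\<dots> = ball_inner \<rho> (ball_laplacian \<rho> (p e)) R"
          unfolding ball_laplacian_symmetric[OF pR pp[OF e] r] by (rule ball_inner_commute)
        also have "\<dots> = - ?ev e * ball_inner \<rho> R (p e)"
          unfolding De ball_inner_cmul ball_inner_commute[of \<rho> "p e"] ..
        finally have "ball_inner \<rho> R (p e) = 0"
          using ball_eigenvalue_inj[of n e, where 'a='a] False by auto
        then show ?thesis by (simp add: ball_inner_commute)
      qed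
      then have "ball_inner \<rho> l R = 0"
        unfolding lp using ball_inner_sum[of "{..N}" p R \<rho>] pp pR r by simp
      then show ?thesis by (simp add: ball_inner_commute)
    qed
    \<comment> \<open>\<open>T\<close> pairs \<open>R\<close> with \<open>d * R\<close>. The latter
      is a uniform limit on the ball of elements of \<open>L\<close>, and \<open>R\<close> is
      orthogonal to all of these.\<close>
    define T where "T = (LINT x|lborel. bump \<rho> x * (d x * (R x * R x)))"
    define M where "M = (LINT x|lborel. bump \<rho> x * \<bar>R x\<bar>)"
    have cR: "continuous_on S R" for S by (rule continuous_on_real_polynomial[OF pR])
    have M: "M \<ge> 0" unfolding M_def by (intro Bochner_Integration.integral_nonneg mult_nonneg_nonneg bump_nonneg) auto
    have "\<bar>T\<bar> \<le> e * M" if e: "e > 0" for e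
    proof -
      have "\<exists>l\<in>L. \<forall>x\<in>cball 0 \<rho>. \<bar>d x * R x - l x\<bar> < e"
      proof (rule Stone_Weierstrass_saturated[OF compact_cball _ _ _ _ _ _ e])
        show "continuous_on UNIV l" if "l \<in> L" for l
          by (rule continuous_on_real_polynomial[OF la_poly[OF L that]])
        show "continuous_on (cball 0 \<rho>) (\<lambda>x. d x * R x)" by (intro continuous_intros cd cR)
        fix x y assume lev: "\<forall>l\<in>L. l x = l y"
        then have "q x = q y" using q by blast
        \<comment> \<open>Points with the same values under \<open>L\<close> share \<open>d\<close>.
          Where \<open>d\<close> is nonzero, \<open>q x < 1\<close> and \<open>sep\<close> applies;
          elsewhere both products vanish.\<close>
        then have "d x = d y" by (simp add: d_def)
        moreover have "R x = R y" if "d x \<noteq> 0"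
          using sep[OF lev _ RB] that by (simp add: d_def max_def split: if_splits)
        ultimately show "d x * R x = d y * R y" by (cases "d x = 0") auto
      qed (auto intro: la_const[OF L] la_add[OF L] la_mult[OF L])
      then obtain l where l: "l \<in> L" and le: "\<And>x. x \<in> cball 0 \<rho> \<Longrightarrow> \<bar>d x * R x - l x\<bar> < e" by blast
      have cl: "continuous_on S l" for S by (rule continuous_on_real_polynomial[OF la_poly[OF L l]])
      have i1: "integrable lborel (\<lambda>x. bump \<rho> x * (d x * (R x * R x)))"
        and i2: "integrable lborel (\<lambda>x. bump \<rho> x * (R x * l x))"
        and i3: "integrable lborel (\<lambda>x. bump \<rho> x * \<bar>R x\<bar>)"
        by (intro integrable_bump[OF r] continuous_intros cR cl cd)+
      have "T = T - ball_inner \<rho> R l" using RL[OF l] by simp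
      also have "\<dots> = (LINT x|lborel. bump \<rho> x * (d x * (R x * R x)) - bump \<rho> x * (R x * l x))"
        unfolding T_def ball_inner_def by (rule Bochner_Integration.integral_diff[OF i1 i2, symmetric])
      finally have "\<bar>T\<bar> = \<bar>LINT x|lborel. bump \<rho> x * (d x * (R x * R x)) - bump \<rho> x * (R x * l x)\<bar>" by simp
      also have "\<dots> \<le> (LINT x|lborel. \<bar>bump \<rho> x * (d x * (R x * R x)) - bump \<rho> x * (R x * l x)\<bar>)"
        by (rule integral_abs_bound)
      also have "\<dots> \<le> (LINT x|lborel. e * (bump \<rho> x * \<bar>R x\<bar>))"
      proof (rule integral_mono)
        show "integrable lborel (\<lambda>x. \<bar>bump \<rho> x * (d x * (R x * R x)) - bump \<rho> x * (R x * l x)\<bar>)"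
          by (intro integrable_abs Bochner_Integration.integrable_diff i1 i2)
        show "integrable lborel (\<lambda>x. e * (bump \<rho> x * \<bar>R x\<bar>))" using i3 by simp
        fix x :: 'a
        show "\<bar>bump \<rho> x * (d x * (R x * R x)) - bump \<rho> x * (R x * l x)\<bar> \<le> e * (bump \<rho> x * \<bar>R x\<bar>)"
        proof (cases "x \<in> cball 0 \<rho>")
          case True
          have "\<bar>bump \<rho> x * (d x * (R x * R x)) - bump \<rho> x * (R x * l x)\<bar>
            = (bump \<rho> x * \<bar>R x\<bar>) * \<bar>d x * R x - l x\<bar>"
          proof -
            have "bump \<rho> x * (d x * (R x * R x)) - bump \<rho> x * (R x * l x) = bump \<rho> x * R x * (d x * R x - l x)"
              by (simp add: algebra_simps)
            then show ?thesis using bump_nonneg[of \<rho> x] by (simp add: abs_mult)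
          qed
          also have "\<dots> \<le> (bump \<rho> x * \<bar>R x\<bar>) * e"
            using le[OF True] bump_nonneg[of \<rho> x] by (intro mult_left_mono) auto
          finally show ?thesis by (simp add: mult.commute)
        next
          case False
          then show ?thesis using bump_zero[OF r, of x] by simp
        qed
      qed
      also have "\<dots> = e * M" by (simp add: M_def)
      finally show ?thesis .
    qed
    note TM = this
    have "\<bar>T\<bar> \<le> 0 + e" if e: "e > 0" for e
    proof -
      have "\<bar>T\<bar> \<le> e / (M + 1) * M" using e M by (intro TM) auto
      also have "\<dots> \<le> e" using e M by (simp add: field_simps)
      finally show ?thesis by simp
    qed
    then have "\<bar>T\<bar> \<le> 0" by (rule field_le_epsilon)
    then have T0: "T = 0" by simp
    have zero: "bump \<rho> x * (d x * (R x * R x)) = 0" for x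
    proof (rule integral_zero_continuous[where F = "\<lambda>x. bump \<rho> x * (d x * (R x * R x))"])
      show "continuous_on UNIV (\<lambda>x. bump \<rho> x * (d x * (R x * R x)))" by (intro continuous_intros cR cd)
      show "integrable lborel (\<lambda>x. bump \<rho> x * (d x * (R x * R x)))"
        by (intro integrable_bump[OF r] continuous_intros cR cd)
      show "0 \<le> bump \<rho> x * (d x * (R x * R x))" for x
        by (rule mult_nonneg_nonneg[OF bump_nonneg mult_nonneg_nonneg[OF _ zero_le_square]]) (simp add: d_def)
      show "(LINT x|lborel. bump \<rho> x * (d x * (R x * R x))) = 0" using T0 by (simp add: T_def)
    qed
    have "R = (\<lambda>x. 0)"
    proof (rule polynomial_zero_on_open[OF pR])
      show "open (ball 0 \<rho> \<inter> {x. q x < 1})"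
        by (intro open_Int open_ball open_Collect_less continuous_intros continuous_on_real_polynomial la_poly[OF L q])
      show "ball 0 \<rho> \<inter> {x. q x < 1} \<noteq> {}" proof -
        have "x0 \<in> ball 0 \<rho> \<inter> {x. q x < 1}" using x0 by (simp add: \<rho>_def)
        then show ?thesis by blast
      qed
      show "R x = 0" if "x \<in> ball 0 \<rho> \<inter> {x. q x < 1}" for x
        using zero[of x] bump_pos[of x \<rho>] that by (auto simp: d_def max_def)
    qed
    then have "b = u" by (auto simp: R_def fun_eq_iff)
    then show ?thesis using uL by simp
  qed
  have "b \<in> L" if b: "b \<in> B" for b
  proof -
    obtain N where "b \<in> degree_le N" using polynomial_degree_le[OF la_poly[OF B b]] by blast
    from la_decomposition[OF B b this, of \<rho>] obtain p where
      p: "\<And>e. e \<le> N \<Longrightarrow> p e \<in> ball_eigenspace \<rho> B e" and bp: "b = (\<lambda>x. \<Sum>e\<le>N. p e x)" by blast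
    show ?thesis unfolding bp by (rule la_sum[OF L]) (use key p in auto)
  qed
  then show ?thesis using LB by blast
qed

subsection \<open>Invariant polynomials separate the orbits of a compact group\<close>

text \<open>Tychonoff's theorem for pointwise convergence; it yields compactness both of groups and
  of families of polynomials.\<close>

lemma compact_fun_box:
  fixes C :: "'a \<Rightarrow> 'b::topological_space set"
  assumes "\<And>x. compact (C x)"
  shows "compact {f. \<forall>x. f x \<in> C x}"
proof -
  have "compactin (product_topology (\<lambda>_::'a. euclidean::'b topology) UNIV) (Pi\<^sub>E UNIV C)"
    unfolding compactin_PiE using assms by simp
  moreover have "Pi\<^sub>E UNIV C = {f. \<forall>x. f x \<in> C x}" by auto
  ultimately show ?thesis by (simp add: euclidean_product_topology)
qed

lemma closed_orthogonal_group: "closed (orthogonal_group :: ('a::euclidean_space \<Rightarrow> 'a) set)"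
proof -
  have c: "continuous_on UNIV (\<lambda>g::'a \<Rightarrow> 'a. g x)" for x by (rule continuous_on_product_coordinates)
  have "orthogonal_group = (\<Inter>x. \<Inter>y. {g::'a \<Rightarrow> 'a. g (x + y) = g x + g y})
    \<inter> (\<Inter>r. \<Inter>x. {g. g (r *\<^sub>R x) = r *\<^sub>R g x}) \<inter> (\<Inter>x. \<Inter>y. {g. g x \<bullet> g y = x \<bullet> y})"
    by (auto simp: orthogonal_group_def orthogonal_transformation_def linear_iff)
  moreover have "closed \<dots>"
    by (intro closed_Int closed_INT ballI closed_Collect_eq continuous_intros c)
  ultimately show ?thesis by simp
qed

text \<open>Preservation of norms places the group in a product of closed balls, and linearity and
  isometry are closed conditions on finitely many values at a time.\<close>

lemma compact_orthogonal_group: "compact (orthogonal_group :: ('a::euclidean_space \<Rightarrow> 'a) set)"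
proof -
  have "orthogonal_group \<subseteq> {g::'a \<Rightarrow> 'a. \<forall>x. g x \<in> cball 0 (norm x)}"
    by (auto simp: orthogonal_group_def orthogonal_transformation)
  then have "orthogonal_group = orthogonal_group \<inter> {g::'a \<Rightarrow> 'a. \<forall>x. g x \<in> cball 0 (norm x)}" by blast
  then show ?thesis
    using closed_Int_compact[OF closed_orthogonal_group compact_fun_box[of "\<lambda>x::'a. cball (0::'a) (norm x)"]]
    by (metis compact_cball)
qed

lemma compact_closed_orthogonal_subgroup:
  "closed_orthogonal_subgroup G \<Longrightarrow> compact G"
  unfolding closed_orthogonal_subgroup_def by (blast intro: closedin_compact compact_orthogonal_group)

section \<open>Orbits and invariants of one orthogonal subgroup\<close>

context
  fixes G :: "('a::euclidean_space \<Rightarrow> 'a) set"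
  assumes G: "orthogonal_subgroup G"
begin

lemma group_orthogonal: "g \<in> G \<Longrightarrow> orthogonal_transformation g"
  using G by (auto simp: orthogonal_subgroup_def orthogonal_group_def)

lemma group_linear: "g \<in> G \<Longrightarrow> linear g"
  using group_orthogonal by (simp add: orthogonal_transformation_def)

lemma group_id: "id \<in> G" and group_comp: "g \<in> G \<Longrightarrow> h \<in> G \<Longrightarrow> g \<circ> h \<in> G" and group_inv: "g \<in> G \<Longrightarrow> inv g \<in> G"
  using G by (auto simp: orthogonal_subgroup_def)

lemma group_inv_apply: "g \<in> G \<Longrightarrow> inv g (g x) = x" "g \<in> G \<Longrightarrow> g (inv g x) = x"
  using orthogonal_transformation_bij[OF group_orthogonal, of g]
  by (auto simp: bij_def surj_f_inv_f)

lemma orbit_refl: "x \<in> orbit G x"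
  unfolding orbit_def using group_id by (metis id_apply imageI)

lemma orbit_eqI:
  assumes "y \<in> orbit G x"
  shows "orbit G y = orbit G x"
proof -
  obtain g where g: "g \<in> G" "y = g x" using assms by (auto simp: orbit_def)
  have "h (g x) \<in> orbit G x" if "h \<in> G" for h
    unfolding orbit_def by (rule image_eqI[OF _ group_comp[OF that g(1)]]) simp
  moreover have "h x \<in> orbit G (g x)" if "h \<in> G" for h
    unfolding orbit_def
    by (rule image_eqI[OF _ group_comp[OF that group_inv[OF g(1)]]]) (simp add: group_inv_apply(1)[OF g(1)])
  ultimately show ?thesis using g by (auto simp: orbit_def)
qed

lemma orbit_shift: "g \<in> G \<Longrightarrow> orbit G (g x) = orbit G x"
  by (rule orbit_eqI) (simp add: orbit_def)

text \<open>A substitute for averaging over Haar measure: among the polynomials of bounded degree whose value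
  at each \<open>z\<close> lies between the bounds of \<open>p\<close> on the orbit of \<open>z\<close>, the minimizer of the \<open>G\<close>-invariant
  strictly convex functional \<open>f \<mapsto> sup\<^bsub>g \<in> G\<^esub> \<Sum>\<^bsub>z \<in> Z\<^esub> f(g z)\<^sup>2\<close> is unique, hence invariant.\<close>

lemma invariant_mean:
  assumes comp: "compact G" and p: "real_polynomial_function p"
  shows "\<exists>f\<in>invariant_polynomials G. \<forall>z a b. (\<forall>y\<in>orbit G z. a \<le> p y \<and> p y \<le> b) \<longrightarrow> a \<le> f z \<and> f z \<le> b"
proof -
  obtain N where pN: "p \<in> degree_le N" using polynomial_degree_le[OF p] by blast
  obtain Z0 where "determined_by (degree_le N :: ('a \<Rightarrow> real) set) Z0" using degree_le_determined by blast
  from interpolation_basis[OF degree_le_subspace this] obtain Z e where "Z \<subseteq> Z0"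
    and e: "\<And>z. z \<in> Z \<Longrightarrow> e z \<in> degree_le N"
    and rep: "\<And>f x. f \<in> degree_le N \<Longrightarrow> f x = (\<Sum>z\<in>Z. f z * e z x)" by meson
  \<comment> \<open>The bounds at \<open>z\<close> refer to the whole orbit of \<open>z\<close>, so
    they are inherited by compositions of \<open>f\<close> with group elements; they are also convex
    and closed under pointwise limits.\<close>
  define K where "K = {f \<in> degree_le N. \<forall>z a b. (\<forall>y\<in>orbit G z. a \<le> p y \<and> p y \<le> b) \<longrightarrow> a \<le> f z \<and> f z \<le> b}"
  have Kb: "a \<le> f z \<and> f z \<le> b" if "f \<in> K" "\<forall>y\<in>orbit G z. a \<le> p y \<and> p y \<le> b" for f z a b
    using that unfolding K_def by blast
  have pK: "p \<in> K" using pN orbit_refl by (auto simp: K_def)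
  have poly: "real_polynomial_function f" if "f \<in> K" for f
    using that degree_le_polynomial by (auto simp: K_def)
  have cx: "continuous_on UNIV (\<lambda>f::'a \<Rightarrow> real. f x)" for x by (rule continuous_on_product_coordinates)
  have cg: "continuous_on G (\<lambda>g. g x)" for x
    by (rule continuous_on_subset[OF continuous_on_product_coordinates]) simp
  have corb: "compact (orbit G x)" for x
    unfolding orbit_def by (rule compact_continuous_image[OF cg comp])
  have degree_closed: "degree_le N = {f::'a \<Rightarrow> real. \<forall>x. f x = (\<Sum>z\<in>Z. f z * e z x)}"
  proof
    show "degree_le N \<subseteq> {f::'a \<Rightarrow> real. \<forall>x. f x = (\<Sum>z\<in>Z. f z * e z x)}" using rep by blast
    show "{f::'a \<Rightarrow> real. \<forall>x. f x = (\<Sum>z\<in>Z. f z * e z x)} \<subseteq> degree_le N"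
    proof
      fix f :: "'a \<Rightarrow> real" assume "f \<in> {f. \<forall>x. f x = (\<Sum>z\<in>Z. f z * e z x)}"
      then have "f = (\<lambda>x. \<Sum>z\<in>Z. f z * e z x)" unfolding mem_Collect_eq by (intro ext) (rule spec)
      also have "\<dots> \<in> degree_le N"
        by (intro fun_subspace_sum[OF degree_le_subspace] fun_subspaceD(3)[OF degree_le_subspace] e)
      finally show "f \<in> degree_le N" .
    qed
  qed
  have "\<exists>a b. \<forall>y\<in>orbit G x. a \<le> p y \<and> p y \<le> b" for x
  proof -
    have "compact (p ` orbit G x)"
      by (intro compact_continuous_image corb continuous_on_real_polynomial p)
    then obtain B where "\<forall>y\<in>p ` orbit G x. norm y \<le> B" using compact_imp_bounded bounded_iff by blast
    then have "\<forall>y\<in>orbit G x. - B \<le> p y \<and> p y \<le> B" by (auto simp: abs_le_iff minus_le_iff)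
    then show ?thesis by blast
  qed
  then obtain a0 b0 where ab0: "\<And>x y. y \<in> orbit G x \<Longrightarrow> a0 x \<le> p y \<and> p y \<le> b0 x" by metis
  have compK: "compact K"
  proof -
    have dc: "closed (degree_le N :: ('a \<Rightarrow> real) set)"
    proof -
      have "closed (\<Inter>x. {f::'a \<Rightarrow> real. f x = (\<Sum>z\<in>Z. f z * e z x)})"
        by (intro closed_INT ballI closed_Collect_eq continuous_intros cx)
      moreover have "(\<Inter>x. {f::'a \<Rightarrow> real. f x = (\<Sum>z\<in>Z. f z * e z x)}) = degree_le N"
        unfolding degree_closed by blast
      ultimately show ?thesis by simp
    qed
    define bd where "bd z a b \<longleftrightarrow> (\<forall>y\<in>orbit G z. a \<le> p y \<and> p y \<le> b)" for z a b
    have "K = degree_le N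
      \<inter> (\<Inter>t\<in>{(z, a, b). bd z a b}. {f. fst (snd t) \<le> f (fst t)} \<inter> {f. f (fst t) \<le> snd (snd t)})"
      unfolding K_def bd_def[symmetric] by auto
    also have "closed \<dots>"
      by (intro closed_Int closed_INT ballI dc closed_Collect_le continuous_intros cx)
    finally have "closed K" .
    moreover have "compact {f. \<forall>x. f x \<in> {a0 x..b0 x}}" by (rule compact_fun_box) simp
    moreover have "K \<inter> {f. \<forall>x. f x \<in> {a0 x..b0 x}} = K"
    proof -
      have "a0 x \<le> f x \<and> f x \<le> b0 x" if "f \<in> K" for f x
        using that ab0 unfolding K_def by blast
      then show ?thesis by auto
    qed
    ultimately show ?thesis using closed_Int_compact by metis
  qed
  define Q where "Q f g = (\<Sum>z\<in>Z. (f (g z))\<^sup>2)" for f :: "'a \<Rightarrow> real" and g :: "'a \<Rightarrow> 'a"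
  have Qg: "continuous_on G (Q f)" if "real_polynomial_function f" for f
    unfolding Q_def
    by (intro continuous_intros continuous_on_compose2[OF continuous_on_real_polynomial[OF that, of UNIV] cg]) auto
  have ne: "G \<noteq> {}" using group_id by blast
  \<comment> \<open>\<open>S\<close> consists of the upper bounds of \<open>Q f\<close> over
    \<open>G\<close> for \<open>f\<close> in \<open>K\<close>, so \<open>m\<close> is the infimum of
    the functional to be minimized.\<close>
  define S where "S = {c. \<exists>f\<in>K. \<forall>g\<in>G. Q f g \<le> c}"
  define m where "m = Inf S"
  have S0: "0 \<le> c" if "c \<in> S" for c
  proof -
    obtain f where "Q f id \<le> c" using \<open>c \<in> S\<close> group_id by (auto simp: S_def)
    moreover have "0 \<le> Q f id" by (simp add: Q_def sum_nonneg)
    ultimately show ?thesis by linarith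
  qed
  have bdd: "bdd_below S" using S0 by (rule bdd_belowI)
  have attain: "\<exists>g\<in>G. m \<le> Q w g" if w: "w \<in> K" for w
  proof -
    obtain g where g: "g \<in> G" "\<forall>h\<in>G. Q w h \<le> Q w g"
      using continuous_attains_sup[OF comp ne Qg[OF poly[OF w]]] by blast
    then have "Q w g \<in> S" using w by (auto simp: S_def)
    then show ?thesis using g cInf_lower[OF _ bdd] by (auto simp: m_def)
  qed
  have Sne: "S \<noteq> {}"
  proof -
    obtain g where "g \<in> G" "\<forall>h\<in>G. Q p h \<le> Q p g"
      using continuous_attains_sup[OF comp ne Qg[OF p]] by blast
    then show ?thesis using pK by (auto simp: S_def)
  qed
  define T where "T c = {f. \<forall>g\<in>G. Q f g \<le> c}" for c
  \<comment> \<open>A minimizer is a common point of the sublevel sets with \<open>c > m\<close>;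
    compactness of \<open>K\<close> reduces its existence to finitely many of them.\<close>
  have "K \<inter> (\<Inter>c\<in>{m<..}. T c) \<noteq> {}"
  proof (rule compact_imp_fip_image[OF compK])
    fix c
    have "T c = (\<Inter>g\<in>G. {f. Q f g \<le> c})" by (auto simp: T_def)
    moreover have "closed (\<Inter>g\<in>G. {f. Q f g \<le> c})"
      unfolding Q_def by (intro closed_INT ballI closed_Collect_le continuous_intros cx)
    ultimately show "closed (T c)" by simp
  next
    fix I assume I: "finite I" "I \<subseteq> {m<..}"
    show "K \<inter> (\<Inter>c\<in>I. T c) \<noteq> {}"
    proof (cases "I = {}")
      case False
      then have "m < Min I" using I by auto
      then obtain c where "c \<in> S" "c < Min I"
        using cInf_less_iff[OF Sne bdd] by (auto simp: m_def)
      then obtain f where f: "f \<in> K" "\<forall>g\<in>G. Q f g \<le> c" by (auto simp: S_def)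
      have "f \<in> T c'" if "c' \<in> I" for c'
        using f(2) \<open>c < Min I\<close> Min_le[OF I(1) that] by (force simp: T_def)
      then show ?thesis using f(1) by blast
    qed (use pK in auto)
  qed
  then obtain f where fI: "f \<in> K \<inter> (\<Inter>c\<in>{m<..}. T c)" by (meson ex_in_conv)
  then have fK: "f \<in> K" by (rule IntD1)
  have fm: "Q f g \<le> m" if g: "g \<in> G" for g
  proof (rule dense_ge)
    fix c assume "m < c"
    then have "f \<in> T c" using fI by (meson INT_D IntD2 greaterThan_iff)
    then show "Q f g \<le> c" using g by (simp add: T_def)
  qed
  have "f (h x) = f x" if h: "h \<in> G" for h x
  proof (rule ccontr)
    assume neq: "f (h x) \<noteq> f x"
    define k where "k x = f (h x)" for x
    have fN: "f \<in> degree_le N" using fK by (simp add: K_def)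
    have kN: "k \<in> degree_le N"
      unfolding k_def[abs_def] by (rule degree_le_compose[OF fN group_linear[OF h]])
    have km: "Q k g \<le> m" if "g \<in> G" for g
      using fm[OF group_comp[OF h that]] by (simp add: Q_def k_def)
    define w where "w x = (1/2) * (f x + k x)" for x
    have "w \<in> K"
    proof -
      have "w \<in> degree_le N"
        unfolding w_def[abs_def] by (intro fun_subspaceD(3)[OF degree_le_subspace] fun_subspaceD(2)[OF degree_le_subspace] fN kN)
      moreover have "a \<le> w z \<and> w z \<le> b" if ab: "\<forall>y\<in>orbit G z. a \<le> p y \<and> p y \<le> b" for a b z
      proof -
        have "a \<le> f z \<and> f z \<le> b" by (rule Kb[OF fK ab])
        moreover have "a \<le> k z \<and> k z \<le> b"
          unfolding k_def using ab by (intro Kb[OF fK]) (simp only: orbit_shift[OF h])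
        ultimately show ?thesis by (auto simp: w_def)
      qed
      ultimately show ?thesis unfolding K_def by blast
    qed
    then obtain g where g: "g \<in> G" "m \<le> Q w g" using attain by blast
    define d where "d x = f (g x) - k (g x)" for x
    have dN: "d \<in> degree_le N"
      unfolding d_def[abs_def]
      by (rule fun_subspace_diff[OF degree_le_subspace degree_le_compose[OF fN group_linear[OF g(1)]]
            degree_le_compose[OF kN group_linear[OF g(1)]]])
    \<comment> \<open>\<open>d\<close> has degree at most \<open>N\<close>, so it would vanish
      identically if it vanished on \<open>Z\<close>; but it is nonzero at
      \<open>inv g x\<close>.\<close>
    have "\<exists>z\<in>Z. d z \<noteq> 0"
    proof (rule ccontr)
      assume "\<not> (\<exists>z\<in>Z. d z \<noteq> 0)"
      then have "d (inv g x) = 0" using rep[OF dN, of "inv g x"] by simp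
      then show False using neq group_inv_apply(2)[OF g(1)] by (simp add: d_def k_def)
    qed
    then have "0 < (\<Sum>z\<in>Z. (d z)\<^sup>2)"
      using \<open>Z \<subseteq> Z0\<close> \<open>determined_by _ Z0\<close> finite_subset[of Z Z0]
      by (metis (no_types, lifting) determined_by_def sum_pos2 zero_le_power2 zero_less_power2)
    \<comment> \<open>Parallelogram law: the midpoint would fall strictly below \<open>m\<close> at
      \<open>g\<close>.\<close>
    moreover have "Q w g = (1/2) * Q f g + (1/2) * Q k g - (1/4) * (\<Sum>z\<in>Z. (d z)\<^sup>2)"
      unfolding Q_def w_def d_def sum_distrib_left sum.distrib[symmetric] sum_subtractf[symmetric]
      by (intro sum.cong refl) (simp add: power2_eq_square algebra_simps)
    ultimately show False using fm[OF g(1)] km[OF g(1)] g(2) by linarith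
  qed
  then have "f \<in> invariant_polynomials G"
    using poly[OF fK] by (simp add: invariant_polynomials_def polynomial_functions_def)
  then show ?thesis using Kb[OF fK] by blast
qed

text \<open>A polynomial within \<open>\<delta> / 3\<close> of the distance to the orbit of
  \<open>x\<close> is at most \<open>\<delta> / 3\<close> on that orbit and at least
  \<open>2 * \<delta> / 3\<close> on the other. \<open>invariant_mean\<close> preserves such bounds
  and hence the gap.\<close>

lemma invariants_separate_orbits:
  assumes comp: "compact G" and eq: "\<And>f. f \<in> invariant_polynomials G \<Longrightarrow> f y = f x"
  shows "y \<in> orbit G x"
proof (rule ccontr)
  assume ny: "y \<notin> orbit G x"
  have corb: "compact (orbit G x)" for x
    unfolding orbit_def
    by (rule compact_continuous_image[OF continuous_on_subset[OF continuous_on_product_coordinates] comp]) simp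
  have disj: "z \<notin> orbit G x" if "z \<in> orbit G y" for z
    using orbit_eqI that ny orbit_refl by blast
  have ne: "orbit G x \<noteq> {}" using orbit_refl by blast
  obtain z0 where z0: "z0 \<in> orbit G y" "\<And>z. z \<in> orbit G y \<Longrightarrow> infdist z0 (orbit G x) \<le> infdist z (orbit G x)"
  proof -
    have "orbit G y \<noteq> {}" using orbit_refl by blast
    then show ?thesis
      using continuous_attains_inf[OF corb[of y] _ continuous_on_infdist[OF continuous_on_id]] that by blast
  qed
  define \<delta> where "\<delta> = infdist z0 (orbit G x)"
  have \<delta>: "\<delta> > 0"
    unfolding \<delta>_def by (rule infdist_pos_not_in_closed[OF compact_imp_closed[OF corb] ne disj[OF z0(1)]])
  obtain p where p: "real_polynomial_function p"
    and ap: "\<And>z. z \<in> orbit G x \<union> orbit G y \<Longrightarrow> \<bar>infdist z (orbit G x) - p z\<bar> < \<delta> / 3"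
  proof (rule Stone_Weierstrass_real_polynomial_function[of "orbit G x \<union> orbit G y" "\<lambda>z. infdist z (orbit G x)" "\<delta> / 3"])
    show "compact (orbit G x \<union> orbit G y)" by (intro compact_Un corb)
    show "continuous_on (orbit G x \<union> orbit G y) (\<lambda>z. infdist z (orbit G x))" by (intro continuous_intros)
  qed (use \<delta> in auto)
  obtain f where f: "f \<in> invariant_polynomials G"
    and fb: "\<And>z a b. \<forall>y\<in>orbit G z. a \<le> p y \<and> p y \<le> b \<Longrightarrow> a \<le> f z \<and> f z \<le> b"
    using invariant_mean[OF comp p] by blast
  have bnd: "\<exists>B. \<forall>v\<in>orbit G z. \<bar>p v\<bar> \<le> B" for z
  proof -
    have "compact (p ` orbit G z)" by (intro compact_continuous_image corb continuous_on_real_polynomial p)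
    then obtain B where "\<forall>y\<in>p ` orbit G z. norm y \<le> B" using compact_imp_bounded bounded_iff by blast
    then show ?thesis by auto
  qed
  obtain B1 B2 where B: "\<And>v. v \<in> orbit G x \<Longrightarrow> \<bar>p v\<bar> \<le> B1" "\<And>v. v \<in> orbit G y \<Longrightarrow> \<bar>p v\<bar> \<le> B2"
    using bnd by meson
  have "p v \<le> \<delta> / 3" if "v \<in> orbit G x" for v
    using ap[of v] that by (simp add: abs_less_iff)
  then have "f x \<le> \<delta> / 3" using fb[of x "- B1" "\<delta> / 3"] B(1) by (force simp: abs_le_iff)
  moreover have "2 * \<delta> / 3 \<le> p v" if "v \<in> orbit G y" for v
  proof -
    have "\<bar>infdist v (orbit G x) - p v\<bar> < \<delta> / 3" using ap that by blast
    moreover have "\<delta> \<le> infdist v (orbit G x)" unfolding \<delta>_def by (rule z0(2)[OF that])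
    ultimately show ?thesis by linarith
  qed
  then have "2 * \<delta> / 3 \<le> f y" using fb[of y "2 * \<delta> / 3" B2] B(2) by (force simp: abs_le_iff)
  ultimately show False using eq[OF f] \<delta> by simp
qed

text \<open>The isometries that map each point into its own orbit form a group with the same orbits,
  which is \<open>G\<close> by maximality. Since invariants separate orbits, preserving them all
  puts \<open>g\<close> in that group.\<close>

lemma maximal_contains_symmetries:
  assumes comp: "compact G" and max: "maximal_in_orbit_class G" and g: "orthogonal_transformation g"
    and inv: "\<And>f x. f \<in> invariant_polynomials G \<Longrightarrow> f (g x) = f x"
  shows "g \<in> G"
proof -
  define H where "H = {h. orthogonal_transformation h \<and> (\<forall>z. h z \<in> orbit G z)}"
  have GH: "G \<subseteq> H" using group_orthogonal by (auto simp: H_def orbit_def)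
  have "h1 \<circ> h2 \<in> H" if "h1 \<in> H" "h2 \<in> H" for h1 h2
    using that orbit_eqI unfolding H_def by (auto simp: orthogonal_transformation_compose)
  moreover have "inv h \<in> H" if h: "h \<in> H" for h
  proof -
    have o: "orthogonal_transformation h" using h by (simp add: H_def)
    have "inv h z \<in> orbit G z" for z
    proof -
      have "h (inv h z) \<in> orbit G (inv h z)" using h by (simp add: H_def)
      then have "z \<in> orbit G (inv h z)"
        using orthogonal_transformation_bij[OF o] by (simp add: bij_def surj_f_inv_f)
      from orbit_eqI[OF this] show ?thesis using orbit_refl by blast
    qed
    then show ?thesis using orthogonal_transformation_inv[OF o] by (simp add: H_def)
  qed
  ultimately have "orthogonal_subgroup H"
    using GH group_id by (auto simp: orthogonal_subgroup_def H_def orthogonal_group_def)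
  moreover have "orbit H z = orbit G z" for z
  proof
    show "orbit H z \<subseteq> orbit G z"
    proof
      fix y assume "y \<in> orbit H z"
      then obtain h where "h \<in> H" "y = h z" by (auto simp: orbit_def)
      then show "y \<in> orbit G z" by (simp add: H_def)
    qed
    show "orbit G z \<subseteq> orbit H z" using GH by (auto simp: orbit_def)
  qed
  then have "orbit_equivalent G H" by (simp add: orbit_equivalent_def)
  ultimately have "H = G" using max GH by (auto simp: maximal_in_orbit_class_def)
  moreover have "g \<in> H"
    using g invariants_separate_orbits[OF comp] inv by (simp add: H_def)
  ultimately show ?thesis by simp
qed

lemma laplacian_algebra_invariants: "laplacian_algebra (invariant_polynomials G)"
  unfolding laplacian_algebra_def polynomial_subalgebra_def
proof (intro conjI ballI allI)
  show "(\<lambda>x. \<Sum>b\<in>Basis. (x \<bullet> b)\<^sup>2) \<in> invariant_polynomials G"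
  proof -
    have "(\<lambda>x::'a. \<Sum>b\<in>Basis. (x \<bullet> b)\<^sup>2) = (\<lambda>x. x \<bullet> x)"
      by (rule ext) (subst (2) euclidean_inner, simp add: power2_eq_square)
    then show ?thesis
      using group_orthogonal la_norm[OF laplacian_algebra_polynomials]
      by (simp add: invariant_polynomials_def orthogonal_transformation_def)
  qed
  fix f assume f: "f \<in> invariant_polynomials G"
  then have pf: "real_polynomial_function f" by (simp add: invariant_polynomials_def polynomial_functions_def)
  have "laplacian f (g x) = laplacian f x" if g: "g \<in> G" for g x
  proof -
    have "(\<lambda>x. f (g x)) = f" using f g by (auto simp: invariant_polynomials_def)
    then show ?thesis using laplacian_orthogonal[OF pf group_orthogonal[OF g], of x] by simp
  qed
  then show "laplacian f \<in> invariant_polynomials G"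
    using real_polynomial_laplacian[OF pf] by (simp add: invariant_polynomials_def polynomial_functions_def)
qed (auto simp: invariant_polynomials_def polynomial_functions_def)

end

subsection \<open>Normal spaces and gradients of invariants\<close>

text \<open>If the Gram matrix of the \<open>w b\<close> is at Frobenius distance below 1 from the
  identity, Cauchy--Schwarz excludes a kernel vector. The criterion is polynomial in inner products,
  so it can be evaluated inside a Laplacian algebra.\<close>

lemma gram_bijective:
  fixes w :: "'a::euclidean_space \<Rightarrow> 'a"
  assumes q: "(\<Sum>b\<in>Basis. \<Sum>c\<in>Basis. (w b \<bullet> w c - b \<bullet> c)\<^sup>2) < 1"
  shows "bij (\<lambda>v. \<Sum>b\<in>Basis. (v \<bullet> b) *\<^sub>R w b)"
proof -
  define M where "M v = (\<Sum>b\<in>Basis. (v \<bullet> b) *\<^sub>R w b)" for v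
  have lin: "linear M"
  proof (rule linearI)
    show "M (x + y) = M x + M y" for x y
      by (simp add: M_def inner_add_left scaleR_add_left sum.distrib)
    show "M (r *\<^sub>R x) = r *\<^sub>R M x" for r x
      by (simp add: M_def scaleR_sum_right)
  qed
  have "v = 0" if Mv: "M v = 0" for v
  proof (rule ccontr)
    assume "v \<noteq> 0"
    have "0 = M v \<bullet> M v" using Mv by simp
    also have "\<dots> = (\<Sum>b\<in>Basis. \<Sum>c\<in>Basis. (v \<bullet> b) * (v \<bullet> c) * (w b \<bullet> w c))"
      by (simp add: M_def inner_sum_left inner_sum_right sum_distrib_left mult_ac inner_commute)
    also have "\<dots> = (\<Sum>b\<in>Basis. \<Sum>c\<in>Basis. (v \<bullet> b) * (v \<bullet> c) * (b \<bullet> c))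
      + (\<Sum>b\<in>Basis. \<Sum>c\<in>Basis. ((v \<bullet> b) * (v \<bullet> c)) * (w b \<bullet> w c - b \<bullet> c))"
      by (simp add: algebra_simps flip: sum.distrib)
    also have "(\<Sum>b\<in>Basis. \<Sum>c\<in>Basis. (v \<bullet> b) * (v \<bullet> c) * (b \<bullet> c)) = v \<bullet> v"
    proof -
      have "(\<Sum>c\<in>Basis. (v \<bullet> b) * (v \<bullet> c) * (b \<bullet> c)) = (v \<bullet> b) * (v \<bullet> b)" if "b \<in> Basis" for b
        using that by (simp add: inner_Basis if_distrib[of "\<lambda>x. _ * x"] sum.delta cong: if_cong)
      then show ?thesis by (simp add: euclidean_inner[of v v])
    qed
    finally have eq: "v \<bullet> v = - (\<Sum>b\<in>Basis. \<Sum>c\<in>Basis. ((v \<bullet> b) * (v \<bullet> c)) * (w b \<bullet> w c - b \<bullet> c))" by simp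
    let ?X = "\<lambda>p. (v \<bullet> fst p) * (v \<bullet> snd p)" and ?Y = "\<lambda>p. w (fst p) \<bullet> w (snd p) - fst p \<bullet> snd p"
    have "(v \<bullet> v)\<^sup>2 = (\<Sum>p\<in>Basis \<times> Basis. ?X p * ?Y p)\<^sup>2"
      unfolding eq by (simp add: sum.cartesian_product case_prod_beta)
    also have "\<dots> \<le> (\<Sum>p\<in>Basis \<times> Basis. (?X p)\<^sup>2) * (\<Sum>p\<in>Basis \<times> Basis. (?Y p)\<^sup>2)"
      by (rule Cauchy_Schwarz_ineq_sum)
    also have "(\<Sum>p\<in>Basis \<times> Basis. (?X p)\<^sup>2) = (v \<bullet> v)\<^sup>2"
    proof -
      have "(\<Sum>p\<in>Basis \<times> Basis. (?X p)\<^sup>2) = (\<Sum>b\<in>Basis. \<Sum>c\<in>Basis. ((v \<bullet> b) * (v \<bullet> c))\<^sup>2)"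
        by (simp add: sum.cartesian_product case_prod_beta)
      also have "\<dots> = (\<Sum>b\<in>Basis. (v \<bullet> b)\<^sup>2) * (\<Sum>c\<in>Basis. (v \<bullet> c)\<^sup>2)"
        by (simp add: sum_product power_mult_distrib)
      finally show ?thesis by (simp add: euclidean_inner[of v v] power2_eq_square)
    qed
    also have "(\<Sum>p\<in>Basis \<times> Basis. (?Y p)\<^sup>2) = (\<Sum>b\<in>Basis. \<Sum>c\<in>Basis. (w b \<bullet> w c - b \<bullet> c)\<^sup>2)"
      by (simp add: sum.cartesian_product case_prod_beta)
    finally have "(v \<bullet> v)\<^sup>2 \<le> (v \<bullet> v)\<^sup>2 * (\<Sum>b\<in>Basis. \<Sum>c\<in>Basis. (w b \<bullet> w c - b \<bullet> c)\<^sup>2)" .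
    moreover have "0 < (v \<bullet> v)\<^sup>2" using \<open>v \<noteq> 0\<close> by simp
    ultimately show False using mult_strict_left_mono[OF q, of "(v \<bullet> v)\<^sup>2"] by linarith
  qed
  then have "inj M" using linear_injective_0[OF lin] by blast
  then show ?thesis
    using linear_injective_imp_surjective[OF lin] by (simp add: bij_def M_def[abs_def])
qed

definition gradients :: "('a::euclidean_space \<Rightarrow> real) set \<Rightarrow> 'a \<Rightarrow> 'a set" where
  "gradients A x = (\<lambda>f. grad f x) ` A"

lemma subspace_gradients:
  assumes A: "laplacian_algebra A"
  shows "subspace (gradients A x)"
  unfolding subspace_def gradients_def
proof (intro conjI ballI allI)
  show "0 \<in> (\<lambda>f. grad f x) ` A" by (rule image_eqI[of _ _ "\<lambda>x. 0"]) (simp_all add: la_const[OF A])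
  show "u + v \<in> (\<lambda>f. grad f x) ` A" if uv: "u \<in> (\<lambda>f. grad f x) ` A" "v \<in> (\<lambda>f. grad f x) ` A" for u v
  proof -
    obtain f where "f \<in> A" "u = grad f x" using uv(1) by blast
    moreover obtain g where "g \<in> A" "v = grad g x" using uv(2) by blast
    ultimately show ?thesis
      using la_add[OF A, of f g] la_poly[OF A] by (intro image_eqI[of _ _ "\<lambda>x. f x + g x"]) (simp_all add: grad_add)
  qed
  show "c *\<^sub>R u \<in> (\<lambda>f. grad f x) ` A" if u: "u \<in> (\<lambda>f. grad f x) ` A" for c u
  proof -
    obtain f where "f \<in> A" "u = grad f x" using u by blast
    then show ?thesis
      using la_cmul[OF A, of f c] la_poly[OF A] by (intro image_eqI[of _ _ "\<lambda>x. c * f x"]) (simp_all add: grad_cmul)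
  qed
qed

text \<open>The map \<open>\<Psi>\<close> straightens invariants \<open>F e\<close> whose gradients at \<open>x0\<close> form an orthonormal basis
  \<open>E\<close> of all gradients. By maximality of the rank the gradients of the \<open>F e\<close> span all gradients near
  \<open>x0\<close>, so that a curve on which the \<open>F e\<close> are constant lies in a level set of \<open>A\<close>.\<close>

lemma curve_in_level_set:
  fixes A :: "('a::euclidean_space \<Rightarrow> real) set"
  assumes A: "laplacian_algebra A" and W: "open W" "x0 \<in> W"
    and rank: "\<And>x. x \<in> W \<Longrightarrow> dim (gradients A x) \<le> dim (gradients A x0)"
    and v: "\<And>u. u \<in> gradients A x0 \<Longrightarrow> u \<bullet> v = 0"
  shows "v \<in> tangent_space {x. \<forall>f\<in>A. f x = f x0} x0"
proof -
  obtain E where E: "E \<subseteq> gradients A x0" "pairwise orthogonal E" "\<And>e. e \<in> E \<Longrightarrow> norm e = 1"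
    "independent E" "card E = dim (gradients A x0)" "span E = gradients A x0"
    by (rule orthonormal_basis_subspace[OF subspace_gradients[OF A, of x0]]) (rule that)
  have fE: "finite E" using E(4) by (rule independent_imp_finite)
  have EE: "e \<bullet> e' = (if e = e' then 1 else 0)" if "e \<in> E" "e' \<in> E" for e e'
    using E(2,3) that by (auto simp: pairwise_def orthogonal_def norm_eq_1)
  have "\<forall>e\<in>E. \<exists>f\<in>A. grad f x0 = e" using E(1) by (auto simp: gradients_def)
  then obtain F where F: "\<And>e. e \<in> E \<Longrightarrow> F e \<in> A" "\<And>e. e \<in> E \<Longrightarrow> grad (F e) x0 = e" by metis
  have pF: "real_polynomial_function (F e)" if "e \<in> E" for e using la_poly[OF A F(1)[OF that]] .
  \<comment> \<open>\<Psi> replaces the coordinate along \<open>e\<close> by \<open>F e\<close>, up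
    to a constant, and has the identity as derivative at \<open>x0\<close>. The \<open>F e\<close>
    are therefore constant on the preimage of a line whose direction is orthogonal to
    \<open>E\<close>.\<close>
  define \<Psi> where "\<Psi> x = x + (\<Sum>e\<in>E. (F e x - F e x0 - e \<bullet> (x - x0)) *\<^sub>R e)" for x
  define \<Psi>' where "\<Psi>' x = id_blinfun + (\<Sum>e\<in>E. blinfun_scaleR_left e o\<^sub>L blinfun_inner_left (grad (F e) x - e))" for x
  have \<Psi>'_apply: "blinfun_apply (\<Psi>' x) h = h + (\<Sum>e\<in>E. ((grad (F e) x - e) \<bullet> h) *\<^sub>R e)" for x h
    by (simp add: \<Psi>'_def blinfun.add_left blinfun.sum_left inner_commute)
  have der: "(\<Psi> has_derivative blinfun_apply (\<Psi>' x)) (at x)" for x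
  proof -
    have "(\<Psi> has_derivative (\<lambda>h. h + (\<Sum>e\<in>E. (grad (F e) x \<bullet> h - 0 - e \<bullet> (h - 0)) *\<^sub>R e))) (at x)"
      unfolding \<Psi>_def[abs_def]
      by (intro has_derivative_add has_derivative_ident has_derivative_sum has_derivative_scaleR_left
          has_derivative_diff has_derivative_grad pF has_derivative_const has_derivative_inner_right)
    then show ?thesis by (simp add: \<Psi>'_apply[abs_def] inner_diff_left)
  qed
  have cont: "continuous_on UNIV \<Psi>'"
    unfolding \<Psi>'_def[abs_def]
    by (intro continuous_intros bounded_linear.continuous_on[OF bounded_linear_blinfun_inner_left] continuous_on_grad pF)
  have id0: "\<Psi>' x0 = id_blinfun"
    by (rule blinfun_eqI) (simp add: \<Psi>'_apply F(2))
  have \<Psi>0: "\<Psi> x0 = x0" by (simp add: \<Psi>_def)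
  \<comment> \<open>The margin \<open>1 / 2\<close> bounds the derivative of \<Psi> from below
    uniformly; continuity of \<gamma>' will rest on this bound.\<close>
  define W' where "W' = W \<inter> {x. norm (\<Psi>' x - id_blinfun) < 1 / 2}"
  have W': "open W'" "x0 \<in> W'"
  proof -
    show "open W'"
      unfolding W'_def
      by (intro open_Int W open_Collect_less continuous_on_norm continuous_on_diff cont continuous_on_const)
    show "x0 \<in> W'" using W(2) id0 by (simp add: W'_def)
  qed
  obtain U' V g g' where U': "open U'" "U' \<subseteq> W'" "x0 \<in> U'" and V: "open V" "\<Psi> x0 \<in> V"
    and hom: "homeomorphism U' V \<Psi> g"
    and dg: "\<And>y. y \<in> V \<Longrightarrow> (g has_derivative (g' y)) (at y)"
    and g': "\<And>y. y \<in> V \<Longrightarrow> g' y = inv (blinfun_apply (\<Psi>' (g y)))"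
    and bij: "\<And>y. y \<in> V \<Longrightarrow> bij (blinfun_apply (\<Psi>' (g y)))"
  proof (rule inverse_function_theorem[of W' \<Psi> \<Psi>' x0 id_blinfun])
    show "open W'" "x0 \<in> W'" by (rule W')+
    show "(\<Psi> has_derivative blinfun_apply (\<Psi>' x)) (at x)" for x by (rule der)
    show "continuous_on W' \<Psi>'" by (rule continuous_on_subset[OF cont]) simp
    show "id_blinfun o\<^sub>L \<Psi>' x0 = id_blinfun" unfolding id0 by (rule blinfun_eqI) simp
  qed (rule that)
  note V = V[unfolded \<Psi>0]
  have gU: "g y \<in> U'" "\<Psi> (g y) = y" if "y \<in> V" for y
    using hom that by (auto simp: homeomorphism_def)
  have gx0: "g x0 = x0" using hom U'(3) \<Psi>0 by (metis homeomorphism_def)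
  have "open ((\<lambda>t. x0 + t *\<^sub>R v) -` V)" by (intro open_vimage V continuous_intros)
  moreover have "0 \<in> (\<lambda>t. x0 + t *\<^sub>R v) -` V" using V by simp
  ultimately obtain \<epsilon> where \<epsilon>: "\<epsilon> > 0" "ball 0 \<epsilon> \<subseteq> (\<lambda>t. x0 + t *\<^sub>R v) -` V"
    by (meson open_contains_ball)
  have inV: "x0 + t *\<^sub>R v \<in> V" if "t \<in> {-\<epsilon><..<\<epsilon>}" for t
    using \<epsilon>(2) that by (auto simp: subset_iff dist_real_def)
  define \<gamma> where "\<gamma> t = g (x0 + t *\<^sub>R v)" for t
  define \<gamma>' where "\<gamma>' t = g' (x0 + t *\<^sub>R v) v" for t
  have d\<gamma>: "(\<gamma> has_vector_derivative \<gamma>' t) (at t)" if t: "t \<in> {-\<epsilon><..<\<epsilon>}" for t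
  proof -
    have "(\<gamma> has_derivative (\<lambda>h. g' (x0 + t *\<^sub>R v) (h *\<^sub>R v))) (at t)"
      unfolding \<gamma>_def
      by (rule has_derivative_compose[where g = g and g' = "g' (x0 + t *\<^sub>R v)" and f = "\<lambda>t. x0 + t *\<^sub>R v"
            and f' = "\<lambda>h. h *\<^sub>R v"])
        (auto intro!: derivative_eq_intros dg inV t)
    moreover have "g' (x0 + t *\<^sub>R v) (h *\<^sub>R v) = h *\<^sub>R \<gamma>' t" for h
      using has_derivative_linear[OF dg[OF inV[OF t]]] by (simp add: \<gamma>'_def linear_cmul)
    ultimately show ?thesis by (simp add: has_vector_derivative_def)
  qed
  have \<Psi>'\<gamma>': "blinfun_apply (\<Psi>' (\<gamma> t)) (\<gamma>' t) = v" if t: "t \<in> {-\<epsilon><..<\<epsilon>}" for t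
    using bij[OF inV[OF t]] g'[OF inV[OF t]] by (simp add: \<gamma>'_def \<gamma>_def bij_def surj_f_inv_f)
  have perpE: "grad (F e) (\<gamma> t) \<bullet> \<gamma>' t = 0" if t: "t \<in> {-\<epsilon><..<\<epsilon>}" and e: "e \<in> E" for t e
  proof -
    have "e \<bullet> v = 0" using v e E(1) by blast
    moreover have "e \<bullet> (\<Sum>e'\<in>E. ((grad (F e') (\<gamma> t) - e') \<bullet> \<gamma>' t) *\<^sub>R e') = (grad (F e) (\<gamma> t) - e) \<bullet> \<gamma>' t"
      using e fE EE by (simp add: inner_sum_right if_distrib[of "\<lambda>x. _ * x"] cong: if_cong)
    ultimately have "e \<bullet> v = e \<bullet> \<gamma>' t + (grad (F e) (\<gamma> t) - e) \<bullet> \<gamma>' t"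
      using arg_cong[OF \<Psi>'\<gamma>'[OF t], of "\<lambda>u. e \<bullet> u"] by (simp add: \<Psi>'_apply inner_add_right)
    then show ?thesis using \<open>e \<bullet> v = 0\<close> by (simp add: inner_diff_left)
  qed
  have perp: "u \<bullet> \<gamma>' t = 0" if t: "t \<in> {-\<epsilon><..<\<epsilon>}" and u: "u \<in> gradients A (\<gamma> t)" for t u
  proof -
    let ?x = "\<gamma> t"
    have x: "?x \<in> W" using gU(1)[OF inV[OF t]] U'(2) by (auto simp: \<gamma>_def W'_def)
    have surj: "\<exists>h. blinfun_apply (\<Psi>' ?x) h = y" for y
      using bij[OF inV[OF t]] by (metis \<gamma>_def bij_def surjD)
    \<comment> \<open>The \<open>e\<close>-coordinate of the derivative of \<Psi> applied to
      \<open>h\<close> is \<open>grad (F e) ?x \<bullet> h\<close>, so its surjectivity yields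
      vectors dual to these gradients.\<close>
    have ind: "\<forall>e\<in>E. c e = 0" if c: "(\<Sum>e\<in>E. c e *\<^sub>R grad (F e) ?x) = 0" for c
    proof
      fix e assume e: "e \<in> E"
      obtain h where h: "blinfun_apply (\<Psi>' ?x) h = e" using surj by blast
      have "(\<Sum>e'\<in>E. c e' * (e' \<bullet> e)) = (\<Sum>e'\<in>E. c e' * (grad (F e') ?x \<bullet> h))"
      proof (intro sum.cong refl)
        fix e' assume e': "e' \<in> E"
        have "e' \<bullet> (\<Sum>d\<in>E. ((grad (F d) ?x - d) \<bullet> h) *\<^sub>R d) = (grad (F e') ?x - e') \<bullet> h"
          using e' fE EE by (simp add: inner_sum_right if_distrib[of "\<lambda>x. _ * x"] cong: if_cong)
        then have "e' \<bullet> e = grad (F e') ?x \<bullet> h"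
          unfolding h[symmetric] by (simp add: \<Psi>'_apply inner_add_right inner_diff_left)
        then show "c e' * (e' \<bullet> e) = c e' * (grad (F e') ?x \<bullet> h)" by simp
      qed
      also have "\<dots> = (\<Sum>e'\<in>E. c e' *\<^sub>R grad (F e') ?x) \<bullet> h" by (simp add: inner_sum_left)
      also have "\<dots> = 0" by (simp add: c)
      finally have "(\<Sum>e'\<in>E. c e' * (e' \<bullet> e)) = 0" .
      moreover have "(\<Sum>e'\<in>E. c e' * (e' \<bullet> e)) = c e"
        using e fE EE by (simp add: if_distrib[of "\<lambda>x. _ * x"] cong: if_cong)
      ultimately show "c e = 0" by simp
    qed
    have inj: "inj_on (\<lambda>e. grad (F e) ?x) E"
    proof (rule inj_onI, rule ccontr)
      fix a b assume ab: "a \<in> E" "b \<in> E" "grad (F a) ?x = grad (F b) ?x" "a \<noteq> b"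
      have "(\<Sum>e\<in>E. (if e = a then 1 else if e = b then -1 else 0) *\<^sub>R grad (F e) ?x)
        = (\<Sum>e\<in>{a, b}. (if e = a then 1 else if e = b then -1 else 0) *\<^sub>R grad (F e) ?x)"
        by (rule sum.mono_neutral_right) (use fE ab in auto)
      also have "\<dots> = 0" using ab by simp
      finally show False using ind ab(1) by fastforce
    qed
    have indep: "independent ((\<lambda>e. grad (F e) ?x) ` E)"
    proof (rule ccontr)
      assume "\<not> independent ((\<lambda>e. grad (F e) ?x) ` E)"
      then obtain c y where y: "y \<in> (\<lambda>e. grad (F e) ?x) ` E" "c y \<noteq> 0"
        and "(\<Sum>y\<in>(\<lambda>e. grad (F e) ?x) ` E. c y *\<^sub>R y) = 0"
        using dependent_finite[of "(\<lambda>e. grad (F e) ?x) ` E"] fE by auto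
      then have "(\<Sum>e\<in>E. c (grad (F e) ?x) *\<^sub>R grad (F e) ?x) = 0"
        by (simp add: sum.reindex[OF inj])
      from ind[OF this] show False using y by auto
    qed
    have "(\<lambda>e. grad (F e) ?x) ` E \<subseteq> gradients A ?x" using F(1) by (auto simp: gradients_def)
    moreover have "card ((\<lambda>e. grad (F e) ?x) ` E) = dim (gradients A x0)"
      using card_image[OF inj] E(5) by simp
    then have "dim (gradients A ?x) \<le> card ((\<lambda>e. grad (F e) ?x) ` E)" using rank[OF x] by simp
    ultimately have "gradients A ?x \<subseteq> span ((\<lambda>e. grad (F e) ?x) ` E)"
      using card_ge_dim_independent[OF _ indep] by blast
    then have "u \<in> span ((\<lambda>e. grad (F e) ?x) ` E)" using u by blast
    then show ?thesis
    proof (induction rule: span_induct)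
      case base
      show ?case by (simp add: subspace_def inner_add_left)
    next
      case (step y)
      then show ?case using perpE[OF t] by auto
    qed
  qed
  have const: "f (\<gamma> t) = f x0" if f: "f \<in> A" and t: "t \<in> {-\<epsilon><..<\<epsilon>}" for f t
  proof -
    have "((\<lambda>t. f (\<gamma> t)) has_derivative (\<lambda>h. 0)) (at s within {-\<epsilon><..<\<epsilon>})" if s: "s \<in> {-\<epsilon><..<\<epsilon>}" for s
    proof -
      have "((\<lambda>t. f (\<gamma> t)) has_derivative (\<lambda>h. grad f (\<gamma> s) \<bullet> (h *\<^sub>R \<gamma>' s))) (at s)"
        using has_derivative_compose[OF d\<gamma>[OF s, unfolded has_vector_derivative_def] has_derivative_grad[OF la_poly[OF A f]]] .
      moreover have "grad f (\<gamma> s) \<bullet> \<gamma>' s = 0" using perp[OF s] f by (auto simp: gradients_def)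
      ultimately show ?thesis by (simp add: has_derivative_at_withinI)
    qed
    then obtain c where c: "\<And>s. s \<in> {-\<epsilon><..<\<epsilon>} \<Longrightarrow> f (\<gamma> s) = c"
      using has_derivative_zero_constant[of "{-\<epsilon><..<\<epsilon>}" "\<lambda>t. f (\<gamma> t)"] convex_real_interval(8) by blast
    have "f (\<gamma> t) = f (\<gamma> 0)" using c[OF t] c[of 0] \<epsilon>(1) by simp
    then show ?thesis by (simp add: \<gamma>_def gx0)
  qed
  have c\<gamma>: "continuous_on {-\<epsilon><..<\<epsilon>} \<gamma>"
    using d\<gamma> by (meson continuous_at_imp_continuous_on has_vector_derivative_continuous)
  have c\<gamma>': "continuous_on {-\<epsilon><..<\<epsilon>} \<gamma>'"
  proof -
    have lower: "norm h \<le> 2 * norm (blinfun_apply (\<Psi>' (\<gamma> t)) h)" if t: "t \<in> {-\<epsilon><..<\<epsilon>}" for t h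
    proof -
      have "\<gamma> t \<in> W'" using gU(1)[OF inV[OF t]] U'(2) by (auto simp: \<gamma>_def)
      then have "norm (\<Psi>' (\<gamma> t) - id_blinfun) \<le> 1 / 2" by (simp add: W'_def)
      then have "norm (blinfun_apply (\<Psi>' (\<gamma> t) - id_blinfun) h) \<le> 1 / 2 * norm h"
        by (meson mult_right_mono norm_blinfun norm_ge_zero order_trans)
      then show ?thesis
        using norm_triangle_ineq4[of "blinfun_apply (\<Psi>' (\<gamma> t)) h" "blinfun_apply (\<Psi>' (\<gamma> t) - id_blinfun) h"]
        by (simp add: blinfun.diff_left)
    qed
    have "(\<gamma>' \<longlongrightarrow> \<gamma>' t) (at t within {-\<epsilon><..<\<epsilon>})" if t: "t \<in> {-\<epsilon><..<\<epsilon>}" for t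
    proof (rule LIM_zero_cancel, rule Lim_null_comparison)
      \<comment> \<open>The derivative of \<Psi> maps both velocities to the same \<open>v\<close>,
        so their difference is controlled by the change of that derivative.\<close>
      have "norm (\<gamma>' s - \<gamma>' t) \<le> 2 * (norm (\<Psi>' (\<gamma> t) - \<Psi>' (\<gamma> s)) * norm (\<gamma>' t))" if s: "s \<in> {-\<epsilon><..<\<epsilon>}" for s
      proof -
        have "blinfun_apply (\<Psi>' (\<gamma> s)) (\<gamma>' s - \<gamma>' t) = blinfun_apply (\<Psi>' (\<gamma> t) - \<Psi>' (\<gamma> s)) (\<gamma>' t)"
          using \<Psi>'\<gamma>'[OF s] \<Psi>'\<gamma>'[OF t] by (simp add: blinfun.diff_right blinfun.diff_left)
        then show ?thesis
          using lower[OF s, of "\<gamma>' s - \<gamma>' t"] norm_blinfun[of "\<Psi>' (\<gamma> t) - \<Psi>' (\<gamma> s)" "\<gamma>' t"] by simp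
      qed
      then show "\<forall>\<^sub>F s in at t within {-\<epsilon><..<\<epsilon>}. norm (\<gamma>' s - \<gamma>' t)
          \<le> 2 * (norm (\<Psi>' (\<gamma> t) - \<Psi>' (\<gamma> s)) * norm (\<gamma>' t))"
        by (simp add: eventually_at_filter)
      have "continuous_on {-\<epsilon><..<\<epsilon>} (\<lambda>s. \<Psi>' (\<gamma> s))"
        by (rule continuous_on_compose2[OF cont c\<gamma>]) simp
      then have "((\<lambda>s. \<Psi>' (\<gamma> s)) \<longlongrightarrow> \<Psi>' (\<gamma> t)) (at t within {-\<epsilon><..<\<epsilon>})"
        using t by (simp add: continuous_on_def)
      then have "((\<lambda>s. 2 * (norm (\<Psi>' (\<gamma> t) - \<Psi>' (\<gamma> s)) * norm (\<gamma>' t))) \<longlongrightarrow>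
          2 * (norm (\<Psi>' (\<gamma> t) - \<Psi>' (\<gamma> t)) * norm (\<gamma>' t))) (at t within {-\<epsilon><..<\<epsilon>})"
        by (intro tendsto_mult tendsto_norm tendsto_diff tendsto_const)
      then show "((\<lambda>s. 2 * (norm (\<Psi>' (\<gamma> t) - \<Psi>' (\<gamma> s)) * norm (\<gamma>' t))) \<longlongrightarrow> 0) (at t within {-\<epsilon><..<\<epsilon>})"
        by simp
    qed
    then show ?thesis by (simp add: continuous_on_def)
  qed
  have "\<gamma> C1_differentiable_on {-\<epsilon><..<\<epsilon>}"
    unfolding C1_differentiable_on_def using d\<gamma> c\<gamma>' by blast
  moreover have "\<gamma> ` {-\<epsilon><..<\<epsilon>} \<subseteq> {x. \<forall>f\<in>A. f x = f x0}" using const by auto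
  moreover have "(\<gamma> has_vector_derivative v) (at 0)"
  proof -
    have z: "0 \<in> {-\<epsilon><..<\<epsilon>}" using \<epsilon>(1) by simp
    have "\<gamma>' 0 = v" using \<Psi>'\<gamma>'[OF z] by (simp add: \<gamma>_def gx0 id0)
    then show ?thesis using d\<gamma>[OF z] by simp
  qed
  moreover have "\<gamma> 0 = x0" by (simp add: \<gamma>_def gx0)
  ultimately show ?thesis unfolding tangent_space_def using \<epsilon>(1) by blast
qed

subsection \<open>The normal spaces condition\<close>

text \<open>At a point of \<open>U\<close> with maximal gradient rank, everything orthogonal to the
  gradients is the velocity of a curve in a level set of the invariants, that is, in the orbit.
  Taking complements reverses this inclusion.\<close>

lemma normal_space_gradients:
  fixes G :: "('a::euclidean_space \<Rightarrow> 'a) set"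
  assumes G: "orthogonal_subgroup G" and comp: "compact G" and U: "open U" "U \<noteq> {}"
  shows "\<exists>x\<in>U. normal_space (orbit G x) x \<subseteq> gradients (invariant_polynomials G) x"
proof -
  let ?A = "invariant_polynomials G"
  note A = laplacian_algebra_invariants[OF G]
  obtain x where x: "x \<in> U" and max: "\<And>y. y \<in> U \<Longrightarrow> dim (gradients ?A y) \<le> dim (gradients ?A x)"
  proof -
    obtain x0 where "x0 \<in> U" using U(2) by blast
    moreover have "\<forall>y. y \<in> U \<longrightarrow> dim (gradients ?A y) < Suc (DIM('a))"
      using dim_subset_UNIV[of "gradients ?A _"] by (simp add: less_Suc_eq_le)
    ultimately show ?thesis
      using ex_has_greatest_nat[of "\<lambda>x. x \<in> U" x0 "\<lambda>x. dim (gradients ?A x)" "Suc (DIM('a))"] that by blast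
  qed
  have "v \<in> tangent_space (orbit G x) x" if v: "v \<in> orthogonal_comp (gradients ?A x)" for v
  proof -
    have "v \<in> tangent_space {y. \<forall>f\<in>?A. f y = f x} x"
    proof (rule curve_in_level_set[OF A U(1) x max])
      show "u \<bullet> v = 0" if "u \<in> gradients ?A x" for u
        using v that unfolding orthogonal_comp_def orthogonal_def by blast
    qed
    moreover have "{y. \<forall>f\<in>?A. f y = f x} \<subseteq> orbit G x"
      using invariants_separate_orbits[OF G comp] by blast
    ultimately show ?thesis unfolding tangent_space_def by blast
  qed
  then have "normal_space (orbit G x) x \<subseteq> orthogonal_comp (orthogonal_comp (gradients ?A x))"
    unfolding normal_space_def orthogonal_comp_def by blast
  then show ?thesis
    using x orthogonal_comp_self[OF subspace_gradients[OF A]] by blast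
qed

text \<open>An open set of tuples contains a product of open sets, so a point as in
  \<open>normal_space_gradients\<close> can be picked in each factor independently.\<close>

lemma k_NS_gradients:
  fixes G :: "('a::euclidean_space \<Rightarrow> 'a) set"
  assumes G: "orthogonal_subgroup G" and comp: "compact G" and NS: "k_NS TYPE('k::finite) G"
  shows "\<exists>x::'a ^ 'k. \<forall>v. \<exists>w. (\<forall>i. w i \<in> gradients (invariant_polynomials G) (x $ i)) \<and> v = (\<Sum>i\<in>UNIV. w i)"
proof -
  obtain U :: "('a ^ 'k) set" where U: "open U" "U \<noteq> {}"
    and span: "\<And>x. x \<in> U \<Longrightarrow> {\<Sum>i\<in>UNIV. w i | w. \<forall>i. w i \<in> normal_space (orbit G (x $ i)) (x $ i)} = UNIV"
    using NS unfolding k_NS_def by blast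
  obtain x0 where "x0 \<in> U" using U by blast
  from U(1)[unfolded open_vec_def, rule_format, OF this]
  obtain W where W0: "\<forall>i. open (W i) \<and> x0 $ i \<in> W i" "\<forall>y. (\<forall>i. y $ i \<in> W i) \<longrightarrow> y \<in> U"
    by blast
  then have W: "\<And>i. open (W i)" "\<And>i. x0 $ i \<in> W i" "\<And>y. (\<forall>i. y $ i \<in> W i) \<Longrightarrow> y \<in> U"
    by blast+
  have "\<forall>i. \<exists>y\<in>W i. normal_space (orbit G y) y \<subseteq> gradients (invariant_polynomials G) y"
    using normal_space_gradients[OF G comp W(1)] W(2) by blast
  then obtain y where y: "\<And>i. y i \<in> W i"
    "\<And>i. normal_space (orbit G (y i)) (y i) \<subseteq> gradients (invariant_polynomials G) (y i)" by metis
  define x :: "'a ^ 'k" where "x = (\<chi> i. y i)"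
  have "x \<in> U" by (rule W(3)) (simp add: x_def y)
  have "\<exists>w. (\<forall>i. w i \<in> gradients (invariant_polynomials G) (x $ i)) \<and> v = (\<Sum>i\<in>UNIV. w i)" for v
  proof -
    have "v \<in> {\<Sum>i\<in>UNIV. w i | w. \<forall>i. w i \<in> normal_space (orbit G (x $ i)) (x $ i)}"
      using span[OF \<open>x \<in> U\<close>] by simp
    then obtain w where "v = (\<Sum>i\<in>UNIV. w i)" "\<forall>i. w i \<in> normal_space (orbit G (x $ i)) (x $ i)" by blast
    moreover have "w i \<in> gradients (invariant_polynomials G) (x $ i)" for i
      using calculation(2) y(2)[of i] by (auto simp: x_def)
    ultimately show ?thesis by blast
  qed
  then show ?thesis by blast
qed

text \<open>\<open>S x\<close> is half the gradient of the form \<open>x \<bullet> S x\<close>.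
  Constancy is asked only along continuous curves in \<open>L\<close> through \<open>x\<close>,
  because for (a) the form may differ between components of an orbit.\<close>

lemma normal_spaceI_quadratic:
  fixes S :: "'a::euclidean_space \<Rightarrow> 'a"
  assumes S: "linear S" and sym: "\<And>u v. S u \<bullet> v = u \<bullet> S v"
    and const: "\<And>(\<gamma> :: real \<Rightarrow> 'a) \<epsilon> t. \<epsilon> > 0 \<Longrightarrow> continuous_on {-\<epsilon><..<\<epsilon>} \<gamma> \<Longrightarrow> \<gamma> ` {-\<epsilon><..<\<epsilon>} \<subseteq> L \<Longrightarrow> \<gamma> 0 = x \<Longrightarrow>
      t \<in> {-\<epsilon><..<\<epsilon>} \<Longrightarrow> \<gamma> t \<bullet> S (\<gamma> t) = x \<bullet> S x"
  shows "S x \<in> normal_space L x"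
proof -
  have "v \<bullet> S x = 0" if v: "v \<in> tangent_space L x" for v
  proof -
    obtain \<gamma> \<epsilon> where g: "\<epsilon> > 0" "\<gamma> C1_differentiable_on {-\<epsilon><..<\<epsilon>}" "\<gamma> ` {-\<epsilon><..<\<epsilon>} \<subseteq> L" "\<gamma> 0 = x"
      "(\<gamma> has_vector_derivative v) (at 0)" using v unfolding tangent_space_def by blast
    have cont: "continuous_on {-\<epsilon><..<\<epsilon>} \<gamma>"
      using g(2) C1_diff_imp_diff differentiable_imp_continuous_on by blast
    have bl: "bounded_linear S" using S by (simp add: linear_conv_bounded_linear)
    have d: "(\<gamma> has_derivative (\<lambda>h. h *\<^sub>R v)) (at 0)" using g(5) by (simp add: has_vector_derivative_def)
    have d1: "((\<lambda>t. \<gamma> t \<bullet> S (\<gamma> t)) has_derivative (\<lambda>h. \<gamma> 0 \<bullet> S (h *\<^sub>R v) + (h *\<^sub>R v) \<bullet> S (\<gamma> 0))) (at 0)"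
      by (rule has_derivative_inner[OF d bounded_linear.has_derivative[OF bl d]])
    have "eventually (\<lambda>t. t \<in> {-\<epsilon><..<\<epsilon>}) (nhds 0)"
      using g(1) by (intro eventually_nhds_in_open) auto
    then have ev: "eventually (\<lambda>t. \<gamma> t \<bullet> S (\<gamma> t) = x \<bullet> S x) (nhds 0)"
      by (rule eventually_mono) (rule const[OF g(1) cont g(3,4)])
    have d2: "((\<lambda>t. \<gamma> t \<bullet> S (\<gamma> t)) has_derivative (\<lambda>h. 0)) (at 0)"
    proof (rule has_derivative_transform_eventually)
      show "((\<lambda>t. x \<bullet> S x) has_derivative (\<lambda>h. 0)) (at 0)" by simp
      show "eventually (\<lambda>t. x \<bullet> S x = \<gamma> t \<bullet> S (\<gamma> t)) (at 0 within UNIV)"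
        using ev by (auto simp: eventually_at_filter elim!: eventually_mono)
      show "x \<bullet> S x = \<gamma> 0 \<bullet> S (\<gamma> 0)" by (simp add: g(4))
    qed simp
    have "\<gamma> 0 \<bullet> S (1 *\<^sub>R v) + (1 *\<^sub>R v) \<bullet> S (\<gamma> 0) = 0"
      using fun_cong[OF has_derivative_unique[OF d1 d2], of 1] .
    then have "x \<bullet> S v + v \<bullet> S x = 0" by (simp add: g(4))
    then show ?thesis using sym[of x v] by (simp add: inner_commute)
  qed
  then show ?thesis unfolding normal_space_def orthogonal_comp_def orthogonal_def by blast
qed

text \<open>Although \<open>N x\<close> may vary irregularly, a spanning set at \<open>x0\<close>
  that extends to continuous sections stays spanning nearby, by the Gram criterion.\<close>

lemma spanning_open:
  fixes N :: "'w::topological_space \<Rightarrow> 'a::euclidean_space set"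
  assumes N: "\<And>x. subspace (N x)"
    and X: "\<And>v. v \<in> X \<Longrightarrow> \<exists>m. continuous_on UNIV m \<and> (\<forall>x. m x \<in> N x) \<and> m x0 = v" and span: "span X = UNIV"
  shows "\<exists>U. open U \<and> x0 \<in> U \<and> (\<forall>x\<in>U. N x = UNIV)"
proof -
  define Y where "Y = {v. \<exists>m. continuous_on UNIV m \<and> (\<forall>x. m x \<in> N x) \<and> m x0 = v}"
  have "subspace Y"
    unfolding subspace_def
  proof (intro conjI ballI allI)
    show "0 \<in> Y" using subspace_0[OF N] by (auto simp: Y_def intro!: exI[of _ "\<lambda>x. 0"])
    show "u + v \<in> Y" if uv: "u \<in> Y" "v \<in> Y" for u v
    proof -
      obtain m where m: "continuous_on UNIV m" "\<forall>x. m x \<in> N x" "m x0 = u" using uv(1) by (auto simp: Y_def)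
      obtain n where n: "continuous_on UNIV n" "\<forall>x. n x \<in> N x" "n x0 = v" using uv(2) by (auto simp: Y_def)
      have "continuous_on UNIV (\<lambda>x. m x + n x)" using m n by (intro continuous_intros)
      then show ?thesis unfolding Y_def using m n subspace_add[OF N] by (intro CollectI exI[of _ "\<lambda>x. m x + n x"]) auto
    qed
    show "c *\<^sub>R u \<in> Y" if u: "u \<in> Y" for c u
    proof -
      obtain m where m: "continuous_on UNIV m" "\<forall>x. m x \<in> N x" "m x0 = u" using u by (auto simp: Y_def)
      have "continuous_on UNIV (\<lambda>x. c *\<^sub>R m x)" using m by (intro continuous_intros)
      then show ?thesis unfolding Y_def using m subspace_scale[OF N] by (intro CollectI exI[of _ "\<lambda>x. c *\<^sub>R m x"]) auto
    qed
  qed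
  moreover have "X \<subseteq> Y" using X by (auto simp: Y_def)
  ultimately have "Y = UNIV" using span span_minimal by blast
  then have "\<forall>b. \<exists>m. continuous_on UNIV m \<and> (\<forall>x. m x \<in> N x) \<and> m x0 = b" by (auto simp: Y_def)
  then obtain m where m: "\<And>b. continuous_on UNIV (m b)" "\<And>b x. m b x \<in> N x" "\<And>b. m b x0 = b" by metis
  define q where "q x = (\<Sum>b\<in>Basis. \<Sum>c\<in>Basis. (m b x \<bullet> m c x - b \<bullet> c)\<^sup>2)" for x
  have cq: "continuous_on UNIV q" unfolding q_def[abs_def] by (intro continuous_intros m)
  have "N x = UNIV" if q1: "q x < 1" for x
  proof -
    have "bij (\<lambda>v. \<Sum>b\<in>Basis. (v \<bullet> b) *\<^sub>R m b x)" using gram_bijective[of "\<lambda>b. m b x"] q1 by (simp add: q_def)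
    then have "surj (\<lambda>v. \<Sum>b\<in>Basis. (v \<bullet> b) *\<^sub>R m b x)" by (rule bij_is_surj)
    moreover have "(\<Sum>b\<in>Basis. (u \<bullet> b) *\<^sub>R m b x) \<in> N x" for u
      by (intro subspace_sum[OF N] subspace_scale[OF N] m)
    ultimately have "v \<in> N x" for v
    proof -
      obtain u where "v = (\<Sum>b\<in>Basis. (u \<bullet> b) *\<^sub>R m b x)"
        using surjD[OF \<open>surj _\<close>, of v] by blast
      then show ?thesis using \<open>(\<Sum>b\<in>Basis. (u \<bullet> b) *\<^sub>R m b x) \<in> N x\<close> by simp
    qed
    then show ?thesis by auto
  qed
  moreover have "open {x. q x < 1}" by (intro open_Collect_less cq continuous_on_const)
  moreover have "q x0 < 1" by (simp add: q_def m)
  ultimately show ?thesis by (intro exI[of _ "{x. q x < 1}"]) auto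
qed

text \<open>A linear \<open>S\<close> with \<open>S y\<close> normal at every \<open>y\<close> is a
  continuous section of normal vectors, so spanning has to be checked at the single tuple
  \<open>x0\<close> only.\<close>

lemma k_NSI:
  fixes G :: "('a::euclidean_space \<Rightarrow> 'a) set" and x0 :: "'a ^ 'k::finite"
  assumes X: "\<And>v. v \<in> X \<Longrightarrow> \<exists>i S. linear S \<and> v = S (x0 $ i) \<and> (\<forall>y. S y \<in> normal_space (orbit G y) y)"
    and span: "span X = UNIV"
  shows "k_NS TYPE('k) G"
proof -
  define N where "N x = {\<Sum>i\<in>UNIV. w i | w. \<forall>i. w i \<in> normal_space (orbit G (x $ i)) (x $ i)}" for x :: "'a ^ 'k"
  have sub: "subspace (normal_space L y)" for L and y :: 'a
    unfolding normal_space_def by (rule subspace_orthogonal_comp)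
  have N: "subspace (N x)" for x
    unfolding subspace_def
  proof (intro conjI ballI allI)
    show "0 \<in> N x" unfolding N_def using subspace_0[OF sub] by (intro CollectI exI[of _ "\<lambda>i. 0"]) simp
    show "u + v \<in> N x" if uv: "u \<in> N x" "v \<in> N x" for u v
    proof -
      obtain a where a: "u = (\<Sum>i\<in>UNIV. a i)" "\<forall>i. a i \<in> normal_space (orbit G (x $ i)) (x $ i)" using uv(1) by (auto simp: N_def)
      obtain b where b: "v = (\<Sum>i\<in>UNIV. b i)" "\<forall>i. b i \<in> normal_space (orbit G (x $ i)) (x $ i)" using uv(2) by (auto simp: N_def)
      show ?thesis unfolding N_def using a b subspace_add[OF sub]
        by (intro CollectI exI[of _ "\<lambda>i. a i + b i"]) (simp add: sum.distrib)
    qed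
    show "c *\<^sub>R u \<in> N x" if u: "u \<in> N x" for c u
    proof -
      obtain a where a: "u = (\<Sum>i\<in>UNIV. a i)" "\<forall>i. a i \<in> normal_space (orbit G (x $ i)) (x $ i)" using u by (auto simp: N_def)
      show ?thesis unfolding N_def using a subspace_scale[OF sub]
        by (intro CollectI exI[of _ "\<lambda>i. c *\<^sub>R a i"]) (simp add: scaleR_sum_right)
    qed
  qed
  have "\<exists>U. open U \<and> x0 \<in> U \<and> (\<forall>x\<in>U. N x = UNIV)"
  proof (rule spanning_open[OF N _ span])
    fix v assume "v \<in> X"
    then obtain i S where S: "linear S" "v = S (x0 $ i)" "\<And>y. S y \<in> normal_space (orbit G y) y" using X by meson
    have "bounded_linear (\<lambda>x::'a ^ 'k. S (x $ i))"
      using bounded_linear_compose[OF _ bounded_linear_vec_nth] S(1) by (simp add: linear_conv_bounded_linear)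
    then have "continuous_on UNIV (\<lambda>x::'a ^ 'k. S (x $ i))" by (rule linear_continuous_on)
    moreover have "S (x $ i) \<in> N x" for x
    proof -
      have "S (x $ i) = (\<Sum>j\<in>UNIV. if j = i then S (x $ i) else 0)" by simp
      then show ?thesis
        unfolding N_def using S(3) subspace_0[OF sub] by (intro CollectI exI[of _ "\<lambda>j. if j = i then S (x $ i) else 0"]) auto
    qed
    ultimately show "\<exists>m. continuous_on UNIV m \<and> (\<forall>x. m x \<in> N x) \<and> m x0 = v"
      using S(2) by (intro exI[of _ "\<lambda>x. S (x $ i)"]) auto
  qed
  then show ?thesis unfolding k_NS_def N_def by blast
qed

lemma k_NS_large:
  fixes G :: "('a::euclidean_space \<Rightarrow> 'a) set"
  assumes G: "orthogonal_subgroup G" and k: "CARD('k::finite) \<ge> DIM('a)"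
  shows "k_NS TYPE('k) G"
proof -
  obtain f :: "'a \<Rightarrow> 'k" where f: "inj_on f Basis"
    using card_le_inj[of "Basis :: 'a set" "UNIV :: 'k set"] k by auto
  \<comment> \<open>Basis vectors are placed at the indices given by \<open>f\<close>; entries at
    other indices are unspecified.\<close>
  define x0 :: "'a ^ 'k" where "x0 = (\<chi> i. inv_into Basis f i)"
  show ?thesis
  proof (rule k_NSI[of Basis x0])
    fix b :: 'a assume b: "b \<in> Basis"
    have "b = id (x0 $ f b)" using f b by (simp add: x0_def)
    moreover have "id y \<in> normal_space (orbit G y) y" for y :: 'a
    proof (rule normal_spaceI_quadratic)
      fix \<gamma> :: "real \<Rightarrow> 'a" and \<epsilon> t
      assume "\<gamma> ` {-\<epsilon><..<\<epsilon>} \<subseteq> orbit G y" "t \<in> {-\<epsilon><..<\<epsilon>}"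
      then have "\<gamma> t \<in> orbit G y" by blast
      then obtain g where "g \<in> G" "\<gamma> t = g y" by (auto simp: orbit_def)
      then show "\<gamma> t \<bullet> id (\<gamma> t) = y \<bullet> id y"
        using group_orthogonal[OF G] by (simp add: orthogonal_transformation_def)
    qed (auto intro: linear_id[unfolded id_def] simp: linear_iff)
    ultimately show "\<exists>i S. linear S \<and> b = S (x0 $ i) \<and> (\<forall>y. S y \<in> normal_space (orbit G y) y)"
      using linear_id by blast
  qed (rule span_Basis)
qed

subsection \<open>Commuting orthogonal transformations\<close>

text \<open>A maximizer \<open>u\<close> of \<open>u \<bullet> S u\<close> on the unit sphere of
  \<open>C\<close> is an eigenvector: \<open>Q\<close> is nonnegative on \<open>C\<close> and zero
  at \<open>u\<close>, so its first variation along \<open>w\<close>, which is twice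
  \<open>w \<bullet> w\<close>, must vanish.\<close>

lemma self_adjoint_eigenvector:
  fixes S :: "'a::euclidean_space \<Rightarrow> 'a"
  assumes S: "linear S" and sym: "\<And>u v. S u \<bullet> v = u \<bullet> S v"
    and C: "subspace C" "C \<noteq> {0}" and inv: "\<And>v. v \<in> C \<Longrightarrow> S v \<in> C"
  shows "\<exists>u\<in>C. u \<noteq> 0 \<and> (\<exists>\<mu>. S u = \<mu> *\<^sub>R u)"
proof -
  obtain c where c: "c \<in> C" "c \<noteq> 0" using C subspace_0 by blast
  have "compact (C \<inter> sphere 0 1)"
    using closed_subspace[OF C(1)] compact_sphere by (rule closed_Int_compact)
  moreover have "(1 / norm c) *\<^sub>R c \<in> C \<inter> sphere 0 1"
    using c subspace_scale[OF C(1)] by simp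
  then have "C \<inter> sphere 0 1 \<noteq> {}" by blast
  moreover have "continuous_on (C \<inter> sphere 0 1) (\<lambda>u. u \<bullet> S u)"
    using linear_continuous_on[of S] S by (intro continuous_intros) (simp add: linear_conv_bounded_linear)
  ultimately obtain u where uC: "u \<in> C \<inter> sphere 0 1"
    and max': "\<forall>v\<in>C \<inter> sphere 0 1. v \<bullet> S v \<le> u \<bullet> S u"
    using continuous_attains_sup[of "C \<inter> sphere 0 1" "\<lambda>u. u \<bullet> S u"] by blast
  have u: "u \<in> C" "norm u = 1" using uC by auto
  have max: "v \<bullet> S v \<le> u \<bullet> S u" if "v \<in> C" "norm v = 1" for v using max' that by simp
  define \<mu> where "\<mu> = u \<bullet> S u"
  define Q where "Q v = \<mu> * (v \<bullet> v) - v \<bullet> S v" for v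
  have Q: "Q v \<ge> 0" if v: "v \<in> C" for v
  proof (cases "v = 0")
    case False
    define n where "n = norm v"
    have n: "n > 0" using False by (simp add: n_def)
    have "((1 / n) *\<^sub>R v) \<bullet> S ((1 / n) *\<^sub>R v) \<le> \<mu>"
      unfolding \<mu>_def using max[of "(1 / n) *\<^sub>R v"] subspace_scale[OF C(1) v] False by (simp add: n_def)
    then have "(v \<bullet> S v) / n\<^sup>2 \<le> \<mu>"
      by (simp add: linear_cmul[OF S] power2_eq_square)
    then have "v \<bullet> S v \<le> \<mu> * n\<^sup>2" using n by (simp add: divide_le_eq)
    then show ?thesis by (simp add: Q_def n_def dot_square_norm)
  qed (simp add: Q_def)
  define w where "w = \<mu> *\<^sub>R u - S u"
  have w: "w \<in> C" unfolding w_def by (intro subspace_diff[OF C(1)] subspace_scale[OF C(1)] u inv)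
  have Qt: "Q (u + t *\<^sub>R w) = 2 * t * (w \<bullet> w) + t\<^sup>2 * Q w" for t
  proof -
    have uu: "u \<bullet> u = 1" using u(2) by (simp add: norm_eq_1)
    have "u \<bullet> S w = S u \<bullet> w" using sym by simp
    then show ?thesis
      by (simp add: Q_def linear_add[OF S] linear_cmul[OF S] inner_add_left inner_add_right uu \<mu>_def[symmetric]
          power2_eq_square algebra_simps inner_commute)
        (simp add: w_def inner_diff_left inner_diff_right algebra_simps inner_commute)
  qed
  have "w \<bullet> w = 0"
  proof (rule ccontr)
    assume ne: "w \<bullet> w \<noteq> 0"
    \<comment> \<open>The minimum of the quadratic in \<open>t\<close> would be at
      \<open>- a / b\<close>; the denominator \<open>b + 1\<close> also covers \<open>b = 0\<close>
      and still gives a negative value.\<close>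
    define a b t where "a = w \<bullet> w" and "b = Q w" and "t = - a / (b + 1)"
    have b: "b \<ge> 0" unfolding b_def by (rule Q[OF w])
    have "0 \<le> Q (u + t *\<^sub>R w)" by (intro Q subspace_add[OF C(1)] subspace_scale[OF C(1)] u w)
    also have "\<dots> = 2 * t * a + t\<^sup>2 * b" by (simp add: Qt a_def b_def)
    also have "\<dots> = a\<^sup>2 * (- b - 2) / (b + 1)\<^sup>2"
    proof -
      define c where "c = b + 1"
      have c: "c \<noteq> 0" using b by (simp add: c_def)
      have "2 * t * a + t\<^sup>2 * b = a\<^sup>2 * (b - 2 * c) / c\<^sup>2"
        using c unfolding t_def c_def[symmetric] by (simp add: field_simps power2_eq_square)
      then show ?thesis by (simp add: c_def)
    qed
    finally have "0 \<le> a\<^sup>2 * (- b - 2) / (b + 1)\<^sup>2" .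
    moreover have "a\<^sup>2 * (- b - 2) / (b + 1)\<^sup>2 < 0"
      using ne b by (intro divide_neg_pos mult_pos_neg) (auto simp: a_def)
    ultimately show False by simp
  qed
  then have "S u = \<mu> *\<^sub>R u" by (simp add: w_def)
  moreover have "u \<noteq> 0" using u(2) by auto
  ultimately show ?thesis using u(1) by blast
qed

text \<open>Closed under inverses so that the adjoint of each member is again a member.\<close>

definition commuting_isometries :: "('a::euclidean_space \<Rightarrow> 'a) set \<Rightarrow> bool" where
  "commuting_isometries \<T> \<longleftrightarrow> (\<forall>g\<in>\<T>. orthogonal_transformation g) \<and>
     (\<forall>g\<in>\<T>. \<forall>h\<in>\<T>. \<forall>x. g (h x) = h (g x)) \<and> (\<forall>g\<in>\<T>. inv g \<in> \<T>)"

text \<open>These operators correspond to the \<T>-invariant quadratic forms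
  \<open>v \<bullet> S v\<close>, whose gradients will supply normal vectors.\<close>

definition commutant :: "('a::euclidean_space \<Rightarrow> 'a) set \<Rightarrow> ('a \<Rightarrow> 'a) set" where
  "commutant \<T> = {S. linear S \<and> (\<forall>u v. S u \<bullet> v = u \<bullet> S v) \<and> (\<forall>g\<in>\<T>. \<forall>x. S (g x) = g (S x))}"

definition invariant_subspace :: "('a::euclidean_space \<Rightarrow> 'a) set \<Rightarrow> 'a set \<Rightarrow> bool" where
  "invariant_subspace \<T> C \<longleftrightarrow> subspace C \<and> (\<forall>g\<in>\<T>. \<forall>v\<in>C. g v \<in> C)"

context
  fixes \<T> :: "('a::euclidean_space \<Rightarrow> 'a) set"
  assumes commuting: "commuting_isometries \<T>"
begin

lemma isometry_orthogonal: "g \<in> \<T> \<Longrightarrow> orthogonal_transformation g"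
  and isometry_commute: "g \<in> \<T> \<Longrightarrow> h \<in> \<T> \<Longrightarrow> g (h x) = h (g x)"
  and isometry_inv: "g \<in> \<T> \<Longrightarrow> inv g \<in> \<T>"
  using commuting unfolding commuting_isometries_def by blast+

lemma isometry_linear: "g \<in> \<T> \<Longrightarrow> linear g"
  using isometry_orthogonal by (simp add: orthogonal_transformation_def)

lemma isometry_inv_apply: "g \<in> \<T> \<Longrightarrow> g (inv g x) = x" "g \<in> \<T> \<Longrightarrow> inv g (g x) = x"
  using orthogonal_transformation_bij[OF isometry_orthogonal, of g] by (auto simp: bij_def surj_f_inv_f)

lemma isometry_inv_inv: "g \<in> \<T> \<Longrightarrow> inv (inv g) = g"
  by (rule inv_inv_eq[OF orthogonal_transformation_bij[OF isometry_orthogonal]])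

lemma isometry_adjoint:
  assumes "g \<in> \<T>"
  shows "g u \<bullet> v = u \<bullet> inv g v"
proof -
  have "g u \<bullet> g (inv g v) = u \<bullet> inv g v"
    using isometry_orthogonal[OF assms] by (simp add: orthogonal_transformation_def)
  then show ?thesis by (simp add: isometry_inv_apply[OF assms])
qed

text \<open>Schur's lemma: an eigenspace of \<open>S\<close> in \<open>C\<close> is invariant
  because \<open>S\<close> commutes with \<T>, so by minimality it is all of
  \<open>C\<close>.\<close>

lemma minimal_scalar:
  assumes C: "invariant_subspace \<T> C" "C \<noteq> {0}"
    and min: "\<And>C'. invariant_subspace \<T> C' \<Longrightarrow> C' \<noteq> {0} \<Longrightarrow> C' \<subseteq> C \<Longrightarrow> dim C \<le> dim C'"
    and S: "S \<in> commutant \<T>" and SC: "\<And>v. v \<in> C \<Longrightarrow> S v \<in> C"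
  shows "\<exists>\<mu>. \<forall>v\<in>C. S v = \<mu> *\<^sub>R v"
proof -
  have lin: "linear S" and sym: "\<And>u v. S u \<bullet> v = u \<bullet> S v" and com: "\<And>g x. g \<in> \<T> \<Longrightarrow> S (g x) = g (S x)"
    using S by (auto simp: commutant_def)
  have sub: "subspace C" using C by (simp add: invariant_subspace_def)
  obtain u \<mu> where u: "u \<in> C" "u \<noteq> 0" "S u = \<mu> *\<^sub>R u"
    using self_adjoint_eigenvector[OF lin sym sub C(2) SC] by blast
  define C' where "C' = {v \<in> C. S v = \<mu> *\<^sub>R v}"
  have inv': "invariant_subspace \<T> C'"
    unfolding invariant_subspace_def subspace_def
  proof (intro conjI ballI allI)
    show "0 \<in> C'" using subspace_0[OF sub] linear_0[OF lin] by (simp add: C'_def)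
    show "x + y \<in> C'" if "x \<in> C'" "y \<in> C'" for x y
      using that subspace_add[OF sub] by (simp add: C'_def linear_add[OF lin] scaleR_add_right)
    show "c *\<^sub>R x \<in> C'" if "x \<in> C'" for c x
      using that subspace_scale[OF sub] by (simp add: C'_def linear_cmul[OF lin])
    show "g v \<in> C'" if "g \<in> \<T>" "v \<in> C'" for g v
      using that C(1) by (simp add: C'_def com invariant_subspace_def linear_cmul[OF isometry_linear])
  qed
  have "C' \<noteq> {0}" using u by (auto simp: C'_def)
  then have "dim C \<le> dim C'" using min[OF inv'] by (auto simp: C'_def)
  moreover have "subspace C'" using inv' by (simp add: invariant_subspace_def)
  ultimately have "C' = C" using subspace_dim_equal[OF _ sub] by (auto simp: C'_def)
  then show ?thesis by (auto simp: C'_def)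
qed

text \<open>On a minimal invariant subspace the self-adjoint operators \<open>g + g\<^sup>-\<^sup>1\<close> and
  \<open>(g - g\<^sup>-\<^sup>1) (h - h\<^sup>-\<^sup>1)\<close> are scalars, hence all \<open>h - h\<^sup>-\<^sup>1\<close> are multiples of a single one.\<close>

lemma two_dimensional_invariant:
  assumes V: "invariant_subspace \<T> V" "V \<noteq> {0}"
  shows "\<exists>C u w. invariant_subspace \<T> C \<and> C \<noteq> {0} \<and> C \<subseteq> V \<and> C = span {u, w}"
proof -
  obtain C where C: "invariant_subspace \<T> C" "C \<noteq> {0}" "C \<subseteq> V"
    and min0: "\<And>C'. invariant_subspace \<T> C' \<and> C' \<noteq> {0} \<and> C' \<subseteq> V \<Longrightarrow> dim C \<le> dim C'"
    using ex_has_least_nat[of "\<lambda>C. invariant_subspace \<T> C \<and> C \<noteq> {0} \<and> C \<subseteq> V" V dim] V by blast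
  have min: "dim C \<le> dim C'" if "invariant_subspace \<T> C'" "C' \<noteq> {0}" "C' \<subseteq> C" for C'
    using min0 that C(3) by blast
  have eqC: "C' = C" if "invariant_subspace \<T> C'" "C' \<noteq> {0}" "C' \<subseteq> C" for C'
    using min[OF that] that C(1) subspace_dim_equal[of C' C] by (auto simp: invariant_subspace_def)
  have sub: "subspace C" and gC: "\<And>g v. g \<in> \<T> \<Longrightarrow> v \<in> C \<Longrightarrow> g v \<in> C" using C(1) by (auto simp: invariant_subspace_def)
  define P where "P g v = g v + inv g v" for g :: "'a \<Rightarrow> 'a" and v
  define J where "J g v = g v - inv g v" for g :: "'a \<Rightarrow> 'a" and v
  have linP: "linear (P g)" and linJ: "linear (J g)" if g: "g \<in> \<T>" for g
    unfolding P_def[abs_def] J_def[abs_def]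
    by (intro linear_compose_add linear_compose_sub isometry_linear isometry_inv g)+
  have PC: "P g v \<in> C" if "g \<in> \<T>" "v \<in> C" for g v
    unfolding P_def by (rule subspace_add[OF sub gC[OF that] gC[OF isometry_inv[OF that(1)] that(2)]])
  have JC: "J g v \<in> C" if "g \<in> \<T>" "v \<in> C" for g v
    unfolding J_def by (rule subspace_diff[OF sub gC[OF that] gC[OF isometry_inv[OF that(1)] that(2)]])
  have adj': "inv g u \<bullet> v = u \<bullet> g v" if "g \<in> \<T>" for g u v
    using isometry_adjoint[OF that, of v u] by (simp add: inner_commute)
  have Jadj: "J g u \<bullet> v = - (u \<bullet> J g v)" if "g \<in> \<T>" for g u v
    using that by (simp add: J_def inner_diff_left inner_diff_right isometry_adjoint adj')
  have Jcom: "J g (h x) = h (J g x)" if "g \<in> \<T>" "h \<in> \<T>" for g h x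
    using that by (simp add: J_def isometry_commute isometry_inv linear_diff[OF isometry_linear])
  have JJ: "J g (J h x) = J h (J g x)" if g: "g \<in> \<T>" and h: "h \<in> \<T>" for g h x
    unfolding J_def[of h] using g h by (simp add: linear_diff[OF linJ[OF g]] Jcom isometry_inv)
  have Pcom: "P g \<in> commutant \<T>" if g: "g \<in> \<T>" for g
    using linP[OF g] g unfolding commutant_def
    by (auto simp: P_def inner_add_left inner_add_right isometry_adjoint isometry_inv_inv isometry_inv isometry_commute linear_add[OF isometry_linear] add.commute)
  have "\<exists>c. \<forall>v\<in>C. P g v = c *\<^sub>R v" if g: "g \<in> \<T>" for g
    by (rule minimal_scalar[OF C(1,2) min Pcom[OF g] PC[OF g]])
  then obtain c where c: "\<And>g v. g \<in> \<T> \<Longrightarrow> v \<in> C \<Longrightarrow> P g v = c g *\<^sub>R v" by metis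
  have dec: "g v = (1/2) *\<^sub>R (c g *\<^sub>R v + J g v)" if "g \<in> \<T>" "v \<in> C" for g v
  proof -
    have "P g v + J g v = 2 *\<^sub>R g v" by (simp add: P_def J_def scaleR_2)
    then show ?thesis using c[OF that] by simp
  qed
  \<comment> \<open>The operators \<open>J g\<close> are skew and commute, hence their products are
    self-adjoint.\<close>
  have JJc: "\<exists>\<mu>. \<forall>v\<in>C. J g (J h v) = \<mu> *\<^sub>R v" if g: "g \<in> \<T>" and h: "h \<in> \<T>" for g h
  proof -
    have "(\<lambda>v. J g (J h v)) \<in> commutant \<T>"
      unfolding commutant_def
    proof (intro CollectI conjI allI ballI)
      show "linear (\<lambda>v. J g (J h v))" using linear_compose[OF linJ[OF h] linJ[OF g]] by (simp add: o_def)
      show "J g (J h u) \<bullet> v = u \<bullet> J g (J h v)" for u v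
        using g h by (simp add: Jadj JJ[OF g h, of v])
      show "J g (J h (k x)) = k (J g (J h x))" if "k \<in> \<T>" for k x
        using that g h by (simp add: Jcom)
    qed
    from minimal_scalar[OF C(1,2) min this JC[OF g JC[OF h]]] show ?thesis by blast
  qed
  obtain u where u: "u \<in> C" "u \<noteq> 0" using C(2) sub subspace_0 by blast
  show ?thesis
  proof (cases "\<forall>g\<in>\<T>. \<forall>v\<in>C. J g v = 0")
    case True
    have "g (t *\<^sub>R u) = (c g / 2) *\<^sub>R (t *\<^sub>R u)" if "g \<in> \<T>" for g t
      using dec[OF that u(1)] True that u(1) by (simp add: linear_cmul[OF isometry_linear] mult.commute)
    then have "g v \<in> span {u}" if "g \<in> \<T>" "v \<in> span {u}" for g v
      using that by (force simp: span_singleton)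
    then have "invariant_subspace \<T> (span {u})" by (simp add: invariant_subspace_def)
    moreover have "span {u} \<noteq> {0}" using u(2) span_base[of u "{u}"] by fastforce
    moreover have "span {u} \<subseteq> C" using u(1) sub by (simp add: span_minimal)
    ultimately have "span {u} = C" by (rule eqC)
    then show ?thesis using C by (intro exI[of _ C] exI[of _ u]) auto
  next
    case False
    then obtain g v0 where g: "g \<in> \<T>" "v0 \<in> C" "J g v0 \<noteq> 0" by blast
    obtain \<kappa> where \<kappa>: "\<And>v. v \<in> C \<Longrightarrow> J g (J g v) = \<kappa> *\<^sub>R v" using JJc[OF g(1) g(1)] by blast
    \<comment> \<open>By skewness the squared norm of \<open>J g v0\<close> is
      \<open>- \<kappa> * (v0 \<bullet> v0)\<close>.\<close>
    have \<kappa>0: "\<kappa> \<noteq> 0"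
    proof
      assume "\<kappa> = 0"
      then have "J g v0 \<bullet> J g v0 = 0" using Jadj[OF g(1), of v0 "J g v0"] \<kappa>[OF g(2)] by simp
      then show False using g(3) by simp
    qed
    define w where "w = J g u"
    have w: "w \<in> C" unfolding w_def by (rule JC[OF g(1) u(1)])
    have step: "h x \<in> span {u, w}" if h: "h \<in> \<T>" and x: "x \<in> {u, w}" for h x
    proof -
      obtain l where l: "\<And>v. v \<in> C \<Longrightarrow> J h (J g v) = l *\<^sub>R v" using JJc[OF h g(1)] by blast
      \<comment> \<open>On \<open>C\<close> the inverse of \<open>J g\<close> is \<open>J g\<close>
        divided by \<kappa>, so \<open>J h\<close> can be recovered from the scalar operator that
        \<open>J h\<close> forms with \<open>J g\<close>.\<close>
      have Jh: "J h v = (l / \<kappa>) *\<^sub>R J g v" if v: "v \<in> C" for v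
      proof -
        have "\<kappa> *\<^sub>R J h v = J h (J g (J g v))"
          by (simp add: \<kappa>[OF v] linear_cmul[OF linJ[OF h]])
        also have "\<dots> = l *\<^sub>R J g v" by (rule l[OF JC[OF g(1) v]])
        finally have "J h v = inverse \<kappa> *\<^sub>R (l *\<^sub>R J g v)" using \<kappa>0 by (metis scaleR_left_imp_eq
          divideR_right inverse_eq_divide real_vector_affinity_eq right_inverse scaleR_one scaleR_scaleR)
        then show ?thesis by (simp add: divide_inverse mult.commute)
      qed
      have "h x = (1/2) *\<^sub>R (c h *\<^sub>R x + (l / \<kappa>) *\<^sub>R J g x)" "x \<in> C"
        using dec[OF h, of x] Jh[of x] x u(1) w by auto
      moreover have "J g x \<in> span {u, w}" "x \<in> span {u, w}"
      proof -
        have "J g w = \<kappa> *\<^sub>R u" unfolding w_def by (rule \<kappa>[OF u(1)])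
        moreover have "\<kappa> *\<^sub>R u \<in> span {u, w}" "w \<in> span {u, w}" by (intro span_scale span_base; simp)+
        ultimately show "J g x \<in> span {u, w}" using x by (auto simp: w_def[symmetric])
        show "x \<in> span {u, w}" using x by (auto intro: span_base)
      qed
      ultimately show ?thesis by (simp add: span_add span_scale)
    qed
    have "h v \<in> span {u, w}" if h: "h \<in> \<T>" and v: "v \<in> span {u, w}" for h v
    proof -
      have "h v \<in> h ` span {u, w}" using v by blast
      also have "\<dots> = span (h ` {u, w})" by (rule linear_span_image[OF isometry_linear[OF h], symmetric])
      also have "\<dots> \<subseteq> span {u, w}" by (rule span_minimal) (use step[OF h] in auto)
      finally show ?thesis .
    qed
    then have "invariant_subspace \<T> (span {u, w})" by (simp add: invariant_subspace_def)
    moreover have "span {u, w} \<noteq> {0}" using u(2) span_base[of u "{u, w}"] by auto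
    moreover have "span {u, w} \<subseteq> C" using u(1) w sub by (simp add: span_minimal)
    ultimately have "span {u, w} = C" by (rule eqC)
    then show ?thesis using C by (intro exI[of _ C] exI[of _ u] exI[of _ w]) auto
  qed
qed

text \<open>Split off an invariant \<open>C\<close> spanned by two vectors and add one of them to
  each point found for the complement. The projection \<pi> onto \<open>C\<close> belongs to the
  commutant and recovers \<open>u\<close> and \<open>w\<close>; this is why two points are enough in
  all dimensions.\<close>

lemma commutant_spans:
  assumes "invariant_subspace \<T> V"
  shows "\<exists>p\<in>V. \<exists>q\<in>V. V \<subseteq> span ((\<lambda>S. S p) ` commutant \<T> \<union> (\<lambda>S. S q) ` commutant \<T>)"
  using assms
proof (induction "dim V" arbitrary: V rule: less_induct)
  case less
  have subV: "subspace V" and gV: "\<And>g v. g \<in> \<T> \<Longrightarrow> v \<in> V \<Longrightarrow> g v \<in> V"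
    using less.prems by (auto simp: invariant_subspace_def)
  show ?case
  proof (cases "V = {0}")
    case True
    then show ?thesis using span_0 by auto
  next
    case False
    obtain C u w where C: "invariant_subspace \<T> C" "C \<noteq> {0}" "C \<subseteq> V" and Cuw: "C = span {u, w}"
      using two_dimensional_invariant[OF less.prems False] by blast
    have sub: "subspace C" and gC: "\<And>g v. g \<in> \<T> \<Longrightarrow> v \<in> C \<Longrightarrow> g v \<in> C" using C(1) by (auto simp: invariant_subspace_def)
    have uw: "u \<in> C" "w \<in> C" unfolding Cuw by (simp_all add: span_base)
    obtain E where E: "E \<subseteq> C" "pairwise orthogonal E" "\<And>e. e \<in> E \<Longrightarrow> norm e = 1"
      "independent E" "card E = dim C" "span E = C"
      by (rule orthonormal_basis_subspace[OF sub]) (rule that)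
    have fE: "finite E" using E(4) by (rule independent_imp_finite)
    define \<pi> where "\<pi> v = (\<Sum>e\<in>E. (v \<bullet> e) *\<^sub>R e)" for v
    have lin\<pi>: "linear \<pi>"
    proof (rule linearI)
      show "\<pi> (x + y) = \<pi> x + \<pi> y" for x y by (simp add: \<pi>_def inner_add_left scaleR_add_left sum.distrib)
      show "\<pi> (r *\<^sub>R x) = r *\<^sub>R \<pi> x" for r x by (simp add: \<pi>_def scaleR_sum_right)
    qed
    have \<pi>C: "\<pi> v \<in> C" for v unfolding \<pi>_def using E(1) by (intro subspace_sum[OF sub] subspace_scale[OF sub]) auto
    have sym\<pi>: "\<pi> x \<bullet> y = x \<bullet> \<pi> y" for x y
      by (simp add: \<pi>_def inner_sum_left inner_sum_right mult.commute inner_commute[of y])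
    have perp: "(v - \<pi> v) \<bullet> c = 0" if c: "c \<in> C" for v c
    proof -
      have "(v - \<pi> v) \<bullet> e = 0" if e: "e \<in> E" for e
      proof -
        have "\<pi> v \<bullet> e = (\<Sum>e'\<in>E. if e' = e then v \<bullet> e else 0)"
          unfolding \<pi>_def inner_sum_left
          by (rule sum.cong) (use E(2,3) e in \<open>auto simp: pairwise_def orthogonal_def norm_eq_1\<close>)
        then show ?thesis using fE e by (simp add: inner_diff_left)
      qed
      note perpE = this
      have "c \<in> span E" using c E(6) by simp
      then show ?thesis
        by (induction rule: span_induct) (auto simp: subspace_def inner_add_right perpE)
    qed
    have \<pi>id: "\<pi> c = c" if c: "c \<in> C" for c
    proof -
      have "c - \<pi> c \<in> C" by (intro subspace_diff[OF sub] c \<pi>C)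
      from perp[OF this, of c] show ?thesis by simp
    qed
    have \<pi>0: "\<pi> v = 0" if "\<And>c. c \<in> C \<Longrightarrow> v \<bullet> c = 0" for v
      unfolding \<pi>_def using that E(1) by (intro sum.neutral) auto
    have com\<pi>: "\<pi> (g v) = g (\<pi> v)" if g: "g \<in> \<T>" for g v
    proof -
      have "g v = g (\<pi> v) + g (v - \<pi> v)" by (simp add: linear_diff[OF isometry_linear[OF g]])
      moreover have "\<pi> (g (v - \<pi> v)) = 0"
        by (rule \<pi>0) (simp add: isometry_adjoint[OF g] perp gC isometry_inv g)
      moreover have "\<pi> (g (\<pi> v)) = g (\<pi> v)" by (rule \<pi>id[OF gC[OF g \<pi>C]])
      ultimately show ?thesis by (simp add: linear_add[OF lin\<pi>])
    qed
    have \<pi>S: "\<pi> \<in> commutant \<T>" using lin\<pi> sym\<pi> com\<pi> by (simp add: commutant_def)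
    define V' where "V' = {v \<in> V. \<forall>c\<in>C. v \<bullet> c = 0}"
    have V': "invariant_subspace \<T> V'"
      unfolding invariant_subspace_def subspace_def
    proof (intro conjI ballI allI)
      show "0 \<in> V'" using subspace_0[OF subV] by (simp add: V'_def)
      show "x + y \<in> V'" if "x \<in> V'" "y \<in> V'" for x y
        using that subspace_add[OF subV] by (simp add: V'_def inner_add_left)
      show "c *\<^sub>R x \<in> V'" if "x \<in> V'" for c x
        using that subspace_scale[OF subV] by (simp add: V'_def)
      show "g v \<in> V'" if "g \<in> \<T>" "v \<in> V'" for g v
        using that gV gC isometry_inv by (simp add: V'_def isometry_adjoint)
    qed
    have "dim V' < dim V"
    proof (rule ccontr)
      assume "\<not> dim V' < dim V"
      moreover have "subspace V'" using V' by (simp add: invariant_subspace_def)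
      ultimately have "V' = V" using subspace_dim_equal[OF _ subV] by (auto simp: V'_def)
      moreover obtain c where c: "c \<in> C" "c \<noteq> 0" using C(2) sub subspace_0 by blast
      ultimately have "c \<in> V'" using C(3) by blast
      then have "c \<bullet> c = 0" using c(1) by (simp add: V'_def)
      then show False using c(2) by simp
    qed
    from less.hyps[OF this V'] obtain p' q' where pq': "p' \<in> V'" "q' \<in> V'"
      and span': "V' \<subseteq> span ((\<lambda>S. S p') ` commutant \<T> \<union> (\<lambda>S. S q') ` commutant \<T>)" by blast
    define p q where "p = p' + u" and "q = q' + w"
    define X where "X = (\<lambda>S. S p) ` commutant \<T> \<union> (\<lambda>S. S q) ` commutant \<T>"
    have \<pi>V': "\<pi> v = 0" if "v \<in> V'" for v using that by (intro \<pi>0) (simp add: V'_def)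
    have \<pi>pq: "\<pi> p = u" "\<pi> q = w"
      unfolding p_def q_def by (simp_all add: linear_add[OF lin\<pi>] \<pi>V' pq' \<pi>id uw)
    have CX: "C \<subseteq> span X"
      unfolding Cuw
    proof (rule span_mono[of "{u, w}" "span X", unfolded span_span])
      show "{u, w} \<subseteq> span X"
        using \<pi>S \<pi>pq by (auto simp: X_def intro!: span_base)
    qed
    define \<sigma> where "\<sigma> v = v - \<pi> v" for v
    have lin\<sigma>: "linear \<sigma>" unfolding \<sigma>_def[abs_def] by (intro linear_compose_sub linear_id[unfolded id_def] lin\<pi>)
    have \<sigma>pq: "\<sigma> p = p'" "\<sigma> q = q'" by (simp_all add: \<sigma>_def \<pi>pq) (simp_all add: p_def q_def)
    have V'X: "V' \<subseteq> span X"
    proof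
      fix s assume s: "s \<in> V'"
      have "\<sigma> s = s" using \<pi>V'[OF s] by (simp add: \<sigma>_def)
      moreover have "\<sigma> s \<in> \<sigma> ` span ((\<lambda>S. S p') ` commutant \<T> \<union> (\<lambda>S. S q') ` commutant \<T>)"
        using s span' by blast
      moreover have "\<sigma> ` span ((\<lambda>S. S p') ` commutant \<T> \<union> (\<lambda>S. S q') ` commutant \<T>) \<subseteq> span X"
        unfolding linear_span_image[OF lin\<sigma>, symmetric]
      proof (rule span_mono)
        \<comment> \<open>Sandwiching \<open>S\<close> between two copies of the complementary
          projection \<sigma> stays in the commutant and makes its value at \<open>p\<close> depend
          on \<open>p'\<close> only.\<close>
        have com: "(\<lambda>v. \<sigma> (S (\<sigma> v))) \<in> commutant \<T>" if S: "S \<in> commutant \<T>" for S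
        proof -
          have linS: "linear S" and symS: "\<And>u v. S u \<bullet> v = u \<bullet> S v"
            and comS: "\<And>g x. g \<in> \<T> \<Longrightarrow> S (g x) = g (S x)" using S by (auto simp: commutant_def)
          have sym\<sigma>: "\<sigma> x \<bullet> y = x \<bullet> \<sigma> y" for x y by (simp add: \<sigma>_def inner_diff_left inner_diff_right sym\<pi>)
          have com\<sigma>: "\<sigma> (g v) = g (\<sigma> v)" if "g \<in> \<T>" for g v
            using that by (simp add: \<sigma>_def com\<pi> linear_diff[OF isometry_linear])
          have "linear (\<lambda>v. \<sigma> (S (\<sigma> v)))"
            using linear_compose[OF linear_compose[OF lin\<sigma> linS] lin\<sigma>] by (simp add: o_def)
          then show ?thesis by (simp add: commutant_def sym\<sigma> symS com\<sigma> comS)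
        qed
        show "\<sigma> ` ((\<lambda>S. S p') ` commutant \<T> \<union> (\<lambda>S. S q') ` commutant \<T>) \<subseteq> X"
        proof
          fix y assume "y \<in> \<sigma> ` ((\<lambda>S. S p') ` commutant \<T> \<union> (\<lambda>S. S q') ` commutant \<T>)"
          then obtain S where S: "S \<in> commutant \<T>" "y = \<sigma> (S p') \<or> y = \<sigma> (S q')" by blast
          then have "y = (\<lambda>v. \<sigma> (S (\<sigma> v))) p \<or> y = (\<lambda>v. \<sigma> (S (\<sigma> v))) q" by (simp add: \<sigma>pq)
          then show "y \<in> X" unfolding X_def using com[OF S(1)] by (elim disjE) (rule UnI1 UnI2, erule image_eqI, assumption)+
        qed
      qed
      ultimately show "s \<in> span X" by auto
    qed
    have "V \<subseteq> span X"
    proof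
      fix v assume v: "v \<in> V"
      have "v - \<pi> v \<in> V'" using v \<pi>C C(3) perp by (auto simp: V'_def intro!: subspace_diff[OF subV])
      then have "\<pi> v + (v - \<pi> v) \<in> span X" using \<pi>C CX V'X by (intro span_add) auto
      then show "v \<in> span X" by simp
    qed
    moreover have "p \<in> V" "q \<in> V"
      using pq' uw C(3) by (auto simp: p_def q_def V'_def intro!: subspace_add[OF subV])
    ultimately show ?thesis unfolding X_def by blast
  qed
qed

end

subsection \<open>Orbits of the identity component\<close>

context
  fixes G :: "('a::euclidean_space \<Rightarrow> 'a) set"
  assumes G: "orthogonal_subgroup G" and comp: "compact G"
begin

text \<open>Pointwise convergence alone does not make composition jointly continuous. Isometries are
  equicontinuous, so the triangle inequality through \<open>fst p (snd p0 z)\<close> controls both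
  arguments.\<close>

lemma continuous_on_composition:
  "continuous_on (G \<times> G) (\<lambda>p. fst p \<circ> snd p)"
proof (rule continuous_on_coordinatewise_then_product)
  fix z :: 'a
  have c: "continuous_on S (\<lambda>g::'a \<Rightarrow> 'a. g y)" for y S
    by (rule continuous_on_subset[OF continuous_on_product_coordinates]) simp
  show "continuous_on (G \<times> G) (\<lambda>p. (fst p \<circ> snd p) z)"
    unfolding continuous_on_def
  proof
    fix p0 assume p0: "p0 \<in> G \<times> G"
    let ?F = "at p0 within G \<times> G"
    have l1: "((\<lambda>p. snd p z) \<longlongrightarrow> snd p0 z) ?F"
      using continuous_on_compose2[OF c[of UNIV z] continuous_on_snd[OF continuous_on_id], of "G \<times> G"] p0
      by (auto simp: continuous_on_def)
    have l2: "((\<lambda>p. fst p (snd p0 z)) \<longlongrightarrow> fst p0 (snd p0 z)) ?F"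
      using continuous_on_compose2[OF c[of UNIV "snd p0 z"] continuous_on_fst[OF continuous_on_id], of "G \<times> G"] p0
      by (auto simp: continuous_on_def)
    have lim: "((\<lambda>p. dist (snd p z) (snd p0 z) + dist (fst p (snd p0 z)) (fst p0 (snd p0 z))) \<longlongrightarrow> 0 + 0) ?F"
      by (intro tendsto_add tendsto_dist_iff[THEN iffD1] l1 l2)
    have ev: "eventually (\<lambda>p. norm (dist ((fst p \<circ> snd p) z) ((fst p0 \<circ> snd p0) z))
        \<le> dist (snd p z) (snd p0 z) + dist (fst p (snd p0 z)) (fst p0 (snd p0 z))) ?F"
      unfolding eventually_at_filter
    proof (rule always_eventually, intro allI impI)
      fix p assume "p \<in> G \<times> G"
      then have "orthogonal_transformation (fst p)" using group_orthogonal[OF G] by auto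
      then have "dist (fst p (snd p z)) (fst p (snd p0 z)) = dist (snd p z) (snd p0 z)"
        by (simp add: dist_norm orthogonal_transformation linear_diff[symmetric])
      then show "norm (dist ((fst p \<circ> snd p) z) ((fst p0 \<circ> snd p0) z))
        \<le> dist (snd p z) (snd p0 z) + dist (fst p (snd p0 z)) (fst p0 (snd p0 z))"
        using dist_triangle[of "fst p (snd p z)" "fst p0 (snd p0 z)" "fst p (snd p0 z)"] by simp
    qed
    from Lim_null_comparison[OF ev lim[unfolded add_0]]
    have "((\<lambda>p. dist ((fst p \<circ> snd p) z) ((fst p0 \<circ> snd p0) z)) \<longlongrightarrow> 0) ?F" .
    then show "((\<lambda>p. (fst p \<circ> snd p) z) \<longlongrightarrow> (fst p0 \<circ> snd p0) z) ?F"
      by (rule tendsto_dist_iff[THEN iffD2])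
  qed
qed

lemma Hausdorff_group: "Hausdorff_space (top_of_set G)"
proof -
  have "Hausdorff_space (product_topology (\<lambda>_::'a. euclidean :: 'a topology) UNIV)"
    by (simp add: Hausdorff_space_product_topology Hausdorff_space_euclidean)
  then show ?thesis by (simp add: euclidean_product_topology Hausdorff_space_subtopology)
qed

text \<open>The orbit space of the identity component on \<open>G x\<close> is totally disconnected: two points of
  \<open>G x\<close> in different orbits are separated by a clopen subset of \<open>G\<close>, which can be made invariant
  under the stabilizer of \<open>x\<close>.\<close>

lemma connected_subset_component_orbit:
  assumes C: "connected C" "C \<subseteq> orbit G x" and x: "x \<in> C" and y: "y \<in> C"
  shows "y \<in> orbit (connected_component_set G id) x"
proof (rule ccontr)
  assume ny: "y \<notin> orbit (connected_component_set G id) x"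
  define K0 where "K0 = {g \<in> G. g x = x}"
  define K1 where "K1 = {g \<in> G. g x = y}"
  have cx: "continuous_on S (\<lambda>g::'a \<Rightarrow> 'a. g z)" for z S
    by (rule continuous_on_subset[OF continuous_on_product_coordinates]) simp
  have closedK: "closedin (top_of_set G) {g \<in> G. g x = z}" for z
    using continuous_closedin_preimage_constant[OF cx, of G x z] by simp
  \<comment> \<open>In a compact Hausdorff space, two closed sets that no connected set joins lie on
    different sides of a clopen partition.\<close>
  have "separated_between (top_of_set G) K0 K1"
  proof (rule cut_wire_fence_theorem)
    show "compact_space (top_of_set G)" using comp by (simp add: compact_space_subtopology)
    show "Hausdorff_space (top_of_set G)" by (rule Hausdorff_group)
    show "closedin (top_of_set G) K0" "closedin (top_of_set G) K1" unfolding K0_def K1_def by (rule closedK)+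
    fix D assume "connectedin (top_of_set G) D"
    then have D: "connected D" "D \<subseteq> G" by (auto simp: connectedin_subtopology)
    show "disjnt D K0 \<or> disjnt D K1"
    proof (rule ccontr)
      assume "\<not> (disjnt D K0 \<or> disjnt D K1)"
      then obtain g0 g1 where g0: "g0 \<in> D" "g0 \<in> G" "g0 x = x" and g1: "g1 \<in> D" "g1 \<in> G" "g1 x = y"
        by (auto simp: disjnt_iff K0_def K1_def)
      \<comment> \<open>Right translation by \<open>inv g0\<close> moves \<open>D\<close> to a
        connected set through \<open>id\<close>, so an element of the identity component would carry
        \<open>x\<close> to \<open>y\<close>.\<close>
      have "continuous_on D (\<lambda>g. g \<circ> inv g0)"
        by (rule continuous_on_coordinatewise_then_product) (simp add: cx)
      then have "connected ((\<lambda>g. g \<circ> inv g0) ` D)" using D(1) connected_continuous_image by blast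
      moreover have "(\<lambda>g. g \<circ> inv g0) ` D \<subseteq> G"
        using D(2) group_comp[OF G _ group_inv[OF G g0(2)]] by blast
      moreover have "id \<in> (\<lambda>g. g \<circ> inv g0) ` D"
        by (rule image_eqI[OF _ g0(1)]) (auto simp: group_inv_apply[OF G g0(2)])
      moreover have "g1 \<circ> inv g0 \<in> (\<lambda>g. g \<circ> inv g0) ` D" using g1(1) by blast
      ultimately have "g1 \<circ> inv g0 \<in> connected_component_set G id"
        unfolding connected_component_def by blast
      moreover have "inv g0 x = x" using group_inv_apply(1)[OF G g0(2), of x] g0(3) by simp
      then have "(g1 \<circ> inv g0) x = y" using g1(3) by simp
      ultimately show False using ny unfolding orbit_def by blast
    qed
  qed
  then obtain U V where U: "openin (top_of_set G) U" and V: "openin (top_of_set G) V"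
    and UV: "U \<union> V = G" "disjnt U V" "K0 \<subseteq> U" "K1 \<subseteq> V"
    unfolding separated_between_def by auto
  have "closedin (top_of_set G) U" "closedin (top_of_set G) V"
  proof -
    have "G - V = U" "G - U = V" using UV by (auto simp: disjnt_iff)
    then show "closedin (top_of_set G) U" "closedin (top_of_set G) V"
      using U V by (metis closedin_diff closedin_topspace topspace_euclidean_subtopology)+
  qed
  then have cU: "closedin (top_of_set G) U" and cV: "compact V" using comp closedin_compact by blast+
  have cK0: "compact K0" unfolding K0_def by (rule closedin_compact[OF comp closedK])
  \<comment> \<open>\<open>V\<close> need not be a union of cosets of the stabilizer
    \<open>K0\<close>. Saturating it on the right makes membership depend on \<open>g x\<close>
    alone.\<close>
  define C1 where "C1 = (\<lambda>p. fst p \<circ> snd p) ` (V \<times> K0)"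
  define C0 where "C0 = G - C1"
  have VG: "V \<subseteq> G" and K0G: "K0 \<subseteq> G" using UV by (auto simp: K0_def)
  have cC1: "compact C1"
    unfolding C1_def
    by (rule compact_continuous_image[OF continuous_on_subset[OF continuous_on_composition] compact_Times[OF cV cK0]])
      (use VG K0G in auto)
  have C1G: "C1 \<subseteq> G" unfolding C1_def using group_comp[OF G subsetD[OF VG] subsetD[OF K0G]] by auto
  have K0_inv: "inv k \<in> K0" if "k \<in> K0" for k
  proof -
    have k: "k \<in> G" "k x = x" using that by (auto simp: K0_def)
    show ?thesis using group_inv[OF G k(1)] group_inv_apply(1)[OF G k(1), of x] by (simp add: K0_def k(2))
  qed
  have C1_iff: "g \<in> C1 \<longleftrightarrow> g \<in> G \<and> (\<exists>k\<in>K0. g \<circ> k \<in> V)" for g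
  proof
    assume "g \<in> C1"
    then obtain h k where hk: "h \<in> V" "k \<in> K0" "g = h \<circ> k" by (auto simp: C1_def)
    have "g \<circ> inv k = h" using hk group_inv_apply(2)[OF G, of k] by (auto simp: K0_def)
    then have "g \<circ> inv k \<in> V" using hk(1) by simp
    then show "g \<in> G \<and> (\<exists>k\<in>K0. g \<circ> k \<in> V)" using K0_inv[OF hk(2)] C1G \<open>g \<in> C1\<close> by blast
  next
    assume g: "g \<in> G \<and> (\<exists>k\<in>K0. g \<circ> k \<in> V)"
    then obtain k where k: "k \<in> K0" "g \<circ> k \<in> V" by blast
    have "g = (g \<circ> k) \<circ> inv k" using k group_inv_apply(2)[OF G, of k] by (auto simp: K0_def)
    then have "g = (\<lambda>p. fst p \<circ> snd p) (g \<circ> k, inv k)" by simp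
    moreover have "(g \<circ> k, inv k) \<in> V \<times> K0" using k K0_inv by blast
    ultimately show "g \<in> C1" unfolding C1_def by (rule image_eqI)
  qed
  \<comment> \<open>The complement of the saturation is an intersection of right translates of the
    closed set \<open>U\<close>, hence closed as well.\<close>
  have C0_eq: "C0 = G \<inter> (\<Inter>k\<in>K0. {g \<in> G. g \<circ> k \<in> U})"
  proof -
    have "g \<circ> k \<in> U \<longleftrightarrow> g \<circ> k \<notin> V" if "g \<in> G" "k \<in> K0" for g k
      using UV(1,2) group_comp[OF G, of g k] that K0G by (auto simp: disjnt_iff)
    then show ?thesis by (auto simp: C0_def C1_iff)
  qed
  have "closedin (top_of_set G) C0"
    unfolding C0_eq
  proof (rule closedin_Int)
    show "closedin (top_of_set G) G" by simp
    have "closedin (top_of_set G) {g \<in> G. g \<circ> k \<in> U}" if k: "k \<in> K0" for k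
    proof -
      have "continuous_on G (\<lambda>g. g \<circ> k)"
        by (rule continuous_on_coordinatewise_then_product) (simp add: cx)
      moreover have "(\<lambda>g. g \<circ> k) \<in> G \<rightarrow> G" using group_comp[OF G] k K0G by blast
      ultimately have "continuous_map (top_of_set G) (top_of_set G) (\<lambda>g. g \<circ> k)" by auto
      from closedin_continuous_map_preimage[OF this cU] show ?thesis by simp
    qed
    moreover have "K0 \<noteq> {}" using group_id[OF G] by (auto simp: K0_def)
    ultimately show "closedin (top_of_set G) (\<Inter>k\<in>K0. {g \<in> G. g \<circ> k \<in> U})" by (intro closedin_INT) auto
  qed
  then have cC0: "compact C0" by (rule closedin_compact[OF comp])
  have cE: "closed ((\<lambda>g. g x) ` C0)" "closed ((\<lambda>g. g x) ` C1)"
    by (intro compact_imp_closed compact_continuous_image[OF cx] cC0 cC1)+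
  have disj: "(\<lambda>g. g x) ` C0 \<inter> (\<lambda>g. g x) ` C1 = {}"
  proof (rule ccontr)
    assume "(\<lambda>g. g x) ` C0 \<inter> (\<lambda>g. g x) ` C1 \<noteq> {}"
    then obtain g h where gh: "g \<in> C0" "h \<in> C1" "g x = h x" by auto
    have g: "g \<in> G" "g \<notin> C1" using gh by (auto simp: C0_def)
    obtain k where k: "k \<in> K0" "h \<circ> k \<in> V" and h: "h \<in> G" using gh(2) C1_iff by blast
    define l where "l = inv g \<circ> (h \<circ> k)"
    have "l x = x" using gh(3) k group_inv_apply(1)[OF G g(1), of x] by (simp add: l_def K0_def flip: gh(3))
    moreover have "l \<in> G" unfolding l_def using g h k K0G by (intro group_comp[OF G] group_inv[OF G]) auto
    ultimately have "l \<in> K0" by (simp add: K0_def)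
    moreover have "g \<circ> l = h \<circ> k" by (auto simp: l_def group_inv_apply(2)[OF G g(1)])
    then have "g \<circ> l \<in> V" using k(2) by simp
    ultimately have "g \<in> C1" unfolding C1_iff using g(1) by blast
    then show False using g(2) by simp
  qed
  have cover: "C \<subseteq> (\<lambda>g. g x) ` C0 \<union> (\<lambda>g. g x) ` C1"
    using C(2) unfolding orbit_def C0_def by blast
  have "x \<in> (\<lambda>g. g x) ` C0"
  proof -
    have "k \<notin> V" if "k \<in> K0" for k using that UV by (auto simp: disjnt_iff)
    then have "id \<in> C0" using group_id[OF G] by (auto simp: C0_def C1_iff)
    then show ?thesis by (intro image_eqI[of _ _ id]) simp_all
  qed
  moreover have "y \<in> (\<lambda>g. g x) ` C1"
  proof -
    obtain g where g: "g \<in> G" "y = g x" using y C(2) by (auto simp: orbit_def)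
    then have "g \<in> V" using UV by (auto simp: K1_def)
    then have "g \<in> C1" using g(1) group_id[OF G] by (auto simp: C1_iff K0_def intro!: bexI[of _ id])
    then show ?thesis using g(2) by blast
  qed
  ultimately show False
    using C(1) cE disj cover x y unfolding connected_closed by blast
qed

lemma k_NS_torus:
  assumes torus: "is_torus (connected_component_set G id)" and k: "CARD('k::finite) \<ge> 2"
  shows "k_NS TYPE('k) G"
proof -
  define T where "T = connected_component_set G id"
  have TG: "T \<subseteq> G" unfolding T_def by (rule connected_component_subset)
  obtain n \<phi> \<psi> where hom: "homeomorphism (standard_torus n) T \<phi> \<psi>"
    and mult: "\<And>z w. z \<in> standard_torus n \<Longrightarrow> w \<in> standard_torus n \<Longrightarrow> \<phi> (\<lambda>i. z i * w i) = \<phi> z \<circ> \<phi> w"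
    using torus unfolding is_torus_def T_def by blast
  have commT: "g \<circ> h = h \<circ> g" if gh: "g \<in> T" "h \<in> T" for g h
  proof -
    have "T = \<phi> ` standard_torus n" using hom by (simp add: homeomorphism_def)
    then obtain z w where zw: "z \<in> standard_torus n" "w \<in> standard_torus n" "g = \<phi> z" "h = \<phi> w" using gh by blast
    then show ?thesis using mult[of z w] mult[of w z] by (simp add: mult.commute)
  qed
  \<comment> \<open>Inverses are adjoined directly; they commute with whatever the original maps
    commute with.\<close>
  define \<T> where "\<T> = T \<union> inv ` T"
  have \<T>G: "\<T> \<subseteq> G" unfolding \<T>_def using TG group_inv[OF G] by auto
  have bijT: "bij g" if "g \<in> \<T>" for g
    using \<T>G that group_orthogonal[OF G] orthogonal_transformation_bij by blast
  have inv_inv: "inv (inv g) = g" if "g \<in> T" for g using bijT[of g] that by (simp add: \<T>_def inv_inv_eq)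
  have c1: "g (h x) = h (g x)" if "g \<in> T" "h \<in> T" for g h x
    using fun_cong[OF commT[OF that], of x] by simp
  have c2: "g (inv h x) = inv h (g x)" if "g \<in> T" "h \<in> T" for g h x
  proof -
    have hG: "h \<in> G" using that TG by blast
    have "h (g (inv h x)) = g (h (inv h x))" using c1[OF that] by simp
    then have "inv h (h (g (inv h x))) = inv h (g x)" by (simp add: group_inv_apply[OF G hG])
    then show ?thesis by (simp add: group_inv_apply[OF G hG])
  qed
  have c3: "inv g (inv h x) = inv h (inv g x)" if "g \<in> T" "h \<in> T" for g h x
  proof -
    have gG: "g \<in> G" using that TG by blast
    have "g (inv h (inv g x)) = inv h x" using c2[OF that, of "inv g x"] by (simp add: group_inv_apply[OF G gG])
    then have "inv g (g (inv h (inv g x))) = inv g (inv h x)" by simp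
    then show ?thesis by (simp add: group_inv_apply[OF G gG])
  qed
  have comm: "g (h x) = h (g x)" if "g \<in> \<T>" "h \<in> \<T>" for g h x
    using that c1 c2 c3 unfolding \<T>_def by (auto)
  have invc: "inv g \<in> \<T>" if "g \<in> \<T>" for g
    using that inv_inv by (auto simp: \<T>_def)
  have orth: "orthogonal_transformation g" if "g \<in> \<T>" for g using that \<T>G group_orthogonal[OF G] by blast
  have ctx: "commuting_isometries \<T>"
    unfolding commuting_isometries_def using orth comm invc by blast
  have "invariant_subspace \<T> UNIV" by (simp add: invariant_subspace_def)
  then obtain p q where pq: "UNIV \<subseteq> span ((\<lambda>S. S p) ` commutant \<T> \<union> (\<lambda>S. S q) ` commutant \<T>)"
    using commutant_spans[OF ctx] by blast
  obtain i1 i2 :: 'k where i: "i1 \<noteq> i2"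
    using k card_le_Suc0_iff_eq[of "UNIV :: 'k set"] by (auto simp: not_less_eq_eq numeral_2_eq_2)
  \<comment> \<open>Two entries carry the pair \<open>p\<close>, \<open>q\<close>; all further
    entries repeat \<open>q\<close>.\<close>
  define x0 :: "'a ^ 'k" where "x0 = (\<chi> i. if i = i1 then p else q)"
  have NS: "S y \<in> normal_space (orbit G y) y" if S: "S \<in> commutant \<T>" for S y
  proof (rule normal_spaceI_quadratic)
    have S': "linear S" "\<And>u v. S u \<bullet> v = u \<bullet> S v" "\<And>g x. g \<in> \<T> \<Longrightarrow> S (g x) = g (S x)"
      using S by (auto simp: commutant_def)
    show "linear S" by (rule S')
    show "S u \<bullet> v = u \<bullet> S v" for u v by (rule S')
    fix \<gamma> :: "real \<Rightarrow> 'a" and \<epsilon> t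
    assume \<gamma>: "\<epsilon> > 0" "continuous_on {-\<epsilon><..<\<epsilon>} \<gamma>" "\<gamma> ` {-\<epsilon><..<\<epsilon>} \<subseteq> orbit G y" "\<gamma> 0 = y" "t \<in> {-\<epsilon><..<\<epsilon>}"
    have "connected (\<gamma> ` {-\<epsilon><..<\<epsilon>})" by (rule connected_continuous_image[OF \<gamma>(2)]) simp
    moreover have "y \<in> \<gamma> ` {-\<epsilon><..<\<epsilon>}" using \<gamma>(1,4) by (intro image_eqI[of _ _ 0]) auto
    moreover have "\<gamma> t \<in> \<gamma> ` {-\<epsilon><..<\<epsilon>}" using \<gamma>(5) by blast
    ultimately have "\<gamma> t \<in> orbit T y"
      unfolding T_def by (intro connected_subset_component_orbit[OF _ \<gamma>(3)])
    then obtain g where g: "g \<in> T" "\<gamma> t = g y" by (auto simp: orbit_def)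
    then have g\<T>: "g \<in> \<T>" by (simp add: \<T>_def)
    then show "\<gamma> t \<bullet> S (\<gamma> t) = y \<bullet> S y"
      using g(2) S'(3)[OF g\<T>] orth[OF g\<T>] by (simp add: orthogonal_transformation_def)
  qed
  show ?thesis
  proof (rule k_NSI[of "(\<lambda>S. S p) ` commutant \<T> \<union> (\<lambda>S. S q) ` commutant \<T>" x0])
    show "span ((\<lambda>S. S p) ` commutant \<T> \<union> (\<lambda>S. S q) ` commutant \<T>) = UNIV" using pq by blast
    fix v assume "v \<in> (\<lambda>S. S p) ` commutant \<T> \<union> (\<lambda>S. S q) ` commutant \<T>"
    then obtain S where S: "S \<in> commutant \<T>" "v = S p \<or> v = S q" by blast
    have "linear S" using S(1) by (simp add: commutant_def)
    moreover have "x0 $ i1 = p" "x0 $ i2 = q" using i by (auto simp: x0_def)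
    then have "\<exists>j. v = S (x0 $ j)" using S(2) by metis
    ultimately show "\<exists>i S. linear S \<and> v = S (x0 $ i) \<and> (\<forall>y. S y \<in> normal_space (orbit G y) y)"
      using NS[OF S(1)] by blast
  qed
qed

end

subsection \<open>Polarizations separate generic orbits\<close>

lemma diagonal_orthogonal_subgroup:
  fixes G :: "('a::euclidean_space \<Rightarrow> 'a) set"
  assumes G: "orthogonal_subgroup G"
  shows "orthogonal_subgroup (diagonal_action G :: ('a ^ 'k::finite \<Rightarrow> 'a ^ 'k) set)"
proof -
  define D where "D g v = (\<chi> i. g (v $ i))" for g :: "'a \<Rightarrow> 'a" and v :: "'a ^ 'k"
  have DG: "diagonal_action G = D ` G" by (simp add: diagonal_action_def D_def[abs_def])
  have "orthogonal_transformation (D g)" if g: "g \<in> G" for g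
  proof -
    note lin = group_linear[OF G g]
    have "linear (D g)"
      by (rule linearI) (simp_all add: D_def vec_eq_iff linear_add[OF lin] linear_cmul[OF lin])
    then show ?thesis
      using group_orthogonal[OF G g]
      by (simp add: orthogonal_transformation_def D_def inner_vec_def)
  qed
  moreover have "id \<in> D ` G"
    by (rule image_eqI[OF _ group_id[OF G]]) (simp add: D_def fun_eq_iff vec_eq_iff)
  moreover have "D g \<circ> D h \<in> D ` G" if "g \<in> G" "h \<in> G" for g h
    by (rule image_eqI[OF _ group_comp[OF G that]]) (simp add: D_def fun_eq_iff vec_eq_iff)
  moreover have "inv (D g) \<in> D ` G" if g: "g \<in> G" for g
  proof (rule image_eqI[OF _ group_inv[OF G g]])
    show "inv (D g) = D (inv g)"
      by (rule inv_equality) (simp_all add: D_def vec_eq_iff group_inv_apply[OF G g])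
  qed
  ultimately show ?thesis
    unfolding DG by (auto simp: orthogonal_subgroup_def orthogonal_group_def)
qed

lemma polarizations_subset_invariants:
  fixes G :: "('a::euclidean_space \<Rightarrow> 'a) set" and i0 :: "'k::finite"
  assumes G: "orthogonal_subgroup G"
  shows "generalized_polarizations i0 (invariant_polynomials G)
    \<subseteq> invariant_polynomials (diagonal_action G :: ('a ^ 'k \<Rightarrow> 'a ^ 'k) set)"
  unfolding generalized_polarizations_def
proof (rule hull_minimal)
  show "laplacian_algebra (invariant_polynomials (diagonal_action G :: ('a ^ 'k \<Rightarrow> 'a ^ 'k) set))"
    by (rule laplacian_algebra_invariants[OF diagonal_orthogonal_subgroup[OF G]])
  have "real_polynomial_function (\<lambda>v::'a ^ 'k. f (v $ i))" if "f \<in> invariant_polynomials G" for f i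
    using that by (intro real_polynomial_component) (simp add: invariant_polynomials_def polynomial_functions_def)
  moreover have "real_polynomial_function (\<lambda>v::'a ^ 'k. v $ i \<bullet> v $ j)" for i j
    by (intro real_polynomial_inner polynomial_function_vec_nth)
  moreover have "g u \<bullet> g v = u \<bullet> v" if "g \<in> G" for g u v
    using group_orthogonal[OF G that] by (simp add: orthogonal_transformation_def)
  ultimately show "{\<lambda>v. f (v $ i0) |f. f \<in> invariant_polynomials G} \<union> {\<lambda>v. v $ i \<bullet> v $ j |i j. True}
    \<subseteq> invariant_polynomials (diagonal_action G :: ('a ^ 'k \<Rightarrow> 'a ^ 'k) set)"
    by (auto simp: invariant_polynomials_def polynomial_functions_def diagonal_action_def)
qed

theorem invariants_eq_polarizations:
  fixes G :: "('a::euclidean_space \<Rightarrow> 'a) set" and i0 :: "'k::finite"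
  assumes G: "orthogonal_subgroup G" and comp: "compact G" and max: "maximal_in_orbit_class G"
    and NS: "k_NS TYPE('k) G"
  shows "generalized_polarizations i0 (invariant_polynomials G)
    = invariant_polynomials (diagonal_action G :: ('a ^ 'k \<Rightarrow> 'a ^ 'k) set)"
proof -
  define A where "A = invariant_polynomials G"
  define L where "L = generalized_polarizations i0 A"
  have A: "laplacian_algebra A" unfolding A_def by (rule laplacian_algebra_invariants[OF G])
  have Ap: "A \<subseteq> polynomial_functions" unfolding A_def invariant_polynomials_def by blast
  have L: "laplacian_algebra L" unfolding L_def by (rule generalized_polarizations_laplacian[OF Ap])
  \<comment> \<open>\<open>W F x\<close> is linear in \<open>F\<close>, so linear combinations of
    such vectors are again of this form, and invariants evaluated at them stay in
    \<open>L\<close>.\<close>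
  define W where "W F x = grad F x $ i0" for F :: "'a ^ 'k \<Rightarrow> real" and x
  have compW: "(\<lambda>x. f (W F x)) \<in> L" if "f \<in> A" "F \<in> L" for f F
    using generalized_polarizations_compose_grad[OF Ap that[unfolded L_def]] by (simp add: L_def W_def)
  have gradW: "\<exists>F\<in>L. \<forall>x. W F x = grad h (x $ i)" if "h \<in> A" for h i
    unfolding L_def W_def by (rule generalized_polarizations_grad[OF Ap that])
  have Wadd: "W (\<lambda>x. F x + H x) x = W F x + W H x" if "F \<in> L" "H \<in> L" for F H x
    using la_poly[OF L] that by (simp add: W_def grad_add)
  have Wcmul: "W (\<lambda>x. c * F x) x = c *\<^sub>R W F x" if "F \<in> L" for F c x
    using la_poly[OF L] that by (simp add: W_def grad_cmul)
  have Wsum: "W (\<lambda>x. \<Sum>j\<in>J. F j x) x = (\<Sum>j\<in>J. W (F j) x)" if "\<And>j. j \<in> J \<Longrightarrow> F j \<in> L"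
    for J and F :: "'j \<Rightarrow> 'a ^ 'k \<Rightarrow> real" and x
    using la_poly[OF L] that by (simp add: W_def grad_sum)
  have rA: "(\<lambda>u::'a. u \<bullet> u) \<in> A" by (rule la_norm[OF A])
  have hA: "(\<lambda>u::'a. (1/2) * (u \<bullet> u)) \<in> A" by (rule la_cmul[OF A rA])
  have gh: "grad (\<lambda>u::'a. (1/2) * (u \<bullet> u)) u = u" for u
    using grad_cmul[OF la_poly[OF A rA], of "1/2"] by (simp add: grad_norm)
  \<comment> \<open>The gradient of half the squared norm is the identity, so the entries of
    \<open>x\<close> are themselves values of \<open>W\<close>.\<close>
  have "\<exists>H\<in>L. \<forall>x. W H x = x $ i" for i using gradW[OF hA, of i] unfolding gh .
  then obtain H where H: "\<And>i. H i \<in> L" "\<And>i x. W (H i) x = x $ i" by metis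
  obtain x0 :: "'a ^ 'k" where x0: "\<And>v. \<exists>w. (\<forall>i. w i \<in> gradients A (x0 $ i)) \<and> v = (\<Sum>i\<in>UNIV. w i)"
    using k_NS_gradients[OF G comp NS] unfolding A_def by blast
  have "\<exists>F\<in>L. W F x0 = v" for v
  proof -
    obtain w where w: "\<And>i. w i \<in> gradients A (x0 $ i)" "v = (\<Sum>i\<in>UNIV. w i)" using x0 by blast
    have "\<forall>i. \<exists>F\<in>L. W F x0 = w i"
    proof
      fix i
      obtain h where h: "h \<in> A" "w i = grad h (x0 $ i)" using w(1)[of i] unfolding gradients_def by blast
      show "\<exists>F\<in>L. W F x0 = w i" using gradW[OF h(1), of i] h(2) by auto
    qed
    then obtain F where F: "\<And>i. F i \<in> L" "\<And>i. W (F i) x0 = w i" by metis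
    have "W (\<lambda>x. \<Sum>i\<in>UNIV. F i x) x0 = v" using Wsum[of UNIV F x0] F w(2) by simp
    then show ?thesis using la_sum[OF L, of UNIV F] F(1) by (intro bexI[of _ "\<lambda>x. \<Sum>i\<in>UNIV. F i x"]) auto
  qed
  then obtain F where F: "\<And>b. F b \<in> L" "\<And>b. W (F b) x0 = b" by metis
  define M where "M x v = (\<Sum>b\<in>Basis. (v \<bullet> b) *\<^sub>R W (F b) x)" for x v
  \<comment> \<open>The squared distance of the Gram matrix from the identity vanishes at
    \<open>x0\<close>, and \<open>q x < 1\<close> makes the vectors \<open>W (F b) x\<close> a
    basis.\<close>
  define q where "q x = (\<Sum>b\<in>Basis. \<Sum>c\<in>Basis. (W (F b) x \<bullet> W (F c) x - b \<bullet> c)\<^sup>2)" for x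
  \<comment> \<open>Composition with the squared norm yields only squares of such vectors; mixed
    inner products follow by polarization.\<close>
  have inner: "(\<lambda>x. W (F b) x \<bullet> W (F c) x) \<in> L" for b c
  proof -
    have "(\<lambda>x. (1/2) * (W (\<lambda>x. F b x + F c x) x \<bullet> W (\<lambda>x. F b x + F c x) x
        - W (F b) x \<bullet> W (F b) x - W (F c) x \<bullet> W (F c) x)) \<in> L"
      by (intro la_cmul[OF L] la_diff[OF L] compW[OF rA] la_add[OF L] F)
    moreover have "(1/2) * (W (\<lambda>x. F b x + F c x) x \<bullet> W (\<lambda>x. F b x + F c x) x
        - W (F b) x \<bullet> W (F b) x - W (F c) x \<bullet> W (F c) x) = W (F b) x \<bullet> W (F c) x" for x
      by (simp add: Wadd[OF F(1) F(1)] inner_add_left inner_add_right inner_commute)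
    ultimately show ?thesis by simp
  qed
  have q: "q \<in> L"
  proof -
    have "(\<lambda>x. (W (F b) x \<bullet> W (F c) x - b \<bullet> c)\<^sup>2) \<in> L" for b c
      unfolding power2_eq_square by (intro la_mult[OF L] la_diff[OF L] inner la_const[OF L])
    then show ?thesis unfolding q_def[abs_def] by (intro la_sum[OF L])
  qed
  show ?thesis
    unfolding A_def[symmetric] L_def[symmetric]
  proof (rule laplacian_algebra_eqI[OF L _ _ q])
    show "laplacian_algebra (invariant_polynomials (diagonal_action G :: ('a ^ 'k \<Rightarrow> 'a ^ 'k) set))"
      by (rule laplacian_algebra_invariants[OF diagonal_orthogonal_subgroup[OF G]])
    show "L \<subseteq> invariant_polynomials (diagonal_action G)"
      unfolding L_def A_def by (rule polarizations_subset_invariants[OF G])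
    show "q x0 < 1" by (simp add: q_def F)
    fix x y :: "'a ^ 'k" and b :: "'a ^ 'k \<Rightarrow> real"
    assume lev: "\<forall>l\<in>L. l x = l y" and qx: "q x < 1" and b: "b \<in> invariant_polynomials (diagonal_action G)"
    have linM: "linear (M z)" for z
      unfolding M_def by (intro linearI)
        (simp_all add: inner_add_left scaleR_add_left sum.distrib scaleR_sum_right)
    have bijx: "bij (M x)"
      unfolding M_def[abs_def] by (rule gram_bijective) (use qx in \<open>simp add: q_def\<close>)
    define FF where "FF v x = (\<Sum>b\<in>Basis. (v \<bullet> b) * F b x)" for v x
    have FF: "FF v \<in> L" for v unfolding FF_def[abs_def] by (intro la_sum[OF L] la_cmul[OF L] F)
    have WFF: "W (FF v) z = M z v" for v z
      unfolding FF_def[abs_def] M_def using Wsum[of Basis "\<lambda>b x. (v \<bullet> b) * F b x" z] la_cmul[OF L F(1)]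
      by (simp add: Wcmul[OF F(1)])
    have lev_f: "f (M x v) = f (M y v)" if "f \<in> A" for f v
      using bspec[OF lev compW[OF that FF[of v]]] by (simp only: WFF)
    \<comment> \<open>\<open>g\<close> maps the gradients at \<open>x\<close> to those at \<open>y\<close>. It is an isometry because \<open>|u|\<^sup>2\<close> is itself one
      of the invariants that it preserves.\<close>
    define g where "g u = M y (inv (M x) u)" for u
    have gM: "g (M x v) = M y v" for v using bijx by (simp add: g_def bij_def inv_f_f)
    have Msurj: "\<exists>v. u = M x v" for u using bijx by (metis bij_def surjD)
    have "linear g"
    proof (rule linearI)
      fix u u'
      obtain v v' where "u = M x v" "u' = M x v'" using Msurj by metis
      then show "g (u + u') = g u + g u'"
        using gM[of "v + v'"] by (simp add: linear_add[OF linM] gM)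
    next
      fix r u
      obtain v where "u = M x v" using Msurj by metis
      then show "g (r *\<^sub>R u) = r *\<^sub>R g u" using gM[of "r *\<^sub>R v"] by (simp add: linear_cmul[OF linM] gM)
    qed
    moreover have gf: "f (g u) = f u" if "f \<in> A" for f u
    proof -
      obtain v where "u = M x v" using Msurj by metis
      then show ?thesis using lev_f[OF that, of v] gM by simp
    qed
    then have "norm (g u) = norm u" for u using rA by (fastforce simp: norm_eq_sqrt_inner)
    ultimately have og: "orthogonal_transformation g" by (simp add: orthogonal_transformation)
    have gG: "g \<in> G" by (rule maximal_contains_symmetries[OF G comp max og]) (use gf in \<open>simp add: A_def\<close>)
    \<comment> \<open>With \<open>x $ i = M x v\<close>, the squared norm of
      \<open>M z v - z $ i\<close> is a function of \<open>z\<close> in \<open>L\<close>. It is zero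
      at \<open>x\<close>, hence also at \<open>y\<close>.\<close>
    have gx: "g (x $ i) = y $ i" for i
    proof -
      obtain v where v: "x $ i = M x v" using Msurj by metis
      have D: "(\<lambda>z. FF v z + (-1) * H i z) \<in> L" by (intro la_add[OF L] la_cmul[OF L] FF H)
      have WD: "W (\<lambda>z. FF v z + (-1) * H i z) z = M z v - z $ i" for z
        using Wadd[OF FF la_cmul[OF L H(1)], of v "-1" i z] Wcmul[OF H(1), of "-1" i z] by (simp add: WFF H(2))
      have "(M x v - x $ i) \<bullet> (M x v - x $ i) = (M y v - y $ i) \<bullet> (M y v - y $ i)"
        using bspec[OF lev compW[OF rA D]] by (simp only: WD)
      then have "M y v = y $ i" using v by simp
      then show ?thesis using v gM by simp
    qed
    have "b x = b (\<chi> i. g (x $ i))"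
      using b gG by (auto simp: invariant_polynomials_def diagonal_action_def)
    also have "(\<chi> i. g (x $ i)) = y" by (simp add: vec_eq_iff gx)
    finally show "b x = b y" .
  qed
qed

theorem theorem7:
  fixes G :: "('a::euclidean_space \<Rightarrow> 'a) set"
    and A :: "('a \<Rightarrow> real) set"
    and i0 :: "'k::finite"
  assumes "closed_orthogonal_subgroup G"
    and "A = invariant_polynomials G"
    and "CARD('k) \<ge> 2"
  shows "(maximal_in_orbit_class G \<and> k_NS TYPE('k) G \<longrightarrow>
            invariant_polynomials (diagonal_action G) = generalized_polarizations i0 A) \<and>
         (is_torus (connected_component_set G id) \<longrightarrow> k_NS TYPE('k) G) \<and>
         (CARD('k) \<ge> DIM('a) \<longrightarrow> k_NS TYPE('k) G)"
proof -
  have G: "orthogonal_subgroup G"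
    using assms(1) by (simp add: closed_orthogonal_subgroup_def)
  have comp: "compact G"
    using assms(1) by (rule compact_closed_orthogonal_subgroup)
  show ?thesis
    using invariants_eq_polarizations[OF G comp, of i0] k_NS_torus[OF G comp _ assms(3)] k_NS_large[OF G, where 'k = 'k]
    unfolding assms(2) by simp
qed

end
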